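(* Let $A\subseteq B\subseteq\{0,1\}$. Every map in $\mathsf{cSet}_A^+$ whose codomain is a comical set admits a weak connection structure with respect to $\Box_B$.
   Context: **Cubical sets.** For $A\subseteq\{0,1\}$, $\Box_A$ is the subcategory of the category of posets with objects $[1]^n$ ($n\ge 0$, $[1]=\{0<1\}$) and morphisms generated under composition by: faces $\partial_{i,\varepsilon}:[1]^{n-1}\to[1]^n$ ($1\le i\le n$, $\varepsilon\in\{0,1\}$; insert $\varepsilon$ as $i$-th coordinate); degeneracies $\sigma_i:[1]^n\to[1]^{n-1}$ ($1\le i\le n$; delete the $i$-th coordinate); and, for each $\varepsilon\in A$, connections $\gamma_{i,\varepsilon}:[1]^n\to[1]^{n-1}$ ($1\le i\le n-1$; replace $x_i,x_{i+1}$ by $\max\{x_i,x_{i+1}\}$ if $\varepsilon=0$, by $\min\{x_i,x_{i+1}\}$ if $\varepsilon=1$). $\mathsf{cSet}_A$ is the category of presheaves of sets on $\Box_A$, $\Box^n_A$ the representable at $[1]^n$; elements of $X_n=X([1]^n)$ are $n$-cubes. A cube is degenerate if it is in the image of a degeneracy or a connection of $\Box_A$. **Marked cubical sets.** An object of $\mathsf{cSet}_A^+$ is a pair $(X,eX)$ with $X\in\mathsf{cSet}_A$ and $eX\subseteq\bigcup_{n\ge1}X_n$ a set of "marked" cubes containing all degenerate cubes; morphisms are cubical maps preserving marked cubes. $\Box^n_A$ also denotes the marked cubical set with only degenerate cubes marked. A map is regular if a cube is marked iff its image is marked, and entire if its underlying cubical map is an isomorphism; a regular subcomplex inclusion is a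 regular monomorphism. $\tau_nX$ is obtained from $X$ by marking all cubes of dimension $>n$. **Comical sets.** Every monomorphism $\delta:[1]^m\to[1]^n$ of $\Box_A$ is uniquely a composite $\partial_{c_1,\varepsilon_1}\cdots\partial_{c_r,\varepsilon_r}$ with $c_1>\dots>c_r$. It is a critical face with respect to $\partial_{i,\varepsilon}$ if this composite contains none of: (1) $\partial_{i,\varepsilon}$ or $\partial_{i,1-\varepsilon}$; (2) for some $j>i$, $\partial_{j,\varepsilon}$ together with $\partial_{k,1-\varepsilon}$ for all $i<k<j$; (3) for some $j<i$, $\partial_{j,\varepsilon}$ together with $\partial_{k,1-\varepsilon}$ for all $j<k<i$. The comical cube $\Box^n_{A,i,\varepsilon}$ ($n\ge1$) is $\Box^n_A$ with all critical faces with respect to $\partial_{i,\varepsilon}$ marked; the comical open box $\sqcap^n_{A,i,\varepsilon}$ is its regular subcomplex whose non-degenerate cubes are all faces except $\mathrm{id}_{[1]^n}$ and $\partial_{i,\varepsilon}$; the inclusion is a comical open box inclusion. For $n\ge2$, $(\Box^n_{A,i,\varepsilon})'$ is obtained from $\Box^n_{A,i,\varepsilon}$ by marking all $(n-1)$-dimensional faces except $\partial_{i,\varepsilon}$; the entire map $(\Box^n_{A,i,\varepsilon})'\to\tau_{n-2}\Box^n_{A,i,\varepsilon}$ is a comical marking extension. A comical set is a marked cubical set with the right lifting property against all comical open box inclusions and comical marking extensions. **Weak connection structures.** For $A\subseteq B$, the inclusion $i:\Box_A\hookrightarrow\Box_B$ induces $i^*:\mathsf{cSet}_B^+\to\mathsf{cSet}_A^+$,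 which restricts structure maps, keeping the same cubes and the same marked cubes; $i_!$ is its left adjoint and $\eta:\mathrm{id}\Rightarrow i^*i_!$ the unit. A weak connection structure on a map $f:X\to Y$ in $\mathsf{cSet}_A^+$ (with respect to $\Box_B$) is a map $\Gamma_f:i^*i_!X\to Y$ in $\mathsf{cSet}_A^+$ with $\Gamma_f\circ\eta_X=f$. *)

theory Defs
  imports "HOL-Library.FuncSet"
begin

section \<open>The cube categories\<close>

text \<open>
  The poset \<open>[1] = {0 < 1}\<close> is \<^typ>\<open>bool\<close>, so that subsets of \<open>{0,1}\<close> are terms of type
  \<^typ>\<open>bool set\<close>, and \<open>[1]\<^sup>n\<close> is the set of boolean lists of length \<open>n\<close>.  Morphisms
  \<open>[1]\<^sup>m \<rightarrow> [1]\<^sup>n\<close> are functions that are \<^const>\<open>extensional\<close> on \<open>[1]\<^sup>m\<close>, so for fixed \<open>m\<close>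
  and \<open>n\<close> equality of morphisms is equality of HOL functions.  They are automatically
  monotone, being generated by monotone maps.  Coordinates are numbered from \<open>1\<close>, whereas
  list positions are numbered from \<open>0\<close>.
\<close>

type_synonym vmap = "bool list \<Rightarrow> bool list"

definition cube :: "nat \<Rightarrow> bool list set" where
  "cube n = {v. length v = n}"

definition idm :: "nat \<Rightarrow> vmap" where
  "idm n = (\<lambda>v\<in>cube n. v)"

definition face :: "nat \<Rightarrow> nat \<Rightarrow> bool \<Rightarrow> vmap" where
  "face n i \<epsilon> = (\<lambda>v\<in>cube (n - 1). take (i - 1) v @ [\<epsilon>] @ drop (i - 1) v)"

definition degen :: "nat \<Rightarrow> nat \<Rightarrow> vmap" where
  "degen n i = (\<lambda>v\<in>cube n. take (i - 1) v @ drop i v)"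

definition conn :: "nat \<Rightarrow> nat \<Rightarrow> bool \<Rightarrow> vmap" where
  "conn n i \<epsilon> = (\<lambda>v\<in>cube n.
     take (i - 1) v
     @ [if \<epsilon> then min (v ! (i - 1)) (v ! i) else max (v ! (i - 1)) (v ! i)]
     @ drop (i + 1) v)"

inductive box_mor :: "bool set \<Rightarrow> nat \<Rightarrow> nat \<Rightarrow> vmap \<Rightarrow> bool" for A :: "bool set" where
  ident: "box_mor A n n (idm n)"
| face: "1 \<le> i \<Longrightarrow> i \<le> n \<Longrightarrow> box_mor A (n - 1) n (face n i \<epsilon>)"
| degen: "1 \<le> i \<Longrightarrow> i \<le> n \<Longrightarrow> box_mor A n (n - 1) (degen n i)"
| conn: "\<epsilon> \<in> A \<Longrightarrow> 1 \<le> i \<Longrightarrow> i \<le> n - 1 \<Longrightarrow> box_mor A n (n - 1) (conn n i \<epsilon>)"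
| comp: "box_mor A k m \<psi> \<Longrightarrow> box_mor A m n \<phi> \<Longrightarrow> box_mor A k n (compose (cube k) \<phi> \<psi>)"

definition box_hom :: "bool set \<Rightarrow> nat \<Rightarrow> nat \<Rightarrow> vmap set" where
  "box_hom A m n = {\<phi>. box_mor A m n \<phi>}"


section \<open>Cubical sets and marked cubical sets\<close>

text \<open>
  For \<open>\<phi> : [1]\<^sup>m \<rightarrow> [1]\<^sup>n\<close>, the structure map \<open>\<phi>\<^sup>* : X\<^sub>n \<rightarrow> X\<^sub>m\<close> is \<open>act X m n \<phi>\<close>.
  Everything is graded by dimension, so the \<open>X\<^sub>n\<close> need not be disjoint and the set of
  marked cubes is given by its part in each dimension.
\<close>

record 'x cset =
  cubes :: "nat \<Rightarrow> 'x set"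
  act :: "nat \<Rightarrow> nat \<Rightarrow> vmap \<Rightarrow> 'x \<Rightarrow> 'x"

record 'x mcset = "'x cset" +
  marked :: "nat \<Rightarrow> 'x set"

definition cubical_set :: "bool set \<Rightarrow> ('x, 'z) cset_scheme \<Rightarrow> bool" where
  "cubical_set A X \<longleftrightarrow>
     (\<forall>m n. \<forall>\<phi>\<in>box_hom A m n. act X m n \<phi> \<in> cubes X n \<rightarrow> cubes X m) \<and>
     (\<forall>n. \<forall>x\<in>cubes X n. act X n n (idm n) x = x) \<and>
     (\<forall>k m n. \<forall>\<psi>\<in>box_hom A k m. \<forall>\<phi>\<in>box_hom A m n. \<forall>x\<in>cubes X n.
        act X k n (compose (cube k) \<phi> \<psi>) x = act X k m \<psi> (act X m n \<phi> x))"

definition degenerate :: "bool set \<Rightarrow> ('x, 'z) cset_scheme \<Rightarrow> nat \<Rightarrow> 'x set" where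
  "degenerate A X n =
     (\<Union>i\<in>{1..n}. act X n (n - 1) (degen n i) ` cubes X (n - 1)) \<union>
     (\<Union>i\<in>{1..n - 1}. \<Union>\<epsilon>\<in>A. act X n (n - 1) (conn n i \<epsilon>) ` cubes X (n - 1))"

definition marked_cubical_set :: "bool set \<Rightarrow> 'x mcset \<Rightarrow> bool" where
  "marked_cubical_set A X \<longleftrightarrow>
     cubical_set A X \<and>
     (\<forall>n. marked X n \<subseteq> cubes X n) \<and> marked X 0 = {} \<and>
     (\<forall>n. degenerate A X n \<subseteq> marked X n)"

text \<open>
  Maps are families of functions, of which only the values on cubes matter; accordingly,
  equality of maps is always tested on cubes.
\<close>

definition marked_map ::
  "bool set \<Rightarrow> 'x mcset \<Rightarrow> 'y mcset \<Rightarrow> (nat \<Rightarrow> 'x \<Rightarrow> 'y) \<Rightarrow> bool" where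
  "marked_map A X Y f \<longleftrightarrow>
     (\<forall>n. f n \<in> cubes X n \<rightarrow> cubes Y n) \<and>
     (\<forall>m n. \<forall>\<phi>\<in>box_hom A m n. \<forall>x\<in>cubes X n. f m (act X m n \<phi> x) = act Y m n \<phi> (f n x)) \<and>
     (\<forall>n. f n \<in> marked X n \<rightarrow> marked Y n)"

definition min_marked :: "bool set \<Rightarrow> 'x cset \<Rightarrow> 'x mcset" where
  "min_marked A X = \<lparr>cubes = cubes X, act = act X, marked = degenerate A X\<rparr>"

definition mark_also :: "'x mcset \<Rightarrow> (nat \<Rightarrow> 'x set) \<Rightarrow> 'x mcset" where
  "mark_also X S = X\<lparr>marked := \<lambda>n. marked X n \<union> S n\<rparr>"

definition regular_subcomplex :: "'x mcset \<Rightarrow> (nat \<Rightarrow> 'x set) \<Rightarrow> 'x mcset" where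
  "regular_subcomplex X S = X\<lparr>cubes := S, marked := \<lambda>n. marked X n \<inter> S n\<rparr>"

definition trunc :: "nat \<Rightarrow> 'x mcset \<Rightarrow> 'x mcset" where
  "trunc n X = mark_also X (\<lambda>m. if m > n then cubes X m else {})"

definition representable :: "bool set \<Rightarrow> nat \<Rightarrow> vmap cset" where
  "representable A n =
     \<lparr>cubes = \<lambda>m. box_hom A m n, act = \<lambda>k m \<psi> \<phi>. compose (cube k) \<phi> \<psi>\<rparr>"


section \<open>Comical sets\<close>

text \<open>
  A list \<open>[(c\<^sub>1,\<epsilon>\<^sub>1), \<dots>, (c\<^sub>r,\<epsilon>\<^sub>r)]\<close> with \<open>c\<^sub>1 > \<dots> > c\<^sub>r\<close> stands for the composite
  \<open>\<partial>\<^bsub>c\<^sub>1,\<epsilon>\<^sub>1\<^esub> \<cdots> \<partial>\<^bsub>c\<^sub>r,\<epsilon>\<^sub>r\<^esub> : [1]\<^bsup>n-r\<^esup> \<rightarrow> [1]\<^sup>n\<close>; since the indices decrease, this is the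
  inclusion of the face on which coordinate \<open>c\<^sub>j\<close> is constantly \<open>\<epsilon>\<^sub>j\<close>.
\<close>

definition face_words :: "nat \<Rightarrow> (nat \<times> bool) list set" where
  "face_words n = {w. sorted_wrt (>) (map fst w) \<and> fst ` set w \<subseteq> {1..n}}"

primrec face_comp :: "nat \<Rightarrow> (nat \<times> bool) list \<Rightarrow> vmap" where
  "face_comp n [] = idm n"
| "face_comp n (p # w) =
     compose (cube (n - Suc (length w))) (face n (fst p) (snd p)) (face_comp (n - 1) w)"

definition faces :: "nat \<Rightarrow> nat \<Rightarrow> vmap set" where
  "faces n k = {face_comp n w | w. w \<in> face_words n \<and> length w + k = n}"

definition critical_word :: "nat \<Rightarrow> bool \<Rightarrow> (nat \<times> bool) list \<Rightarrow> bool" where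
  "critical_word i \<epsilon> w \<longleftrightarrow>
     \<not> ((i, \<epsilon>) \<in> set w \<or> (i, \<not> \<epsilon>) \<in> set w) \<and>
     \<not> (\<exists>j>i. (j, \<epsilon>) \<in> set w \<and> (\<forall>k. i < k \<and> k < j \<longrightarrow> (k, \<not> \<epsilon>) \<in> set w)) \<and>
     \<not> (\<exists>j<i. (j, \<epsilon>) \<in> set w \<and> (\<forall>k. j < k \<and> k < i \<longrightarrow> (k, \<not> \<epsilon>) \<in> set w))"

definition critical_faces :: "nat \<Rightarrow> nat \<Rightarrow> bool \<Rightarrow> nat \<Rightarrow> vmap set" where
  "critical_faces n i \<epsilon> k =
     {face_comp n w | w. w \<in> face_words n \<and> length w + k = n \<and> critical_word i \<epsilon> w}"

definition comical_cube :: "bool set \<Rightarrow> nat \<Rightarrow> nat \<Rightarrow> bool \<Rightarrow> vmap mcset" where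
  "comical_cube A n i \<epsilon> =
     mark_also (min_marked A (representable A n)) (critical_faces n i \<epsilon>)"

text \<open>
  The open box consists of the cubes that factor through a face other than the identity and
  \<open>\<partial>\<^bsub>i,\<epsilon>\<^esub>\<close>, i.e. of these faces and their degeneracies.
\<close>

definition open_box :: "bool set \<Rightarrow> nat \<Rightarrow> nat \<Rightarrow> bool \<Rightarrow> vmap mcset" where
  "open_box A n i \<epsilon> = regular_subcomplex (comical_cube A n i \<epsilon>)
     (\<lambda>m. {compose (cube m) \<delta> \<psi> | k \<delta> \<psi>.
             \<delta> \<in> faces n k \<and> (k, \<delta>) \<notin> {(n, idm n), (n - 1, face n i \<epsilon>)} \<and>
             \<psi> \<in> box_hom A m k})"

definition comical_cube' :: "bool set \<Rightarrow> nat \<Rightarrow> nat \<Rightarrow> bool \<Rightarrow> vmap mcset" where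
  "comical_cube' A n i \<epsilon> = mark_also (comical_cube A n i \<epsilon>)
     (\<lambda>m. if m = n - 1 then faces n (n - 1) - {face n i \<epsilon>} else {})"

text \<open>The right lifting property of \<open>X\<close> (that is, of the map from \<open>X\<close> to the terminal object)
  against \<open>j : K \<rightarrow> L\<close>.\<close>

definition has_rlp ::
  "bool set \<Rightarrow> 'k mcset \<Rightarrow> 'l mcset \<Rightarrow> (nat \<Rightarrow> 'k \<Rightarrow> 'l) \<Rightarrow> 'x mcset \<Rightarrow> bool" where
  "has_rlp A K L j X \<longleftrightarrow>
     (\<forall>u. marked_map A K X u \<longrightarrow>
        (\<exists>v. marked_map A L X v \<and> (\<forall>n. \<forall>x\<in>cubes K n. v n (j n x) = u n x)))"

definition comical_set :: "bool set \<Rightarrow> 'x mcset \<Rightarrow> bool" where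
  "comical_set A X \<longleftrightarrow>
     marked_cubical_set A X \<and>
     (\<forall>n\<ge>1. \<forall>i\<in>{1..n}. \<forall>\<epsilon>.
        has_rlp A (open_box A n i \<epsilon>) (comical_cube A n i \<epsilon>) (\<lambda>_ x. x) X) \<and>
     (\<forall>n\<ge>2. \<forall>i\<in>{1..n}. \<forall>\<epsilon>.
        has_rlp A (comical_cube' A n i \<epsilon>) (trunc (n - 2) (comical_cube A n i \<epsilon>)) (\<lambda>_ x. x) X)"


section \<open>Change of cube category\<close>

definition i_star :: "bool set \<Rightarrow> 'x mcset \<Rightarrow> 'x mcset" where
  "i_star A Y = Y\<lparr>act := \<lambda>m n \<phi>. if \<phi> \<in> box_hom A m n then act Y m n \<phi> else undefined\<rparr>"

text \<open>
  The left adjoint of \<open>i\<^sup>*\<close> is the left Kan extension along the inclusion of cube categories: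
  its \<open>n\<close>-cubes are triples \<open>(m, \<phi>, x)\<close> with \<open>\<phi> : [1]\<^sup>n \<rightarrow> [1]\<^sup>m\<close> in the larger cube category
  and \<open>x\<close> an \<open>m\<close>-cube of \<open>X\<close>, standing for \<open>\<phi>\<^sup>*(\<eta> x)\<close>, modulo the equivalence relation
  generated by \<open>(m', \<alpha>\<phi>, x) \<sim> (m, \<phi>, \<alpha>\<^sup>*x)\<close> for \<open>\<alpha> : [1]\<^sup>m \<rightarrow> [1]\<^bsup>m'\<^esup>\<close> in the smaller one.
  The marked cubes are those that have to be marked, namely the degenerate ones and the images
  of marked cubes under the unit.  That this is the left adjoint is proved at the end.
\<close>

type_synonym 'x kan_cube = "(nat \<times> vmap \<times> 'x) set"

definition kan_carrier ::
  "bool set \<Rightarrow> 'x mcset \<Rightarrow> nat \<Rightarrow> (nat \<times> vmap \<times> 'x) set" where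
  "kan_carrier B X n = {(m, \<phi>, x). \<phi> \<in> box_hom B n m \<and> x \<in> cubes X m}"

inductive kan_step ::
  "bool set \<Rightarrow> bool set \<Rightarrow> 'x mcset \<Rightarrow> nat \<Rightarrow> nat \<times> vmap \<times> 'x \<Rightarrow> nat \<times> vmap \<times> 'x \<Rightarrow> bool"
  for A B X n where
  "\<phi> \<in> box_hom B n m \<Longrightarrow> \<alpha> \<in> box_hom A m m' \<Longrightarrow> x \<in> cubes X m' \<Longrightarrow>
   kan_step A B X n (m', compose (cube n) \<alpha> \<phi>, x) (m, \<phi>, act X m m' \<alpha> x)"

definition kan_class ::
  "bool set \<Rightarrow> bool set \<Rightarrow> 'x mcset \<Rightarrow> nat \<Rightarrow> nat \<times> vmap \<times> 'x \<Rightarrow> 'x kan_cube" where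
  "kan_class A B X n t = {s. equivclp (kan_step A B X n) t s}"

definition kan_ext :: "bool set \<Rightarrow> bool set \<Rightarrow> 'x mcset \<Rightarrow> 'x kan_cube cset" where
  "kan_ext A B X =
     \<lparr>cubes = \<lambda>n. kan_class A B X n ` kan_carrier B X n,
      act = \<lambda>k n \<psi> c. \<Union>(m, \<phi>, x)\<in>c. kan_class A B X k (m, compose (cube k) \<phi> \<psi>, x)\<rparr>"

definition eta :: "bool set \<Rightarrow> bool set \<Rightarrow> 'x mcset \<Rightarrow> nat \<Rightarrow> 'x \<Rightarrow> 'x kan_cube" where
  "eta A B X n x = kan_class A B X n (n, idm n, x)"

definition i_shriek :: "bool set \<Rightarrow> bool set \<Rightarrow> 'x mcset \<Rightarrow> 'x kan_cube mcset" where
  "i_shriek A B X =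
     mark_also (min_marked B (kan_ext A B X)) (\<lambda>n. eta A B X n ` marked X n)"

definition weak_connection_structure ::
  "bool set \<Rightarrow> bool set \<Rightarrow> 'x mcset \<Rightarrow> 'y mcset \<Rightarrow> (nat \<Rightarrow> 'x \<Rightarrow> 'y) \<Rightarrow>
   (nat \<Rightarrow> 'x kan_cube \<Rightarrow> 'y) \<Rightarrow> bool" where
  "weak_connection_structure A B X Y f \<Gamma> \<longleftrightarrow>
     marked_map A (i_star A (i_shriek A B X)) Y \<Gamma> \<and>
     (\<forall>n. \<forall>x\<in>cubes X n. \<Gamma> n (eta A B X n x) = f n x)"


section \<open>Consistency of the definitions\<close>

lemma face_in_hom: "1 \<le> i \<Longrightarrow> i \<le> n \<Longrightarrow> face n i \<epsilon> \<in> box_hom A (n - 1) n"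
  and degen_in_hom: "1 \<le> i \<Longrightarrow> i \<le> n \<Longrightarrow> degen n i \<in> box_hom A n (n - 1)"
  and conn_in_hom: "\<epsilon> \<in> A \<Longrightarrow> 1 \<le> i \<Longrightarrow> i \<le> n - 1 \<Longrightarrow> conn n i \<epsilon> \<in> box_hom A n (n - 1)"
  and idm_in_hom: "idm n \<in> box_hom A n n"
  and compose_in_hom: "\<psi> \<in> box_hom A k m \<Longrightarrow> \<phi> \<in> box_hom A m n \<Longrightarrow>
        compose (cube k) \<phi> \<psi> \<in> box_hom A k n"
  unfolding box_hom_def mem_Collect_eq by (rule box_mor.intros; assumption)+

lemma box_mor_ext_funcset:
  "box_mor A m n \<phi> \<Longrightarrow> \<phi> \<in> cube m \<rightarrow> cube n \<and> \<phi> \<in> extensional (cube m)"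
proof (induction rule: box_mor.induct)
  case (comp k m \<psi> n \<phi>)
  then show ?case using funcset_compose[of \<psi> "cube k" "cube m" \<phi> "cube n"] by simp
qed (unfold idm_def face_def degen_def conn_def,
    (intro conjI restrict_extensional; auto simp: cube_def)+)

lemma box_hom_funcset: "\<phi> \<in> box_hom A m n \<Longrightarrow> \<phi> \<in> cube m \<rightarrow> cube n"
  and box_hom_extensional: "\<phi> \<in> box_hom A m n \<Longrightarrow> \<phi> \<in> extensional (cube m)"
  by (auto simp: box_hom_def dest: box_mor_ext_funcset)

lemma box_hom_mono:
  assumes "A \<subseteq> B" shows "box_hom A m n \<subseteq> box_hom B m n"
proof -
  have "box_mor A m n \<phi> \<Longrightarrow> box_mor B m n \<phi>" for \<phi>
  proof (induction rule: box_mor.induct)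
    case (conn \<epsilon> i n)
    then show ?case using assms by (intro box_mor.conn) auto
  qed (intro box_mor.intros; assumption)+
  then show ?thesis by (auto simp: box_hom_def)
qed

lemma compose_idm_left: "\<phi> \<in> box_hom A m n \<Longrightarrow> compose (cube m) (idm n) \<phi> = \<phi>"
  unfolding idm_def by (rule Id_compose[OF box_hom_funcset box_hom_extensional])

lemma compose_idm_right: "\<phi> \<in> box_hom A m n \<Longrightarrow> compose (cube m) \<phi> (idm m) = \<phi>"
  unfolding idm_def by (rule compose_Id[OF box_hom_funcset box_hom_extensional])

lemma compose_box_assoc:
  "\<psi> \<in> box_hom A k m \<Longrightarrow>
   compose (cube k) (compose (cube m) \<alpha> \<phi>) \<psi> = compose (cube k) \<alpha> (compose (cube k) \<phi> \<psi>)"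
  by (rule compose_assoc[symmetric]) (rule box_hom_funcset)

lemma cubical_set_representable: "cubical_set A (representable A n)"
  unfolding cubical_set_def representable_def
  by (auto simp: compose_in_hom compose_idm_right compose_box_assoc[symmetric])

lemma degenerate_subset:
  assumes "cubical_set A X" shows "degenerate A X n \<subseteq> cubes X n"
proof -
  have "act X n (n - 1) \<phi> ` cubes X (n - 1) \<subseteq> cubes X n" if "\<phi> \<in> box_hom A n (n - 1)" for \<phi>
    using assms that unfolding cubical_set_def by blast
  note this[OF degen_in_hom] this[OF conn_in_hom]
  then show ?thesis
    unfolding degenerate_def by (intro Un_least UN_least) auto
qed

lemma degenerate_0: "degenerate A X 0 = {}"
  by (simp add: degenerate_def)

lemma cubical_set_cong:
  "cubes X = cubes Y \<Longrightarrow> act X = act Y \<Longrightarrow> cubical_set A X = cubical_set A Y"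
  by (simp add: cubical_set_def)

lemma degenerate_cong:
  "cubes X = cubes Y \<Longrightarrow> act X = act Y \<Longrightarrow> degenerate A X = degenerate A Y"
  by (simp add: degenerate_def fun_eq_iff)

lemma marked_cubical_set_min_marked:
  assumes "cubical_set A X" shows "marked_cubical_set A (min_marked A X)"
proof -
  have "cubical_set A (min_marked A X)"
    using assms cubical_set_cong[of "min_marked A X" X] by (simp add: min_marked_def)
  moreover have "degenerate A (min_marked A X) = degenerate A X"
    by (rule degenerate_cong) (simp_all add: min_marked_def)
  ultimately show ?thesis
    using degenerate_subset[OF assms]
    by (simp add: marked_cubical_set_def degenerate_0) (simp add: min_marked_def degenerate_0)
qed

lemma marked_cubical_set_mark_also:
  assumes "marked_cubical_set A X" "\<And>n. S n \<subseteq> cubes X n" "S 0 = {}"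
  shows "marked_cubical_set A (mark_also X S)"
proof -
  have "cubical_set A (mark_also X S)"
    using assms cubical_set_cong[of "mark_also X S" X]
    by (simp add: mark_also_def marked_cubical_set_def)
  moreover have "degenerate A (mark_also X S) = degenerate A X"
    by (rule degenerate_cong) (simp_all add: mark_also_def)
  ultimately show ?thesis
    using assms unfolding marked_cubical_set_def by (auto simp: mark_also_def)
qed

lemma face_words_length:
  assumes "w \<in> face_words n"
  shows "length w \<le> n" and "length w = n \<Longrightarrow> fst ` set w = {1..n}"
proof -
  have "sorted_wrt (>) cs \<Longrightarrow> distinct cs" for cs :: "nat list"
    by (induction cs) auto
  then have "distinct (map fst w)"
    using assms by (simp add: face_words_def)
  then have c: "card (fst ` set w) = length w"
    by (metis distinct_card length_map list.set_map)
  have s: "fst ` set w \<subseteq> {1..n}" using assms by (simp add: face_words_def)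
  show "length w \<le> n" using card_mono[OF _ s] c by simp
  show "fst ` set w = {1..n}" if "length w = n"
    using card_subset_eq[OF _ s] c that by simp
qed

lemma face_comp_in_hom: "w \<in> face_words n \<Longrightarrow> face_comp n w \<in> box_hom A (n - length w) n"
proof (induction w arbitrary: n)
  case Nil
  then show ?case by (simp add: idm_in_hom)
next
  case (Cons p w)
  have *: "1 \<le> fst p" "fst p \<le> n" "\<forall>q\<in>set w. fst q < fst p" and "sorted_wrt (>) (map fst w)"
    "fst ` set w \<subseteq> {1..n}"
    using Cons.prems by (auto simp: face_words_def)
  then have "w \<in> face_words (n - 1)"
    unfolding face_words_def by fastforce
  from Cons.IH[OF this] have "face_comp (n - 1) w \<in> box_hom A (n - Suc (length w)) (n - 1)"
    by simp
  then show ?case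
    using compose_in_hom face_in_hom[OF *(1,2)] by simp
qed

lemma faces_in_hom: "\<delta> \<in> faces n k \<Longrightarrow> \<delta> \<in> box_hom A k n"
  unfolding faces_def using face_comp_in_hom by fastforce

lemma critical_faces_subset: "critical_faces n i \<epsilon> k \<subseteq> faces n k"
  by (auto simp: critical_faces_def faces_def)

lemma critical_faces_0:
  assumes "i \<in> {1..n}" shows "critical_faces n i \<epsilon> 0 = {}"
proof -
  have "\<not> critical_word i \<epsilon> w" if "w \<in> face_words n" "length w = n" for w
  proof -
    have "i \<in> fst ` set w" using face_words_length(2)[OF that] assms by simp
    then obtain e where "(i, e) \<in> set w" by force
    then show ?thesis by (cases "e = \<epsilon>") (auto simp: critical_word_def)
  qed
  then show ?thesis by (auto simp: critical_faces_def)
qed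

lemma marked_cubical_set_comical_cube:
  assumes "i \<in> {1..n}" shows "marked_cubical_set A (comical_cube A n i \<epsilon>)"
  unfolding comical_cube_def
proof (rule marked_cubical_set_mark_also)
  show "marked_cubical_set A (min_marked A (representable A n))"
    by (intro marked_cubical_set_min_marked cubical_set_representable)
  show "critical_faces n i \<epsilon> k \<subseteq> cubes (min_marked A (representable A n)) k" for k
    using critical_faces_subset faces_in_hom by (fastforce simp: min_marked_def representable_def)
qed (rule critical_faces_0[OF assms])

lemma marked_cubical_set_comical_cube':
  assumes "i \<in> {1..n}" "2 \<le> n"
  shows "marked_cubical_set A (comical_cube' A n i \<epsilon>)"
    and "marked_cubical_set A (trunc (n - 2) (comical_cube A n i \<epsilon>))"
proof -
  have "cubes (comical_cube A n i \<epsilon>) k = box_hom A k n" for k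
    by (simp add: comical_cube_def mark_also_def min_marked_def representable_def)
  then show "marked_cubical_set A (comical_cube' A n i \<epsilon>)"
    unfolding comical_cube'_def using assms
    by (intro marked_cubical_set_mark_also marked_cubical_set_comical_cube)
      (auto intro: faces_in_hom)
  show "marked_cubical_set A (trunc (n - 2) (comical_cube A n i \<epsilon>))"
    unfolding trunc_def using assms
    by (intro marked_cubical_set_mark_also marked_cubical_set_comical_cube) auto
qed

lemma marked_cubical_set_regular_subcomplex:
  assumes X: "marked_cubical_set A X" and S: "\<And>n. S n \<subseteq> cubes X n"
    and act: "\<And>m n \<phi> x. \<phi> \<in> box_hom A m n \<Longrightarrow> x \<in> S n \<Longrightarrow> act X m n \<phi> x \<in> S m"
  shows "marked_cubical_set A (regular_subcomplex X S)" (is "marked_cubical_set A ?S")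
proof -
  have simps: "cubes ?S = S" "act ?S = act X" "marked ?S n = marked X n \<inter> S n" for n
    by (simp_all add: regular_subcomplex_def)
  have cX: "cubical_set A X" using X by (simp add: marked_cubical_set_def)
  have c: "cubical_set A ?S"
    unfolding cubical_set_def simps
  proof (intro conjI allI ballI)
    show "act X m n \<phi> \<in> S n \<rightarrow> S m" if "\<phi> \<in> box_hom A m n" for m n \<phi>
      using act[OF that] by blast
    show "act X n n (idm n) x = x" if "x \<in> S n" for n x
      using cX subsetD[OF S that] unfolding cubical_set_def by blast
    show "act X k n (compose (cube k) \<phi> \<psi>) x = act X k m \<psi> (act X m n \<phi> x)"
      if "\<psi> \<in> box_hom A k m" "\<phi> \<in> box_hom A m n" "x \<in> S n" for k m n \<psi> \<phi> x
      using cX that(1,2) subsetD[OF S that(3)] unfolding cubical_set_def by blast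
  qed
  have "degenerate A ?S n \<subseteq> degenerate A X n" for n
    unfolding degenerate_def simps by (intro Un_mono UN_mono image_mono S order_refl)
  moreover have "degenerate A ?S n \<subseteq> S n" for n
    using degenerate_subset[OF c] by (simp add: simps)
  ultimately show ?thesis
    using X S c unfolding marked_cubical_set_def simps by blast
qed

lemma marked_cubical_set_open_box:
  assumes "i \<in> {1..n}" shows "marked_cubical_set A (open_box A n i \<epsilon>)"
  unfolding open_box_def
proof (rule marked_cubical_set_regular_subcomplex[OF marked_cubical_set_comical_cube[OF assms]],
    goal_cases)
  case (1 m)
  then show ?case
    by (auto simp: comical_cube_def mark_also_def min_marked_def representable_def
        intro!: compose_in_hom dest: faces_in_hom)
next
  case (2 m p \<chi> x)
  then obtain k \<delta> \<psi> where *: "\<delta> \<in> faces n k" "(k, \<delta>) \<notin> {(n, idm n), (n - 1, face n i \<epsilon>)}"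
    "\<psi> \<in> box_hom A p k" "x = compose (cube p) \<delta> \<psi>" by blast
  have "act (comical_cube A n i \<epsilon>) m p \<chi> x = compose (cube m) \<delta> (compose (cube m) \<psi> \<chi>)"
    using 2(1) by (simp add: * comical_cube_def mark_also_def min_marked_def representable_def
        compose_box_assoc)
  with * compose_in_hom[OF 2(1) *(3)] show ?case by blast
qed

lemma kan_class_eq_iff:
  "kan_class A B X n s = kan_class A B X n t \<longleftrightarrow> equivclp (kan_step A B X n) s t"
  unfolding kan_class_def
  by (metis (mono_tags, lifting) Collect_cong equivclp_refl equivclp_sym equivclp_trans mem_Collect_eq)

lemma kan_class_self: "t \<in> kan_class A B X n t"
  by (simp add: kan_class_def)

lemma equivclp_invariant:
  assumes "equivclp r s t" and "\<And>s t. r s t \<Longrightarrow> F s = F t"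
  shows "F s = F t"
  using assms(1) by (induction rule: equivclp_induct) (use assms(2) in \<open>fastforce+\<close>)

lemma kan_step_invariant:
  assumes "s \<in> kan_class A B X n t" and "\<And>s t. kan_step A B X n s t \<Longrightarrow> F s = F t"
  shows "F s = F t"
  using assms equivclp_invariant[of "kan_step A B X n" t s F] by (simp add: kan_class_def)

lemma kan_step_eq:
  assumes "\<phi> \<in> box_hom B n m" "\<alpha> \<in> box_hom A m m'" "x \<in> cubes X m'"
  shows "kan_class A B X n (m', compose (cube n) \<alpha> \<phi>, x)
       = kan_class A B X n (m, \<phi>, act X m m' \<alpha> x)"
  unfolding kan_class_eq_iff using kan_step.intros[OF assms] by blast

lemma cubes_kan_ext:
  "cubes (kan_ext A B X) n = {kan_class A B X n (m, \<phi>, x) | m \<phi> x. \<phi> \<in> box_hom B n m \<and> x \<in> cubes X m}"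
  by (auto simp: kan_ext_def kan_carrier_def)

lemma kan_ext_cubeI:
  "\<phi> \<in> box_hom B n m \<Longrightarrow> x \<in> cubes X m \<Longrightarrow>
   kan_class A B X n (m, \<phi>, x) \<in> cubes (kan_ext A B X) n"
  by (auto simp: cubes_kan_ext)

lemma act_kan_ext:
  assumes "\<psi> \<in> box_hom B k n"
  shows "act (kan_ext A B X) k n \<psi> (kan_class A B X n (m, \<phi>, x))
       = kan_class A B X k (m, compose (cube k) \<phi> \<psi>, x)"
proof -
  define F where "F = (\<lambda>(m, \<phi>, x). kan_class A B X k (m, compose (cube k) \<phi> \<psi>, x))"
  have F: "F s = F t" if "kan_step A B X n s t" for s t
    using that
  proof cases
    case (1 \<phi> m \<alpha> m' x)
    then show ?thesis
      using assms by (simp add: F_def compose_box_assoc kan_step_eq compose_in_hom)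
  qed
  have "act (kan_ext A B X) k n \<psi> (kan_class A B X n (m, \<phi>, x))
      = (\<Union>t\<in>kan_class A B X n (m, \<phi>, x). F t)"
    by (simp add: kan_ext_def F_def)
  also have "\<dots> = F (m, \<phi>, x)"
    using kan_step_invariant[of _ A B X n "(m, \<phi>, x)" F, OF _ F] kan_class_self by fast
  finally show ?thesis by (simp add: F_def)
qed

lemma cubical_set_kan_ext: "cubical_set B (kan_ext A B X)"
  unfolding cubical_set_def
proof (intro conjI allI ballI)
  fix m n \<phi> assume \<phi>: "\<phi> \<in> box_hom B m n"
  show "act (kan_ext A B X) m n \<phi> \<in> cubes (kan_ext A B X) n \<rightarrow> cubes (kan_ext A B X) m"
  proof
    fix c assume "c \<in> cubes (kan_ext A B X) n"
    then obtain p \<psi> x where "c = kan_class A B X n (p, \<psi>, x)" "\<psi> \<in> box_hom B n p" "x \<in> cubes X p"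
      by (auto simp: cubes_kan_ext)
    with \<phi> show "act (kan_ext A B X) m n \<phi> c \<in> cubes (kan_ext A B X) m"
      by (simp add: act_kan_ext kan_ext_cubeI compose_in_hom)
  qed
next
  fix n c assume "c \<in> cubes (kan_ext A B X) n"
  then show "act (kan_ext A B X) n n (idm n) c = c"
    by (auto simp: cubes_kan_ext act_kan_ext[OF idm_in_hom] compose_idm_right)
next
  fix k m n \<psi> \<phi> c
  assume "\<psi> \<in> box_hom B k m" "\<phi> \<in> box_hom B m n" "c \<in> cubes (kan_ext A B X) n"
  then show "act (kan_ext A B X) k n (compose (cube k) \<phi> \<psi>) c =
      act (kan_ext A B X) k m \<psi> (act (kan_ext A B X) m n \<phi> c)"
    by (auto simp: cubes_kan_ext act_kan_ext compose_in_hom compose_box_assoc)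
qed

lemma i_shriek_simps:
  "cubes (i_shriek A B X) = cubes (kan_ext A B X)"
  "act (i_shriek A B X) = act (kan_ext A B X)"
  "marked (i_shriek A B X) n = degenerate B (kan_ext A B X) n \<union> eta A B X n ` marked X n"
  by (simp_all add: i_shriek_def mark_also_def min_marked_def)

lemma i_star_simps:
  "cubes (i_star A Y) = cubes Y" "marked (i_star A Y) = marked Y"
  "\<phi> \<in> box_hom A m n \<Longrightarrow> act (i_star A Y) m n \<phi> = act Y m n \<phi>"
  by (simp_all add: i_star_def)

lemma eta_in_cubes: "x \<in> cubes X n \<Longrightarrow> eta A B X n x \<in> cubes (kan_ext A B X) n"
  unfolding cubes_kan_ext eta_def using idm_in_hom by blast

lemma act_eta:
  "\<phi> \<in> box_hom B n m \<Longrightarrow>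
   act (kan_ext A B X) n m \<phi> (eta A B X m x) = kan_class A B X n (m, \<phi>, x)"
  by (simp add: eta_def act_kan_ext compose_idm_left)

lemma marked_cubical_set_i_shriek:
  assumes "marked_cubical_set A X"
  shows "marked_cubical_set B (i_shriek A B X)"
  unfolding i_shriek_def
  using assms eta_in_cubes
  by (intro marked_cubical_set_mark_also marked_cubical_set_min_marked cubical_set_kan_ext)
    (fastforce simp: marked_cubical_set_def min_marked_def)+

lemma marked_cubical_set_i_star:
  assumes "A \<subseteq> B" "marked_cubical_set B Y"
  shows "marked_cubical_set A (i_star A Y)"
proof -
  note sub = box_hom_mono[OF assms(1), THEN subsetD]
  have Y: "cubical_set B Y" "\<And>n. marked Y n \<subseteq> cubes Y n" "marked Y 0 = {}"
    "\<And>n. degenerate B Y n \<subseteq> marked Y n"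
    using assms(2) by (simp_all add: marked_cubical_set_def)
  have "cubical_set A Y"
    unfolding cubical_set_def
  proof (intro conjI allI ballI)
    show "act Y m n \<phi> \<in> cubes Y n \<rightarrow> cubes Y m" if "\<phi> \<in> box_hom A m n" for m n \<phi>
      using Y(1) sub[OF that] unfolding cubical_set_def by blast
    show "act Y n n (idm n) x = x" if "x \<in> cubes Y n" for n x
      using Y(1) that unfolding cubical_set_def by blast
    show "act Y k n (compose (cube k) \<phi> \<psi>) x = act Y k m \<psi> (act Y m n \<phi> x)"
      if "\<psi> \<in> box_hom A k m" "\<phi> \<in> box_hom A m n" "x \<in> cubes Y n" for k m n \<psi> \<phi> x
      using Y(1) sub[OF that(1)] sub[OF that(2)] that(3) unfolding cubical_set_def by blast
  qed
  then have "cubical_set A (i_star A Y)"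
    unfolding cubical_set_def by (auto simp: i_star_simps compose_in_hom idm_in_hom)
  moreover have "degenerate A (i_star A Y) n \<subseteq> degenerate B Y n" for n
  proof -
    have "act (i_star A Y) n (n - 1) (degen n i) = act Y n (n - 1) (degen n i)" if "i \<in> {1..n}" for i
      using that by (intro i_star_simps degen_in_hom) auto
    moreover have "act (i_star A Y) n (n - 1) (conn n i \<epsilon>) = act Y n (n - 1) (conn n i \<epsilon>)"
      if "i \<in> {1..n - 1}" "\<epsilon> \<in> A" for i \<epsilon>
      using that by (intro i_star_simps conn_in_hom) auto
    ultimately show ?thesis
      using assms(1) unfolding degenerate_def i_star_simps
      by (intro Un_mono UN_mono order_refl) auto
  qed
  ultimately show ?thesis
    using Y(2-4) unfolding marked_cubical_set_def i_star_simps by blast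
qed

lemma marked_map_eta:
  assumes "A \<subseteq> B" "marked_cubical_set A X"
  shows "marked_map A X (i_star A (i_shriek A B X)) (eta A B X)"
  unfolding marked_map_def
proof (intro conjI allI ballI)
  fix m n \<phi> x assume *: "\<phi> \<in> box_hom A m n" "x \<in> cubes X n"
  then have \<phi>: "\<phi> \<in> box_hom B m n" using box_hom_mono[OF assms(1)] by blast
  have "eta A B X m (act X m n \<phi> x) = kan_class A B X m (n, compose (cube m) \<phi> (idm m), x)"
    unfolding eta_def using * by (intro kan_step_eq[symmetric] idm_in_hom)
  then show "eta A B X m (act X m n \<phi> x) = act (i_star A (i_shriek A B X)) m n \<phi> (eta A B X n x)"
    using * \<phi> by (simp add: i_star_simps i_shriek_simps act_eta compose_idm_right[OF \<phi>])
qed (auto simp: i_star_simps i_shriek_simps eta_in_cubes)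

text \<open>\<^term>\<open>eta A B X\<close> is a universal arrow from \<open>X\<close> to \<open>i\<^sup>*\<close>; hence \<open>i\<^sub>!\<close> is left adjoint to
  \<open>i\<^sup>*\<close> with unit \<open>\<eta>\<close>.\<close>

theorem eta_universal:
  fixes X :: "'x mcset" and Y :: "'y mcset"
  assumes AB: "A \<subseteq> B" and X: "marked_cubical_set A X" and Y: "marked_cubical_set B Y"
    and g: "marked_map A X (i_star A Y) g"
  shows "\<exists>h. marked_map B (i_shriek A B X) Y h \<and>
           (\<forall>n. \<forall>x\<in>cubes X n. h n (eta A B X n x) = g n x)"
    and "\<And>h h' n c. marked_map B (i_shriek A B X) Y h \<Longrightarrow> marked_map B (i_shriek A B X) Y h' \<Longrightarrow>
           \<forall>n. \<forall>x\<in>cubes X n. h n (eta A B X n x) = g n x \<Longrightarrow>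
           \<forall>n. \<forall>x\<in>cubes X n. h' n (eta A B X n x) = g n x \<Longrightarrow>
           c \<in> cubes (i_shriek A B X) n \<Longrightarrow> h n c = h' n c"
proof -
  have Yc: "\<And>m n \<phi> y. \<phi> \<in> box_hom B m n \<Longrightarrow> y \<in> cubes Y n \<Longrightarrow> act Y m n \<phi> y \<in> cubes Y m"
    and Yid: "\<And>n y. y \<in> cubes Y n \<Longrightarrow> act Y n n (idm n) y = y"
    and Yo: "\<And>k m n \<phi> \<psi> y. \<psi> \<in> box_hom B k m \<Longrightarrow> \<phi> \<in> box_hom B m n \<Longrightarrow> y \<in> cubes Y n \<Longrightarrow>
      act Y k n (compose (cube k) \<phi> \<psi>) y = act Y k m \<psi> (act Y m n \<phi> y)"
    using Y unfolding marked_cubical_set_def cubical_set_def by auto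
  have gc: "\<And>n x. x \<in> cubes X n \<Longrightarrow> g n x \<in> cubes Y n"
    and gn: "\<And>m n \<alpha> x. \<alpha> \<in> box_hom A m n \<Longrightarrow> x \<in> cubes X n \<Longrightarrow>
       g m (act X m n \<alpha> x) = act Y m n \<alpha> (g n x)"
    and gm: "\<And>n x. x \<in> marked X n \<Longrightarrow> g n x \<in> marked Y n"
    using g unfolding marked_map_def by (auto simp: i_star_simps)
  define F where "F n = (\<lambda>(m, \<phi>, x). act Y n m \<phi> (g m x))" for n
  define h where "h n c = F n (SOME t. t \<in> c)" for n c
  have inv: "F n s = F n t" if "kan_step A B X n s t" for n s t
    using that
  proof cases
    case (1 \<phi> m \<alpha> m' x)
    then show ?thesis
      using box_hom_mono[OF AB] by (simp add: F_def gn Yo gc subset_iff)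
  qed
  have h: "h n (kan_class A B X n t) = F n t" for n t
    unfolding h_def
    by (rule kan_step_invariant[OF someI[of "\<lambda>s. s \<in> kan_class A B X n t"] inv])
      (rule kan_class_self)
  have h_eta: "h n (eta A B X n x) = g n x" if "x \<in> cubes X n" for n x
    using that by (simp add: eta_def h F_def Yid gc)
  have hc: "h n c \<in> cubes Y n" if "c \<in> cubes (kan_ext A B X) n" for n c
    using that by (auto simp: cubes_kan_ext h F_def intro!: Yc gc)
  have hn: "h k (act (kan_ext A B X) k n \<psi> c) = act Y k n \<psi> (h n c)"
    if "\<psi> \<in> box_hom B k n" "c \<in> cubes (kan_ext A B X) n" for k n \<psi> c
    using that by (auto simp: cubes_kan_ext act_kan_ext h F_def Yo gc)
  have hd: "h n c \<in> degenerate B Y n" if c: "c \<in> degenerate B (kan_ext A B X) n" for n c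
  proof -
    consider i b where "i \<in> {1..n}" "b \<in> cubes (kan_ext A B X) (n - 1)"
        "c = act (kan_ext A B X) n (n - 1) (degen n i) b"
      | i \<epsilon> b where "i \<in> {1..n - 1}" "\<epsilon> \<in> B" "b \<in> cubes (kan_ext A B X) (n - 1)"
        "c = act (kan_ext A B X) n (n - 1) (conn n i \<epsilon>) b"
      using c unfolding degenerate_def by blast
    then show ?thesis
    proof cases
      case 1
      then have "degen n i \<in> box_hom B n (n - 1)" by (intro degen_in_hom) auto
      from hn[OF this 1(2)] have "h n c = act Y n (n - 1) (degen n i) (h (n - 1) b)"
        unfolding 1(3) .
      then have "h n c \<in> act Y n (n - 1) (degen n i) ` cubes Y (n - 1)"
        using hc[OF 1(2)] by (rule image_eqI)
      with 1(1) show ?thesis unfolding degenerate_def by (intro UnI1 UN_I)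
    next
      case 2
      then have "conn n i \<epsilon> \<in> box_hom B n (n - 1)" by (intro conn_in_hom) auto
      from hn[OF this 2(3)] have "h n c = act Y n (n - 1) (conn n i \<epsilon>) (h (n - 1) b)"
        unfolding 2(4) .
      then have "h n c \<in> act Y n (n - 1) (conn n i \<epsilon>) ` cubes Y (n - 1)"
        using hc[OF 2(3)] by (rule image_eqI)
      with 2(1,2) show ?thesis unfolding degenerate_def by (intro UnI2 UN_I)
    qed
  qed
  have "h n c \<in> marked Y n" if c: "c \<in> marked (i_shriek A B X) n" for n c
  proof -
    consider "c \<in> degenerate B (kan_ext A B X) n" | x where "x \<in> marked X n" "c = eta A B X n x"
      using c by (auto simp: i_shriek_simps)
    then show ?thesis
    proof cases
      case 1
      with hd Y show ?thesis unfolding marked_cubical_set_def by blast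
    next
      case 2
      moreover from this X have "x \<in> cubes X n" unfolding marked_cubical_set_def by blast
      ultimately show ?thesis by (simp add: h_eta gm)
    qed
  qed
  then have "marked_map B (i_shriek A B X) Y h"
    using hc hn unfolding marked_map_def by (simp add: i_shriek_simps(1,2))
  with h_eta show "\<exists>h. marked_map B (i_shriek A B X) Y h \<and>
      (\<forall>n. \<forall>x\<in>cubes X n. h n (eta A B X n x) = g n x)" by blast
next
  fix h h' n c
  assume hh: "marked_map B (i_shriek A B X) Y h" "marked_map B (i_shriek A B X) Y h'"
    "\<forall>n. \<forall>x\<in>cubes X n. h n (eta A B X n x) = g n x"
    "\<forall>n. \<forall>x\<in>cubes X n. h' n (eta A B X n x) = g n x"
    and "c \<in> cubes (i_shriek A B X) n"
  then obtain m \<phi> x where \<phi>: "\<phi> \<in> box_hom B n m" and x: "x \<in> cubes X m"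
    and "c = kan_class A B X n (m, \<phi>, x)"
    by (auto simp: i_shriek_simps cubes_kan_ext)
  then have c: "c = act (i_shriek A B X) n m \<phi> (eta A B X m x)"
    by (simp add: i_shriek_simps act_eta)
  have "eta A B X m x \<in> cubes (i_shriek A B X) m"
    using x by (simp add: i_shriek_simps eta_in_cubes)
  then have "h n c = act Y n m \<phi> (h m (eta A B X m x))"
    and "h' n c = act Y n m \<phi> (h' m (eta A B X m x))"
    using hh(1,2) \<phi> unfolding c marked_map_def by blast+
  with hh(3,4) x show "h n c = h' n c" by simp
qed

end

(* If A = {0,1} then B = A and the unit is invertible.  Otherwise A is contained in {e} for some e;
   write "join" for the connection with neutral element e (max for e = 0, min for e = 1).

   A weak connection structure is a family of cubes v(phi, x), for phi : [1]^n -> [1]^m in Box_B and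
   x an m-cube of X, natural in both variables and extending f.  One cell x of X at a time, such a
   family has to be extended from the phi having a constant coordinate, and the identity, to all
   phi.  The maps to be added are attached in pairs: if phi_j is the last coordinate that is not a
   variable, then phi is the missing face t = e of the open box phi_j join t, where t is a new
   variable inserted after the variables of phi_j.  A face of this cube on which only t is left in
   coordinate j fixes the other variables of phi_j at a vertex where phi_j = e; this is not the
   vertex (1 - e, ..., 1 - e), so the face violates condition (3) and is not critical.  All
   remaining critical faces are degenerate for Box_B, hence marked.

   For A = {e} the cubes phi_j join t are again in Box_B, and x join t is degenerate.  For A = {}
   the operation phi_j join t is formal: its face phi_j = e is a new edge E(t) parallel to the
   variable t, and x join E(t) is attached together with E(t), as the open box whose missing face
   is x = e.

   Only monotonicity of the coordinates of phi and the order of their variables matter. *)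

theory Submission
  imports Defs
begin

section \<open>Lists of coordinates and morphisms of the cube category\<close>

text \<open>The pairing cannot use ordinary variables throughout. For \<open>A = {}\<close> the cube
  with coordinate \<open>x\<close> join \<open>t\<close>, where \<open>t\<close> is an ordinary
  variable, has the projection \<open>x\<close> as its face \<open>t = e\<close>; nothing has to be
  filled there, so the cube would be left without a partner. Joining with the formal edge
  \<open>E(t)\<close> instead makes \<open>x\<close> join \<open>t\<close> one more coordinate to be
  filled. The order of attachment must be well-founded. A full nondegenerate face of an upper cell,
  other than the missing one, is either upper, and then belongs to a pair of lower dimension, or
  arises by putting \<open>x\<close> for \<open>E(t)\<close>, which lowers the number of nontrivial
  coordinates. The natural families of values at all labelled maps into [1]^m form, for varying m, a
  cubical set again, so that a weak connection structure becomes a lift of f along evaluation at the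
  identity. Every attachment of a cell needs that a degenerate cube determines its degeneracy; with
  at most one connection this follows because all morphisms of Box_A commute with join.\<close>

definition insert_at :: "nat \<Rightarrow> 'q \<Rightarrow> 'q list \<Rightarrow> 'q list" where
  "insert_at p a v = take p v @ a # drop p v"

definition delete_at :: "nat \<Rightarrow> 'q list \<Rightarrow> 'q list" where
  "delete_at p v = take p v @ drop (Suc p) v"

lemma length_insert_at [simp]: "length (insert_at p a v) = Suc (length v)"
  by (simp add: insert_at_def)

lemma length_delete_at: "p < length v \<Longrightarrow> length (delete_at p v) = length v - 1"
  by (simp add: delete_at_def)

lemma length_delete_at_Suc [simp]: "length v = Suc n \<Longrightarrow> p \<le> n \<Longrightarrow> length (delete_at p v) = n"
  by (simp add: delete_at_def)

lemma nth_insert_at: "p \<le> length v \<Longrightarrow> q \<le> length v \<Longrightarrow>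
    insert_at p a v ! q = (if q < p then v ! q else if q = p then a else v ! (q - 1))"
  by (auto simp: insert_at_def nth_append nth_Cons' min_def intro!: arg_cong[of _ _ "nth v"])

lemma nth_delete_at: "p < length v \<Longrightarrow> Suc q < length v \<Longrightarrow>
    delete_at p v ! q = (if q < p then v ! q else v ! Suc q)"
  by (auto simp: delete_at_def nth_append min_def)

lemma delete_at_insert_at: "p \<le> length v \<Longrightarrow> delete_at p (insert_at p a v) = v"
  by (rule nth_equalityI) (auto simp: length_delete_at nth_delete_at nth_insert_at)

lemma insert_at_delete_at: "p < length v \<Longrightarrow> insert_at p (v ! p) (delete_at p v) = v"
  by (rule nth_equalityI) (auto simp: length_delete_at nth_delete_at nth_insert_at)

text \<open>For \<open>e = False\<close> this is the maximum and for \<open>e = True\<close> the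
  minimum: \<open>e\<close> is the neutral element and \<open>\<not> e\<close> the absorbing
  one.\<close>

definition join :: "bool \<Rightarrow> bool \<Rightarrow> bool \<Rightarrow> bool" where
  "join e a b = (if a = e then b else a)"

lemma join_simps [simp]: "join e e b = b" "join e a e = a" "join e a a = a"
    "join e (\<not> e) b = (\<not> e)" "join e a (\<not> e) = (\<not> e)"
  by (auto simp: join_def)

definition merge_at :: "('q \<Rightarrow> 'q \<Rightarrow> 'q) \<Rightarrow> nat \<Rightarrow> 'q list \<Rightarrow> 'q list" where
  "merge_at f p v = (delete_at (Suc p) v)[p := f (v ! p) (v ! Suc p)]"

lemma length_merge_at [simp]: "length v = Suc n \<Longrightarrow> p < n \<Longrightarrow> length (merge_at f p v) = n"
  by (simp add: merge_at_def)

lemma nth_merge_at: "Suc p < length v \<Longrightarrow> Suc q < length v \<Longrightarrow>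
    merge_at f p v ! q = (if q < p then v ! q else if q = p then f (v ! p) (v ! Suc p) else v ! Suc q)"
  by (auto simp: merge_at_def nth_delete_at nth_list_update length_delete_at)

lemma mem_cube [simp]: "v \<in> cube n \<longleftrightarrow> length v = n"
  by (simp add: cube_def)

lemma face_eq: "face (Suc n) (Suc p) \<eta> = restrict (insert_at p \<eta>) (cube n)"
  by (rule ext) (simp add: face_def insert_at_def restrict_def)

lemma degen_eq: "degen (Suc n) (Suc p) = restrict (delete_at p) (cube (Suc n))"
  by (rule ext) (simp add: degen_def delete_at_def restrict_def)

lemma conn_eq: "p < n \<Longrightarrow> conn (Suc n) (Suc p) e = restrict (merge_at (join e) p) (cube (Suc n))"
  by (rule ext, auto simp: conn_def restrict_def join_def min_def max_def split: if_splits
      intro!: nth_equalityI) (auto simp: nth_merge_at nth_append join_def nth_Cons' min_def)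

lemma face_hom: "p \<le> n \<Longrightarrow> face (Suc n) (Suc p) \<eta> \<in> box_hom A n (Suc n)"
  using face_in_hom[of "Suc p" "Suc n"] by simp

lemma degen_hom: "p \<le> n \<Longrightarrow> degen (Suc n) (Suc p) \<in> box_hom A (Suc n) n"
  using degen_in_hom[of "Suc p" "Suc n"] by simp

lemma conn_hom: "e \<in> A \<Longrightarrow> p < n \<Longrightarrow> conn (Suc n) (Suc p) e \<in> box_hom A (Suc n) n"
  using conn_in_hom[of e A "Suc p" "Suc n"] by simp

text \<open>Reindexes the generators: dimension \<open>Suc n\<close> and position
  \<open>Suc p\<close> replace \<open>n - 1\<close> and the one-based \<open>i\<close>, so that the
  cases contain no truncated subtraction.\<close>

lemma box_hom_induct [consumes 1, case_names idm face degen conn comp]: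
  assumes "\<theta> \<in> box_hom A k n"
    and idm: "\<And>n. P n n (idm n)"
    and face: "\<And>n p \<eta>. p \<le> n \<Longrightarrow> P n (Suc n) (face (Suc n) (Suc p) \<eta>)"
    and degen: "\<And>n p. p \<le> n \<Longrightarrow> P (Suc n) n (degen (Suc n) (Suc p))"
    and conn: "\<And>n p e. e \<in> A \<Longrightarrow> p < n \<Longrightarrow> P (Suc n) n (conn (Suc n) (Suc p) e)"
    and comp: "\<And>k m n \<psi> \<phi>. \<psi> \<in> box_hom A k m \<Longrightarrow> \<phi> \<in> box_hom A m n \<Longrightarrow> P k m \<psi> \<Longrightarrow> P m n \<phi> \<Longrightarrow>
        P k n (compose (cube k) \<phi> \<psi>)"
  shows "P k n \<theta>"
proof -
  have "box_mor A k n \<theta>" using assms(1) by (simp add: box_hom_def)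
  then show ?thesis
  proof (induction rule: box_mor.induct)
    case (face i n \<eta>)
    then obtain n' p where "n = Suc n'" "i = Suc p" by (metis Suc_le_D One_nat_def le_trans)
    with face assms(3)[of p n' \<eta>] show ?case by simp
  next
    case (degen i n)
    then obtain n' p where "n = Suc n'" "i = Suc p" by (metis Suc_le_D One_nat_def le_trans)
    with degen assms(4)[of p n'] show ?case by simp
  next
    case (conn e i n)
    then obtain n' p where "n = Suc n'" "i = Suc p"
      by (metis Suc_le_D One_nat_def diff_le_self le_trans)
    with conn assms(5)[of e p n'] show ?case by simp
  next
    case (comp k m \<psi> n \<phi>)
    then show ?case using assms(6)[of \<psi> k m \<phi> n] by (simp add: box_hom_def)
  qed (rule idm)
qed

lemma box_hom_length: "\<theta> \<in> box_hom A k n \<Longrightarrow> length v = k \<Longrightarrow> length (\<theta> v) = n"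
  using box_hom_funcset[of \<theta> A k n] by (auto simp: Pi_iff)

lemma box_hom_ext: "\<theta> \<in> box_hom A k n \<Longrightarrow> \<theta>' \<in> box_hom A' k n' \<Longrightarrow>
    (\<And>v. length v = k \<Longrightarrow> \<theta> v = \<theta>' v) \<Longrightarrow> \<theta> = \<theta>'"
  by (rule extensionalityI[OF box_hom_extensional box_hom_extensional]) auto

lemma compose_cube [simp]: "length v = k \<Longrightarrow> compose (cube k) \<phi> \<psi> v = \<phi> (\<psi> v)"
  by (simp add: compose_def)

lemma idm_apply [simp]: "length v = n \<Longrightarrow> idm n v = v"
  by (simp add: idm_def)

lemma face_apply [simp]: "length v = n \<Longrightarrow> face (Suc n) (Suc p) \<eta> v = insert_at p \<eta> v"
  by (simp add: face_eq)

lemma degen_apply [simp]: "length v = Suc n \<Longrightarrow> degen (Suc n) (Suc p) v = delete_at p v"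
  by (simp add: degen_eq)

lemma conn_apply [simp]: "length v = Suc n \<Longrightarrow> p < n \<Longrightarrow> conn (Suc n) (Suc p) e v = merge_at (join e) p v"
  by (simp add: conn_eq)

section \<open>Dependence of coordinates on variables\<close>

definition depends :: "nat \<Rightarrow> ('q list \<Rightarrow> 'r list) \<Rightarrow> nat \<Rightarrow> nat \<Rightarrow> bool" where
  "depends n g i k \<longleftrightarrow> k < n \<and> (\<exists>w a. length w = n \<and> g w ! i \<noteq> g (w[k := a]) ! i)"

text \<open>In particular two coordinates share no variable, so that a variable can be assigned to
  the one coordinate that contains it.\<close>

definition ordered :: "nat \<Rightarrow> nat \<Rightarrow> ('q list \<Rightarrow> 'r list) \<Rightarrow> bool" where
  "ordered n m g \<longleftrightarrow> (\<forall>i i' k k'. i < i' \<and> i' < m \<and> depends n g i k \<and> depends n g i' k' \<longrightarrow> k < k')"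

text \<open>For a morphism of the cube category this means that it factors through no proper
  face.\<close>

definition full :: "nat \<Rightarrow> nat \<Rightarrow> ('q list \<Rightarrow> 'r list) \<Rightarrow> bool" where
  "full n m g \<longleftrightarrow> (\<forall>i<m. \<forall>\<eta>. \<exists>w. length w = n \<and> g w ! i \<noteq> \<eta>)"

text \<open>On the way from \<open>w\<close> to \<open>w'\<close>, changing one position at a time,
  the value has to change at some step; \<open>z q\<close> is the stage at which the first
  \<open>q\<close> positions have been replaced.\<close>

lemma depends_if_neq:
  assumes "length w = n" "length w' = n" "g w ! i \<noteq> g w' ! i"
  shows "\<exists>k<n. depends n g i k \<and> w ! k \<noteq> w' ! k"
proof (rule ccontr)
  assume nd: "\<not> ?thesis"
  define z where "z q = take q w' @ drop q w" for q
  have lz: "length (z q) = n" if "q \<le> n" for q using assms that by (simp add: z_def)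
  have "g (z q) ! i = g w ! i" if "q \<le> n" for q
    using that
  proof (induction q)
    case 0 then show ?case by (simp add: z_def)
  next
    case (Suc q)
    have z: "z (Suc q) = (z q)[q := w' ! q]"
      using Suc.prems assms(1,2)
      by (intro nth_equalityI) (auto simp: z_def nth_append nth_list_update min_def less_Suc_eq)
    have zq: "z q ! q = w ! q" using Suc.prems assms(1,2) by (simp add: z_def nth_append min_def)
    have "g (z (Suc q)) ! i = g (z q) ! i"
    proof (cases "w ! q = w' ! q")
      case True
      then have "z (Suc q) = z q" using z zq by (metis list_update_id)
      then show ?thesis by simp
    next
      case False
      with nd Suc.prems have "\<not> depends n g i q" by auto
      then show ?thesis using lz[of q] Suc.prems unfolding z depends_def by auto
    qed
    with Suc show ?case by simp
  qed
  from this[of n] assms show False by (simp add: z_def)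
qed

text \<open>Changing the variable \<open>c\<close> changes the inner value, and
  \<open>depends_if_neq\<close> finds an inner coordinate that both changes and matters to the outer
  map.\<close>

lemma depends_comp:
  assumes "depends k (\<lambda>w. g (s w)) i c" and "\<And>w. length w = k \<Longrightarrow> length (s w) = n"
  shows "\<exists>j. depends n g i j \<and> depends k s j c"
proof -
  obtain w a where w: "c < k" "length w = k" "g (s w) ! i \<noteq> g (s (w[c := a])) ! i"
    using assms(1) by (auto simp: depends_def)
  from depends_if_neq[OF assms(2) assms(2) this(3)] w obtain j where
    "depends n g i j" "s w ! j \<noteq> s (w[c := a]) ! j" by auto
  with w show ?thesis unfolding depends_def by auto
qed

lemma depends_cong: "(\<And>w. length w = n \<Longrightarrow> g w = g' w) \<Longrightarrow> depends n g = depends n g'"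
  unfolding depends_def fun_eq_iff
  by (intro allI conj_cong refl ex_cong1) simp

lemma ordered_cong: "(\<And>w. length w = n \<Longrightarrow> g w = g' w) \<Longrightarrow> ordered n m g = ordered n m g'"
  by (simp add: ordered_def depends_cong[of n g g'])

lemma ordered_comp:
  assumes "ordered n m g" "ordered k n s"
    and len: "\<And>w. length w = k \<Longrightarrow> length (s w) = n"
  shows "ordered k m (\<lambda>w. g (s w))"
  unfolding ordered_def
proof (intro allI impI, elim conjE)
  fix i i' c c' assume *: "i < i'" "i' < m" "depends k (\<lambda>w. g (s w)) i c"
    "depends k (\<lambda>w. g (s w)) i' c'"
  obtain j where j: "depends n g i j" "depends k s j c" using depends_comp[OF *(3) len] by blast
  obtain j' where j': "depends n g i' j'" "depends k s j' c'" using depends_comp[OF *(4) len] by blast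
  have "j < j'" using assms(1) * j(1) j'(1) unfolding ordered_def by blast
  moreover have "j' < n" using j' by (simp add: depends_def)
  ultimately show "c < c'" using assms(2) j(2) j'(2) unfolding ordered_def by blast
qed

lemma depends_insert_at: "depends n (insert_at p \<eta>) i k \<Longrightarrow> p \<le> n \<Longrightarrow> i \<le> n \<Longrightarrow>
  i = (if k < p then k else Suc k)"
  unfolding depends_def by (auto simp: nth_insert_at nth_list_update split: if_splits)

lemma depends_delete_at: "depends (Suc n) (delete_at p) i k \<Longrightarrow> p \<le> n \<Longrightarrow> i < n \<Longrightarrow>
  k = (if i < p then i else Suc i)"
  unfolding depends_def by (auto simp: nth_delete_at nth_list_update split: if_splits)

lemma depends_merge_at: "depends (Suc n) (merge_at f p) i k \<Longrightarrow> p < n \<Longrightarrow> i < n \<Longrightarrow>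
    (if i < p then k = i else if i = p then k \<in> {p, Suc p} else k = Suc i)"
  unfolding depends_def by (auto simp: nth_merge_at nth_list_update split: if_splits)

lemma ordered_insert_at: "p \<le> n \<Longrightarrow> ordered n (Suc n) (insert_at p \<eta>)"
  unfolding ordered_def by (auto dest!: depends_insert_at split: if_splits)

lemma ordered_delete_at: "p \<le> n \<Longrightarrow> ordered (Suc n) n (delete_at p)"
  unfolding ordered_def by (auto dest!: depends_delete_at split: if_splits)

lemma ordered_merge_at: "p < n \<Longrightarrow> ordered (Suc n) n (merge_at f p)"
  unfolding ordered_def by (auto dest!: depends_merge_at split: if_splits)

lemma ordered_box_hom: "\<theta> \<in> box_hom A k n \<Longrightarrow> ordered k n \<theta>"
proof (induction rule: box_hom_induct)
  case (idm n)
  have "depends n (\<lambda>v. v) i k \<Longrightarrow> i = k" for i k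
    by (metis depends_def nth_list_update_neq)
  then have "ordered n n (\<lambda>v. v)" by (auto simp: ordered_def)
  then show ?case using ordered_cong[of n "idm n" "\<lambda>v. v"] by simp
next
  case (face n p \<eta>)
  then show ?case using ordered_insert_at[of p n \<eta>] ordered_cong[of n "face (Suc n) (Suc p) \<eta>"
    "insert_at p \<eta>"]
    by simp
next
  case (degen n p)
  then show ?case using ordered_delete_at[of p n] ordered_cong[of "Suc n" "degen (Suc n) (Suc p)"
    "delete_at p"]
    by simp
next
  case (conn n p e)
  then show ?case using ordered_merge_at[of p n] ordered_cong[of "Suc n" "conn (Suc n) (Suc p) e"
    "merge_at (join e) p"]
    by simp
next
  case (comp k m n \<psi> \<phi>)
  then show ?case
    using ordered_comp[of m n \<phi> k \<psi>] box_hom_length[OF comp(1)]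
      ordered_cong[of k "compose (cube k) \<phi> \<psi>" "\<lambda>w. \<phi> (\<psi> w)"]
    by simp
qed

lemma box_hom_mono_le:
  assumes "\<theta> \<in> box_hom A k n"
  shows "length x = k \<Longrightarrow> length y = k \<Longrightarrow> (\<And>q. q < k \<Longrightarrow> x ! q \<le> y ! q) \<Longrightarrow> i < n \<Longrightarrow> \<theta> x ! i \<le> \<theta> y ! i"
  using assms
proof (induction arbitrary: x y i rule: box_hom_induct)
  case (comp k m n \<psi> \<phi>)
  have "\<phi> (\<psi> x) ! i \<le> \<phi> (\<psi> y) ! i"
    by (rule comp.IH(2)) (use comp.prems comp.IH(1)[of x y] box_hom_length[OF comp(1)] in blast)+
  then show ?case using comp.prems by simp
qed (auto simp: nth_insert_at nth_delete_at nth_merge_at join_def)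

text \<open>The restriction to a single connection enters here: \<open>join e\<close> commutes with
  its own connection, but not with the opposite one. For \<open>A = {}\<close> the result is
  available for both values of \<open>e\<close>.\<close>

lemma box_hom_join:
  assumes "\<theta> \<in> box_hom A k n" "A \<subseteq> {e}"
  shows "length x = k \<Longrightarrow> length y = k \<Longrightarrow> i < n \<Longrightarrow>
    \<theta> (map2 (join e) x y) ! i = join e (\<theta> x ! i) (\<theta> y ! i)"
  using assms(1)
proof (induction arbitrary: x y i rule: box_hom_induct)
  case (conn n p e')
  then have "e' = e" using assms(2) by auto
  with conn show ?case by (auto simp: nth_merge_at join_def)
next
  case (comp k m n \<psi> \<phi>)
  have "\<psi> (map2 (join e) x y) = map2 (join e) (\<psi> x) (\<psi> y)"
    using comp box_hom_length[OF comp(1)] by (intro nth_equalityI) auto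
  with comp show ?case using box_hom_length[OF comp(1)] by simp
qed (auto simp: nth_insert_at nth_delete_at)

text \<open>A constant coordinate can be deleted and reinserted.\<close>

lemma not_full_factor:
  assumes "\<theta> \<in> box_hom A k (Suc n)" "p \<le> n" "\<And>v. length v = k \<Longrightarrow> \<theta> v ! p = \<eta>"
  shows "\<theta> = compose (cube k) (face (Suc n) (Suc p) \<eta>) (compose (cube k) (degen (Suc n) (Suc p)) \<theta>)"
    (is "_ = ?r")
proof (rule box_hom_ext[OF assms(1)])
  show "?r \<in> box_hom A k (Suc n)"
    by (intro compose_in_hom[OF _ face_hom] compose_in_hom[OF assms(1) degen_hom] assms(2))
  fix v :: "bool list" assume v: "length v = k"
  then have "length (\<theta> v) = Suc n" using assms(1) box_hom_length by blast
  then show "\<theta> v = ?r v" using v assms(2) assms(3)[OF v] insert_at_delete_at[of p "\<theta> v"] by simp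
qed

lemma not_full_obtain:
  assumes "\<not> full k n \<theta>" "\<theta> \<in> box_hom A k n"
  obtains n' p \<eta> where "n = Suc n'" "p \<le> n'" "\<And>v. length v = k \<Longrightarrow> \<theta> v ! p = \<eta>"
proof -
  from assms(1) obtain i \<eta> where "i < n" "\<And>v. length v = k \<Longrightarrow> \<theta> v ! i = \<eta>"
    by (auto simp: full_def)
  then show thesis using that[of "n - 1" i \<eta>] by auto
qed

section \<open>Composites of degeneracies and connections, and their sections\<close>

inductive epi :: "bool set \<Rightarrow> nat \<Rightarrow> nat \<Rightarrow> vmap \<Rightarrow> bool" for A :: "bool set" where
  idm: "epi A n n (idm n)"
| degen: "epi A n r \<chi> \<Longrightarrow> p \<le> n \<Longrightarrow> epi A (Suc n) r (compose (cube (Suc n)) \<chi> (degen (Suc n) (Suc p)))"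
| conn: "epi A n r \<chi> \<Longrightarrow> e \<in> A \<Longrightarrow> p < n \<Longrightarrow>
  epi A (Suc n) r (compose (cube (Suc n)) \<chi> (conn (Suc n) (Suc p) e))"

lemma epi_hom: "epi A k n \<theta> \<Longrightarrow> \<theta> \<in> box_hom A k n"
  by (induction rule: epi.induct) (auto intro: idm_in_hom compose_in_hom degen_hom conn_hom)

lemma degen_face: "p \<le> n \<Longrightarrow> compose (cube n) (degen (Suc n) (Suc p)) (face (Suc n) (Suc p) \<eta>) = idm n"
  by (rule box_hom_ext[OF compose_in_hom[OF face_hom degen_hom] idm_in_hom]) (auto simp: delete_at_insert_at)

lemma merge_at_insert_at: "p < length v \<Longrightarrow> p' \<in> {p, Suc p} \<Longrightarrow> merge_at (join e) p (insert_at p' e v) = v"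
  by (rule nth_equalityI) (auto simp: nth_merge_at nth_insert_at)

lemma insert_at_merge_at:
  assumes "length v = Suc n" "p < n"
  shows "v ! p = e \<Longrightarrow> insert_at p e (merge_at (join e) p v) = v"
    and "v ! Suc p = e \<Longrightarrow> insert_at (Suc p) e (merge_at (join e) p v) = v"
    and "v ! p \<noteq> e \<Longrightarrow> v ! Suc p \<noteq> e \<Longrightarrow>
      map2 (join e) (insert_at p e (merge_at (join e) p v)) (insert_at (Suc p) e (merge_at (join e) p v)) = v"
proof -
  have *: "insert_at q e (merge_at (join e) p v) ! i = (if i = q then e else
    if i \<in> {p, Suc p} then join e (v ! p) (v ! Suc p) else v ! i)"
    if "q \<in> {p, Suc p}" "i \<le> n" for q i
  proof -
    consider "i < p" | "i = p" | "i = Suc p" | "Suc p < i" by linarith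
    then show ?thesis using that assms by cases (cases i; auto simp: nth_insert_at nth_merge_at)+
  qed
  show "v ! p = e \<Longrightarrow> insert_at p e (merge_at (join e) p v) = v"
    using assms by (intro nth_equalityI) (auto simp: * join_def)
  show "v ! Suc p = e \<Longrightarrow> insert_at (Suc p) e (merge_at (join e) p v) = v"
    using assms by (intro nth_equalityI) (auto simp: * join_def)
  show "v ! p \<noteq> e \<Longrightarrow> v ! Suc p \<noteq> e \<Longrightarrow>
      map2 (join e) (insert_at p e (merge_at (join e) p v)) (insert_at (Suc p) e (merge_at (join e) p v)) = v"
    using assms by (intro nth_equalityI) (auto simp: * join_def)
qed

lemma conn_face: "p < n \<Longrightarrow> p' \<in> {p, Suc p} \<Longrightarrow> e \<in> A \<Longrightarrow>
    compose (cube n) (conn (Suc n) (Suc p) e) (face (Suc n) (Suc p') e) = idm n"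
  by (rule box_hom_ext[OF compose_in_hom[OF face_hom conn_hom] idm_in_hom]) (auto simp: merge_at_insert_at)

text \<open>Degeneracies and connections are split by faces, and sections compose.\<close>

lemma epi_section:
  assumes "epi A k n \<theta>"
  shows "\<exists>s\<in>box_hom A n k. compose (cube n) \<theta> s = idm n"
proof -
  have *: "\<exists>s\<in>box_hom A r (Suc n). compose (cube r) (compose (cube (Suc n)) \<chi> g) s = idm r"
    if "epi A n r \<chi>" "s \<in> box_hom A r n" "compose (cube r) \<chi> s = idm r"
      "g \<in> box_hom A (Suc n) n" "t \<in> box_hom A n (Suc n)" "compose (cube n) g t = idm n"
    for n r \<chi> s g t
  proof (rule bexI)
    show h: "compose (cube r) t s \<in> box_hom A r (Suc n)" using that(2,5) by (rule compose_in_hom)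
    have "compose (cube r) (compose (cube (Suc n)) \<chi> g) (compose (cube r) t s)
       = compose (cube r) \<chi> (compose (cube r) g (compose (cube r) t s))"
      using compose_box_assoc[OF h] .
    also have "compose (cube r) g (compose (cube r) t s) = compose (cube r) (compose (cube n) g t) s"
      using compose_box_assoc[OF that(2)] by metis
    finally show "compose (cube r) (compose (cube (Suc n)) \<chi> g) (compose (cube r) t s) = idm r"
      using that(2,3,6) compose_idm_left by metis
  qed
  from assms show ?thesis
  proof (induction rule: epi.induct)
    case (idm n) show ?case using idm_in_hom compose_idm_left by blast
  next
    case (degen n r \<chi> p)
    then show ?case
      using *[OF degen(1) _ _ degen_hom face_hom[of p n False] degen_face[of p n False]] by blast
  next
    case (conn n r \<chi> e p)
    then show ?case
      using *[OF conn(1) _ _ conn_hom face_hom[of p n e] conn_face[of p n p e A]] by auto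
  qed
qed

text \<open>The vertex of \<open>[1]\<^sup>2\<close> that lies on no section of a connection is the join of two vertices that do.\<close>

lemma epi_unique:
  assumes "epi A k n \<theta>" "A \<subseteq> {e}"
    and "\<And>x y i. length x = k \<Longrightarrow> length y = k \<Longrightarrow> i < n \<Longrightarrow>
      \<theta>' (map2 (join e) x y) ! i = join e (\<theta>' x ! i) (\<theta>' y ! i)"
    and "\<And>x. length x = k \<Longrightarrow> length (\<theta>' x) = n"
    and "\<And>s v. s \<in> box_hom A n k \<Longrightarrow> compose (cube n) \<theta> s = idm n \<Longrightarrow> length v = n \<Longrightarrow> \<theta>' (s v) = v"
  shows "length v = k \<Longrightarrow> \<theta>' v = \<theta> v"
  using assms(1,3-)
proof (induction arbitrary: \<theta>' v rule: epi.induct)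
  case (idm n)
  then show ?case using idm(4)[OF idm_in_hom, of v] compose_idm_left[OF idm_in_hom[of n A]] by simp
next
  case (degen n r \<chi> p)
  \<comment> \<open>The face at \<open>p\<close> is a section for either value \<open>b\<close>, and
    the two images together contain every vertex.\<close>
  have sec: "\<theta>' (insert_at p b v) = \<chi> v" if "length v = n" for b v
  proof (rule degen.IH[of v "\<lambda>v. \<theta>' (insert_at p b v)"])
    fix x y :: "bool list" and i assume *: "length x = n" "length y = n" "i < r"
    have "insert_at p b (map2 (join e) x y) = map2 (join e) (insert_at p b x) (insert_at p b y)"
      using * degen(2) by (intro nth_equalityI) (auto simp: nth_insert_at)
    then show "\<theta>' (insert_at p b (map2 (join e) x y)) ! i = join e (\<theta>' (insert_at p b x) ! i) (\<theta>' (insert_at p b y) ! i)"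
      using * degen.prems(2)[of "insert_at p b x" "insert_at p b y" i] by simp
  next
    fix s and v :: "bool list" assume s: "s \<in> box_hom A r n" "compose (cube r) \<chi> s = idm r"
      "length v = r"
    let ?t = "compose (cube r) (face (Suc n) (Suc p) b) s"
    have t: "?t \<in> box_hom A r (Suc n)" by (rule compose_in_hom[OF s(1) face_hom[OF degen(2)]])
    have "compose (cube r) (compose (cube (Suc n)) \<chi> (degen (Suc n) (Suc p))) ?t = idm r"
    proof (rule box_hom_ext[OF compose_in_hom[OF t] idm_in_hom])
      show "compose (cube (Suc n)) \<chi> (degen (Suc n) (Suc p)) \<in> box_hom A (Suc n) r"
        using compose_in_hom[OF degen_hom[OF degen(2)] epi_hom[OF degen(1)]] .
      fix v :: "bool list" assume v: "length v = r"
      have "length (s v) = n" using box_hom_length[OF s(1) v] .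
      moreover have "\<chi> (s v) = v" using fun_cong[OF s(2), of v] v by simp
      ultimately show "compose (cube r) (compose (cube (Suc n)) \<chi> (degen (Suc n) (Suc p))) ?t v = idm r v"
        using v degen(2) by (simp add: delete_at_insert_at)
    qed
    from degen.prems(4)[OF t this s(3)] show "\<theta>' (insert_at p b (s v)) = v"
      using s(3) box_hom_length[OF s(1) s(3)] by simp
  qed (use degen.prems that in auto)
  show ?case using sec[of "delete_at p v" "v ! p"] degen(2) degen.prems(1)
    by (simp add: insert_at_delete_at)
next
  case (conn n r \<chi> b p)
  have b: "b = e" using conn(2) assms(2) by auto
  have sec: "\<theta>' (insert_at q e v) = \<chi> v" if "length v = n" "q \<in> {p, Suc p}" for q v
  proof (rule conn.IH[of v "\<lambda>v. \<theta>' (insert_at q e v)"])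
    have q: "q \<le> n" using that(2) conn(3) by auto
    fix x y :: "bool list" and i assume *: "length x = n" "length y = n" "i < r"
    have "insert_at q e (map2 (join e) x y) = map2 (join e) (insert_at q e x) (insert_at q e y)"
      using * q by (intro nth_equalityI) (auto simp: nth_insert_at)
    then show "\<theta>' (insert_at q e (map2 (join e) x y)) ! i = join e (\<theta>' (insert_at q e x) ! i) (\<theta>' (insert_at q e y) ! i)"
      using * conn.prems(2)[of "insert_at q e x" "insert_at q e y" i] by simp
  next
    have q: "q \<le> n" using that(2) conn(3) by auto
    fix s and v :: "bool list" assume s: "s \<in> box_hom A r n" "compose (cube r) \<chi> s = idm r"
      "length v = r"
    let ?t = "compose (cube r) (face (Suc n) (Suc q) e) s"
    have t: "?t \<in> box_hom A r (Suc n)" by (rule compose_in_hom[OF s(1) face_hom[OF q]])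
    have "compose (cube r) (compose (cube (Suc n)) \<chi> (conn (Suc n) (Suc p) b)) ?t = idm r"
    proof (rule box_hom_ext[OF compose_in_hom[OF t] idm_in_hom])
      show "compose (cube (Suc n)) \<chi> (conn (Suc n) (Suc p) b) \<in> box_hom A (Suc n) r"
        using compose_in_hom[OF conn_hom[OF conn(2,3)] epi_hom[OF conn(1)]] .
      fix v :: "bool list" assume v: "length v = r"
      have "length (s v) = n" using box_hom_length[OF s(1) v] .
      moreover have "\<chi> (s v) = v" using fun_cong[OF s(2), of v] v by simp
      ultimately show "compose (cube r) (compose (cube (Suc n)) \<chi> (conn (Suc n) (Suc p) b)) ?t v = idm r v"
        using v conn(3) b merge_at_insert_at[of p "s v" q e] that(2) by simp
    qed
    from conn.prems(4)[OF t this s(3)] show "\<theta>' (insert_at q e (s v)) = v"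
      using s(3) box_hom_length[OF s(1) s(3)] by simp
  qed (use conn.prems that in auto)
  let ?w = "merge_at (join e) p v"
  have w: "length ?w = n" using conn.prems(1) conn(3) by simp
  have "\<theta>' v = \<chi> ?w"
  proof (cases "v ! p = e \<or> v ! Suc p = e")
    case True
    then have "v = insert_at p e ?w \<or> v = insert_at (Suc p) e ?w"
      using insert_at_merge_at[of v n p e] conn.prems(1) conn(3) by metis
    then show ?thesis using sec[OF w] by (metis insertI1 insertI2)
  next
    case False
    then have "v = map2 (join e) (insert_at p e ?w) (insert_at (Suc p) e ?w)"
      using insert_at_merge_at(3)[of v n p e] conn.prems(1) conn(3) by simp
    \<comment> \<open>Both sections give the same value \<open>\<chi> ?w\<close>, so idempotence of
      \<open>join\<close> settles the exceptional vertex.\<close>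
    then have "\<theta>' v ! i = join e (\<chi> ?w ! i) (\<chi> ?w ! i)" if "i < r" for i
      using conn.prems(2)[of "insert_at p e ?w" "insert_at (Suc p) e ?w" i] sec[OF w] w that
      by (metis insertI1 insertI2 length_insert_at)
    then show ?thesis
      using conn.prems(1,3) box_hom_length[OF epi_hom[OF conn(1)] w] by (intro nth_equalityI) auto
  qed
  then show ?case using conn.prems(1) conn(3) b by simp
qed

section \<open>Degeneracies are determined by their sections\<close>

text \<open>Strict growth gives \<open>i \<le> c i\<close>, and counting back from the last argument
  gives the reverse inequality.\<close>

lemma strict_surj_id:
  fixes c :: "nat \<Rightarrow> nat"
  assumes "\<And>i. i < n \<Longrightarrow> c i < k" and mono: "\<And>i i'. i < i' \<Longrightarrow> i' < n \<Longrightarrow> c i < c i'"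
    and "\<And>q. q < k \<Longrightarrow> \<exists>i<n. c i = q"
  shows "n = k" and "i < n \<Longrightarrow> c i = i"
proof -
  have "inj_on c {..<n}"
  proof (rule inj_onI)
    fix x y assume "x \<in> {..<n}" "y \<in> {..<n}" "c x = c y"
    then show "x = y" using mono[of x y] mono[of y x] by (cases x y rule: linorder_cases) auto
  qed
  moreover have "c ` {..<n} = {..<k}" using assms(1,3) by (auto simp: image_iff Bex_def eq_commute)
  ultimately show nk: "n = k" by (metis card_image card_lessThan)
  show "c i = i" if "i < n"
  proof -
    have "i \<le> c i" using that
    proof (induction i)
      case (Suc i)
      then show ?case using mono[of i "Suc i"] by simp
    qed simp
    moreover have "i + d < n \<Longrightarrow> c i + d \<le> c (i + d)" for d
    proof (induction d)
      case (Suc d)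
      then show ?case using mono[of "i + d" "Suc (i + d)"] by simp
    qed simp
    from this[of "n - 1 - i"] have "c i \<le> i" using that assms(1)[of "n - 1"] nk by simp
    ultimately show ?thesis by simp
  qed
qed

text \<open>Let \<open>?U\<close> have \<open>\<not> e\<close> in position \<open>p\<close> only.
  Dependence on \<open>p\<close> forces \<open>f ?U = (\<not> e)\<close>, and a point whose
  \<open>p\<close>-th entry is not \<open>e\<close> is unchanged by joining it with
  \<open>?U\<close>. Hence each variable that matters can by itself force the absorbing
  value.\<close>

lemma join_absorb:
  assumes f: "\<And>x y. length x = k \<Longrightarrow> length y = k \<Longrightarrow> f (map2 (join e) x y) = join e (f x) (f y)"
    and "length w = k" "p < k" "f w \<noteq> f (w[p := a])" and z: "length z = k" "z ! p \<noteq> e"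
  shows "f z \<noteq> e"
proof -
  let ?U = "(replicate k e)[p := \<not> e]"
  have "f (w[p := e]) \<noteq> f (w[p := \<not> e])"
  proof
    assume eq: "f (w[p := e]) = f (w[p := \<not> e])"
    have "f (w[p := b]) = f (w[p := e])" for b using eq by (cases b; cases e) simp_all
    from this[of a] this[of "w ! p"] show False using assms(4) by simp
  qed
  moreover have "w[p := \<not> e] = map2 (join e) (w[p := e]) ?U"
    using assms(2,3) by (intro nth_equalityI) (auto simp: nth_list_update)
  then have "f (w[p := \<not> e]) = join e (f (w[p := e])) (f ?U)"
    using f[of "w[p := e]" ?U] assms(2) by simp
  ultimately have U: "f ?U = (\<not> e)" by (auto simp: join_def split: if_splits)
  have "z = map2 (join e) z ?U"
    using z assms(3) by (intro nth_equalityI) (auto simp: nth_list_update join_def)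
  then have "f z = join e (f z) (f ?U)" using f[of z ?U] z by simp
  then show ?thesis using U by (simp add: join_def split: if_splits)
qed

lemma not_depends_insert_at:
  assumes "\<not> depends n g i p" "p < n" "Suc (length v) = n"
  shows "g (insert_at p a v) ! i = g (insert_at p b v) ! i"
proof -
  have "insert_at p a v = (insert_at p b v)[p := a]"
    using assms(2,3) by (intro nth_equalityI) (auto simp: nth_insert_at nth_list_update)
  then show ?thesis using assms unfolding depends_def by (metis length_insert_at)
qed

text \<open>The variable \<open>c\<close> occurs in some coordinate, and any coordinate other than
  \<open>j\<close> would break the order with \<open>a\<close> or with \<open>b\<close>.\<close>

lemma contiguous:
  assumes "ordered n m g" "\<And>p. p < n \<Longrightarrow> \<exists>i<m. depends n g i p"
    and "j < m" "depends n g j a" "depends n g j b" "a < c" "c < b"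
  shows "depends n g j c"
proof -
  have "c < n" using assms(5,7) by (simp add: depends_def)
  then obtain i where i: "i < m" "depends n g i c" using assms(2) by blast
  have "\<not> i < j" using assms i unfolding ordered_def by (meson less_imp_not_less)
  moreover have "\<not> j < i" using assms i unfolding ordered_def by (meson less_imp_not_less)
  ultimately show ?thesis using i by (metis nat_neq_iff)
qed

lemma ordered_depends_unique:
  "ordered n m g \<Longrightarrow> i < m \<Longrightarrow> i' < m \<Longrightarrow> depends n g i p \<Longrightarrow> depends n g i' p \<Longrightarrow> i = i'"
  unfolding ordered_def by (metis less_irrefl nat_neq_iff)

lemma fullD: "full n m g \<Longrightarrow> i < m \<Longrightarrow> \<exists>w. length w = n \<and> g w ! i \<noteq> \<eta>"
  by (simp add: full_def)

lemma full_epi: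
  assumes "\<theta> \<in> box_hom A k n" "A \<subseteq> {e}" "full k n \<theta>"
  shows "epi A k n \<theta>"
  using assms(1,3)
proof (induction k arbitrary: \<theta> rule: less_induct)
  case (less k)
  note ord = ordered_box_hom[OF less.prems(1)]
  note len = box_hom_length[OF less.prems(1)]
  \<comment> \<open>Common part of the two reductions: in both, \<open>g\<close> is a degeneracy or
    a connection and inserting \<eta> at \<open>p\<close> is a section of it. The remaining factor
    is again full, so the induction hypothesis applies.\<close>
  have split: "epi A k n \<theta>" if k: "k = Suc k'" and p: "p \<le> k'"
    and g: "g \<in> box_hom A (Suc k') k'" "\<And>\<chi>. epi A k' n \<chi> \<Longrightarrow>
      epi A (Suc k') n (compose (cube (Suc k')) \<chi> g)"
    and eq: "\<And>v. length v = k \<Longrightarrow> \<theta> v = \<theta> (insert_at p \<eta> (g v))" for k' p g \<eta>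
  proof -
    let ?\<chi> = "compose (cube k') \<theta> (face (Suc k') (Suc p) \<eta>)"
    have \<chi>: "?\<chi> \<in> box_hom A k' n"
      using compose_in_hom[OF face_hom[OF p]] less.prems(1) k by blast
    have eq': "\<theta> v = ?\<chi> (g v)" if "length v = k" for v
      using eq[OF that] box_hom_length[OF g(1), of v] that k by simp
    have "full k' n ?\<chi>"
      unfolding full_def
    proof (intro allI impI)
      fix i b assume "i < n"
      then obtain v where "length v = k" "\<theta> v ! i \<noteq> b" using less.prems(2) by (auto simp: full_def)
      then show "\<exists>w. length w = k' \<and> ?\<chi> w ! i \<noteq> b"
        using eq'[of v] box_hom_length[OF g(1), of v] k by auto
    qed
    then have e: "epi A k' n ?\<chi>" using less.IH[of k'] \<chi> k by simp
    have "\<theta> = compose (cube (Suc k')) ?\<chi> g"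
      by (rule box_hom_ext[OF less.prems(1)[unfolded k] compose_in_hom[OF g(1) \<chi>]])
        (use eq' k in \<open>simp\<close>)
    then show ?thesis using g(2)[OF e] k by simp
  qed
  consider (irr) p where "p < k" "\<And>i. i < n \<Longrightarrow> \<not> depends k \<theta> i p"
    | (two) i p q where "\<And>p. p < k \<Longrightarrow> \<exists>i<n. depends k \<theta> i p" "i < n" "p < q" "depends k \<theta> i p"
      "depends k \<theta> i q"
    | (one) "\<And>p. p < k \<Longrightarrow> \<exists>i<n. depends k \<theta> i p" "\<And>i p q. i < n \<Longrightarrow> depends k \<theta> i p \<Longrightarrow> depends k \<theta> i q \<Longrightarrow>
      p = q"
    by (metis nat_neq_iff)
  then show ?case
  proof cases
    case irr
    then obtain k' where k: "k = Suc k'" "p \<le> k'" by (cases k) auto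
    show ?thesis
    proof (rule split[OF k, of "degen (Suc k') (Suc p)" False])
      fix v :: "bool list" assume v: "length v = k"
      have "\<theta> (insert_at p (v ! p) (delete_at p v)) ! i = \<theta> (insert_at p False (delete_at p v)) ! i"
        if i: "i < n" for i
        using not_depends_insert_at[OF irr(2)[OF i] irr(1), of "delete_at p v" "v ! p" False] v k
          by simp
      then have "\<theta> (insert_at p (v ! p) (delete_at p v)) = \<theta> (insert_at p False (delete_at p v))"
        using len v k by (intro nth_equalityI) auto
      then show "\<theta> v = \<theta> (insert_at p False (degen (Suc k') (Suc p) v))"
        using v k irr(1) insert_at_delete_at[of p v] by simp
    qed (use k in \<open>auto intro: degen_hom epi.degen\<close>)
  next
    case two
    have kq: "q < k" using two(5) by (simp add: depends_def)
    have d: "depends k \<theta> i (Suc p)"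
      using contiguous[OF ord two(1,2,4,5), of "Suc p"] two(3,5) by (cases "Suc p = q") auto
    have abs: "\<theta> v ! i \<noteq> b" if h: "A \<subseteq> {b}" "depends k \<theta> i c" "length v = k" "v ! c \<noteq> b" for b c v
    proof -
      obtain w a where "length w = k" "c < k" "\<theta> w ! i \<noteq> \<theta> (w[c := a]) ! i"
        using h(2) by (auto simp: depends_def)
      from join_absorb[of k "\<lambda>v. \<theta> v ! i", OF box_hom_join[OF less.prems(1) h(1) _ _ two(2)] this h(3,4)]
      show ?thesis .
    qed
    \<comment> \<open>Over \<open>A = {}\<close> absorption holds for both neutral elements. The
      vertex \<open>?v\<close>, with \<open>False\<close> at \<open>p\<close> and
      \<open>True\<close> at \<open>Suc p\<close>, would then have to avoid both values.\<close>
    have "A \<noteq> {}"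
    proof
      assume A: "A = {}"
      let ?v = "(replicate k True)[p := False]"
      have "\<theta> ?v ! i \<noteq> True" using abs[of True p ?v] A two kq by simp
      moreover have "\<theta> ?v ! i \<noteq> False" using abs[of False "Suc p" ?v] A d two kq
        by (simp add: depends_def)
      ultimately show False by simp
    qed
    then have A: "A = {e}" using assms(2) by auto
    obtain k' where k: "k = Suc k'" "p < k'" using kq two(3) by (cases k) auto
    show ?thesis
    proof (rule split[of k' "Suc p" "conn (Suc k') (Suc p) e" e])
      fix v :: "bool list" assume v: "length v = k"
      let ?w = "insert_at (Suc p) e (merge_at (join e) p v)"
      have w: "length ?w = k" using v k by simp
      have wn: "?w ! c = (if c = Suc p then e else
        if c = p then join e (v ! p) (v ! Suc p) else v ! c)" if "c < k" for c
        using that v k by (cases c) (auto simp: nth_insert_at nth_merge_at)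
      have "\<theta> v ! i' = \<theta> ?w ! i'" if i': "i' < n" for i'
      proof (cases "i' = i")
        case False
        show ?thesis
        proof (rule ccontr)
          assume "\<theta> v ! i' \<noteq> \<theta> ?w ! i'"
          from depends_if_neq[OF v w this] obtain c where c: "c < k" "depends k \<theta> i' c"
            "v ! c \<noteq> ?w ! c" by blast
          then have "c = p \<or> c = Suc p" using wn by (auto split: if_splits)
          then show False using c(2) d two(2,4) i' False ordered_depends_unique[OF ord] by blast
        qed
      next
        case True
        show ?thesis
        proof (cases "v ! p = e \<and> v ! Suc p = e")
          case True
          then have "?w = v" using wn v w by (intro nth_equalityI) auto
          then show ?thesis by simp
        next
          case f: False
          then have "\<theta> v ! i \<noteq> e" using abs[OF assms(2) two(4) v] abs[OF assms(2) d v] by blast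
          moreover have "?w ! p \<noteq> e" using f wn[of p] k by (auto simp: join_def)
          then have "\<theta> ?w ! i \<noteq> e" using abs[OF assms(2) two(4) w] by blast
          ultimately show ?thesis using True by auto
        qed
      qed
      then have "\<theta> v = \<theta> ?w" using len[OF v] len[OF w] by (intro nth_equalityI) auto
      then show "\<theta> v = \<theta> (insert_at (Suc p) e (conn (Suc k') (Suc p) e v))" using v k by simp
    qed (use k A in \<open>auto intro: conn_hom epi.conn\<close>)
  next
    case one
    have ex: "\<exists>c. depends k \<theta> i c" if i: "i < n" for i
    proof -
      obtain v where v: "length v = k" "\<theta> v ! i \<noteq> False" using fullD[OF less.prems(2) i] by metis
      obtain w where w: "length w = k" "\<theta> w ! i \<noteq> True" using fullD[OF less.prems(2) i] by metis
      show ?thesis using depends_if_neq[OF v(1) w(1), of \<theta> i] v w by auto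
    qed
    define c where "c i = (SOME c. depends k \<theta> i c)" for i
    have c: "depends k \<theta> i (c i)" if "i < n" for i unfolding c_def using someI_ex[OF ex[OF that]] .
    have ck: "c i < k" if "i < n" for i using c[OF that] by (simp add: depends_def)
    have cm: "c i < c i'" if "i < i'" "i' < n" for i i'
      using ord c[of i] c[of i'] that unfolding ordered_def by (meson less_trans)
    have cs: "\<exists>i<n. c i = q" if "q < k" for q
      using one(1)[OF that] one(2) c by blast
    have nk: "n = k" by (rule strict_surj_id[of n c, OF ck cm cs])
    have ci: "c i = i" if "i < n" for i by (rule strict_surj_id(2)[of n c, OF ck cm cs that])
    have loc: "\<theta> v ! i = \<theta> w ! i" if i: "i < n" "length v = k" "length w = k" "v ! i = w ! i" for i v w
    proof (rule ccontr)
      assume "\<theta> v ! i \<noteq> \<theta> w ! i"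
      from depends_if_neq[OF i(2,3) this] obtain q where q: "depends k \<theta> i q" "v ! q \<noteq> w ! q" by blast
      then show False using one(2)[OF i(1) q(1) c[OF i(1)]] ci[OF i(1)] i(4) by simp
    qed
    \<comment> \<open>A monotone, nonconstant function of one boolean is that boolean. Constant
      lists are enough to test it, since coordinate \<open>i\<close> only looks at position
      \<open>i\<close>.\<close>
    have val: "\<theta> v ! i = v ! i" if i: "i < n" "length v = k" for i v
    proof -
      obtain x where x: "length x = k" "\<theta> x ! i \<noteq> v ! i" using fullD[OF less.prems(2) i(1)] by metis
      obtain y where y: "length y = k" "\<theta> y ! i \<noteq> (\<not> v ! i)" using fullD[OF less.prems(2) i(1)] by metis
      have "\<theta> (replicate k False) ! i \<le> \<theta> (replicate k True) ! i"
        using box_hom_mono_le[OF less.prems(1), of "replicate k False" "replicate k True"] i by simp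
      moreover have rep: "\<theta> (replicate k (b ! i)) ! i = \<theta> b ! i" if "length b = k" for b
        using loc[of i "replicate k (b ! i)" b] \<open>i < n\<close> nk that by simp
      moreover obtain a c where "\<theta> (replicate k a) ! i \<noteq> \<theta> (replicate k c) ! i"
        using rep[OF x(1)] rep[OF y(1)] x(2) y(2) by blast
      ultimately have "\<theta> (replicate k b) ! i = b" for b by (cases a; cases c; cases b) auto
      then show ?thesis using rep[OF i(2)] by simp
    qed
    have "\<theta> = idm k"
      by (rule box_hom_ext[OF less.prems(1) idm_in_hom]) (use val len nk in \<open>auto intro!: nth_equalityI\<close>)
    then show ?thesis using nk epi.idm by simp
  qed
qed

section \<open>Nondegenerate cubes and uniqueness of degeneracies\<close>

lemma cubical_act: "cubical_set A X \<Longrightarrow> \<phi> \<in> box_hom A m n \<Longrightarrow> x \<in> cubes X n \<Longrightarrow> act X m n \<phi> x \<in> cubes X m"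
  and cubical_id: "cubical_set A X \<Longrightarrow> x \<in> cubes X n \<Longrightarrow> act X n n (idm n) x = x"
  and cubical_comp: "cubical_set A X \<Longrightarrow> \<psi> \<in> box_hom A k m \<Longrightarrow> \<phi> \<in> box_hom A m n \<Longrightarrow> x \<in> cubes X n \<Longrightarrow>
    act X k n (compose (cube k) \<phi> \<psi>) x = act X k m \<psi> (act X m n \<phi> x)"
  unfolding cubical_set_def by blast+

lemma degenerateI:
  "y \<in> cubes X n \<Longrightarrow> p \<le> n \<Longrightarrow> act X (Suc n) n (degen (Suc n) (Suc p)) y \<in> degenerate A X (Suc n)"
  "y \<in> cubes X n \<Longrightarrow> p < n \<Longrightarrow> e \<in> A \<Longrightarrow> act X (Suc n) n (conn (Suc n) (Suc p) e) y \<in> degenerate A X (Suc n)"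
proof -
  show "y \<in> cubes X n \<Longrightarrow> p \<le> n \<Longrightarrow> act X (Suc n) n (degen (Suc n) (Suc p)) y \<in> degenerate A X (Suc n)"
    unfolding degenerate_def by (rule UnI1, rule UN_I[of "Suc p"]) auto
  show "y \<in> cubes X n \<Longrightarrow> p < n \<Longrightarrow> e \<in> A \<Longrightarrow>
    act X (Suc n) n (conn (Suc n) (Suc p) e) y \<in> degenerate A X (Suc n)"
    unfolding degenerate_def by (rule UnI2, rule UN_I[of "Suc p"]) auto
qed

lemma degenerateE:
  assumes "z \<in> degenerate A X k"
  obtains n p y where "k = Suc n" "p \<le> n" "y \<in> cubes X n"
    "z = act X (Suc n) n (degen (Suc n) (Suc p)) y"
  | n p y e where "k = Suc n" "p < n" "e \<in> A" "y \<in> cubes X n"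
    "z = act X (Suc n) n (conn (Suc n) (Suc p) e) y"
proof -
  consider i y where "i \<in> {1..k}" "y \<in> cubes X (k - 1)" "z = act X k (k - 1) (degen k i) y"
    | i e y where "i \<in> {1..k - 1}" "e \<in> A" "y \<in> cubes X (k - 1)" "z = act X k (k - 1) (conn k i e) y"
    using assms unfolding degenerate_def by blast
  then show thesis
  proof cases
    case 1
    then show ?thesis using that(1)[of "k - 1" "i - 1" y] by auto
  next
    case 2
    then show ?thesis using that(2)[of "k - 1" "i - 1" e y] by auto
  qed
qed

text \<open>The generator nearest to the source exhibits the cube as degenerate.\<close>

lemma epi_degenerate:
  assumes "epi A k n \<theta>" "cubical_set A X" "y \<in> cubes X n"
  shows "(k = n \<and> \<theta> = idm n) \<or> act X k n \<theta> y \<in> degenerate A X k"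
  using assms(1)
proof cases
  case (degen k' \<chi> p)
  then show ?thesis
    using cubical_comp[OF assms(2) degen_hom[of p k'] epi_hom[of A k' n \<chi>] assms(3)]
      cubical_act[OF assms(2) epi_hom[of A k' n \<chi>] assms(3)] degenerateI(1)[of _ X k' p A] by simp
next
  case (conn k' \<chi> e p)
  then show ?thesis
    using cubical_comp[OF assms(2) conn_hom[of e A p k'] epi_hom[of A k' n \<chi>] assms(3)]
      cubical_act[OF assms(2) epi_hom[of A k' n \<chi>] assms(3)] degenerateI(2)[of _ X k' p e A] by simp
qed simp

text \<open>If \<chi> is full, it is a composite of degeneracies and connections, hence the
  identity. Otherwise the cube already comes from a face of \<open>y\<close>, and induction on the
  dimension gives a strict inequality.\<close>

lemma nondegenerate_dim:
  assumes X: "cubical_set A X" and A: "A \<subseteq> {e}"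
    and "y \<in> cubes X n" "\<chi> \<in> box_hom A k n" "act X k n \<chi> y \<notin> degenerate A X k"
  shows "k \<le> n \<and> (k = n \<longrightarrow> \<chi> = idm n)"
  using assms(3-)
proof (induction n arbitrary: y \<chi>)
  case 0
  then have "full k 0 \<chi>" by (simp add: full_def)
  then show ?case using epi_degenerate[OF full_epi[OF 0(2) A] X 0(1)] 0(3) by auto
next
  case (Suc n)
  show ?case
  proof (cases "full k (Suc n) \<chi>")
    case True
    then show ?thesis
      using epi_degenerate[OF full_epi[OF Suc.prems(2) A] X Suc.prems(1)] Suc.prems(3) by auto
  next
    case False
    then obtain p \<eta> where p: "p \<le> n" "\<And>v. length v = k \<Longrightarrow> \<chi> v ! p = \<eta>"
      using not_full_obtain[OF False Suc.prems(2)] by (metis Suc_inject)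
    let ?\<chi> = "compose (cube k) (degen (Suc n) (Suc p)) \<chi>"
    have \<chi>: "?\<chi> \<in> box_hom A k n" using compose_in_hom[OF Suc.prems(2) degen_hom[OF p(1)]] .
    have "act X k (Suc n) \<chi> y = act X k n ?\<chi> (act X n (Suc n) (face (Suc n) (Suc p) \<eta>) y)"
      using not_full_factor[OF Suc.prems(2) p] cubical_comp[OF X \<chi> face_hom[OF p(1)] Suc.prems(1)]
        by metis
    then show ?thesis
      using Suc.IH[OF cubical_act[OF X face_hom[OF p(1), of \<eta>] Suc.prems(1)] \<chi>] Suc.prems(3) by auto
  qed
qed

text \<open>The uniqueness part of the Eilenberg-Zilber lemma. For a section \<open>s\<close> of
  \<theta>, the composite of \<theta>' with \<open>s\<close> fixes the nondegenerate cube
  \<open>x\<close> and is therefore the identity. So every section of \<theta> is one of \<theta>',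
  and \<open>epi_unique\<close> applies.\<close>

lemma epi_inj:
  assumes X: "cubical_set A X" and A: "A \<subseteq> {e}" and x: "x \<in> cubes X m" "x \<notin> degenerate A X m"
    and epi: "epi A k m \<theta>" "epi A k m \<theta>'" and eq: "act X k m \<theta> x = act X k m \<theta>' x"
  shows "\<theta> = \<theta>'"
proof (rule box_hom_ext[OF epi_hom[OF epi(1)] epi_hom[OF epi(2)]])
  fix v :: "bool list" assume v: "length v = k"
  have sec: "compose (cube m) \<theta>' s = idm m" if s: "s \<in> box_hom A m k" "compose (cube m) \<theta> s = idm m"
    for s
  proof -
    have "act X m m (compose (cube m) \<theta>' s) x = x"
      using cubical_comp[OF X s(1) epi_hom[OF epi(1)] x(1)] cubical_comp[OF X s(1) epi_hom[OF epi(2)] x(1)]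
        eq s(2) cubical_id[OF X x(1)] by simp
    then show ?thesis
      using nondegenerate_dim[OF X A x(1) compose_in_hom[OF s(1) epi_hom[OF epi(2)]]] x(2) by simp
  qed
  have "\<theta>' v = \<theta> v"
  proof (rule epi_unique[OF epi(1) A _ _ _ v])
    show "\<theta>' (s v) = v" if "s \<in> box_hom A m k" "compose (cube m) \<theta> s = idm m" "length v = m" for s v
      using fun_cong[OF sec[OF that(1,2)], of v] that(3) by simp
  qed (use box_hom_join[OF epi_hom[OF epi(2)] A] box_hom_length[OF epi_hom[OF epi(2)]] in auto)
  then show "\<theta> v = \<theta>' v" by simp
qed

section \<open>Partial maps and open box filling\<close>

text \<open>A map on a subcomplex of \<open>W\<close>, given by its graph: extending it is
  inclusion, and the union of a chain is again such a map, as Zorn's lemma requires.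
  \<open>Q\<close> is the condition that each pair has to satisfy: preservation of markings, or
  lying over \<open>f\<close>.\<close>

definition partial_map :: "bool set \<Rightarrow> ('w, 'a) cset_scheme \<Rightarrow> ('y, 'b) cset_scheme \<Rightarrow>
    (nat \<Rightarrow> 'w \<Rightarrow> 'y \<Rightarrow> bool) \<Rightarrow> (nat \<times> 'w \<times> 'y) set \<Rightarrow> bool" where
  "partial_map A W Y Q R \<longleftrightarrow>
     (\<forall>n w y. (n, w, y) \<in> R \<longrightarrow> w \<in> cubes W n \<and> y \<in> cubes Y n \<and> Q n w y) \<and>
     (\<forall>n w y k \<psi>. (n, w, y) \<in> R \<longrightarrow> \<psi> \<in> box_hom A k n \<longrightarrow> (k, act W k n \<psi> w, act Y k n \<psi> y) \<in> R) \<and>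
     (\<forall>n w y y'. (n, w, y) \<in> R \<longrightarrow> (n, w, y') \<in> R \<longrightarrow> y = y')"

definition pdomain :: "(nat \<times> 'w \<times> 'y) set \<Rightarrow> (nat \<times> 'w) set" where
  "pdomain R = {(n, w). \<exists>y. (n, w, y) \<in> R}"

lemma pdomain_mono: "R \<subseteq> R' \<Longrightarrow> pdomain R \<subseteq> pdomain R'"
  by (auto simp: pdomain_def)

lemma partial_mapD:
  assumes "partial_map A W Y Q R" "(n, w, y) \<in> R"
  shows "w \<in> cubes W n" "y \<in> cubes Y n" "Q n w y"
    and "\<psi> \<in> box_hom A k n \<Longrightarrow> (k, act W k n \<psi> w, act Y k n \<psi> y) \<in> R"
    and "(n, w, y') \<in> R \<Longrightarrow> y' = y"
  using assms unfolding partial_map_def by blast+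

lemma pdomain_act: "partial_map A W Y Q R \<Longrightarrow> (n, w) \<in> pdomain R \<Longrightarrow> \<psi> \<in> box_hom A k n \<Longrightarrow>
  (k, act W k n \<psi> w) \<in> pdomain R"
  unfolding pdomain_def using partial_mapD(4) by fastforce

text \<open>If \<theta> is not full, its cube lies on the boundary of \<open>x\<close>, where
  \<open>R\<close> has the right value already. For the other \<theta> the cube is new, because a
  section of \<theta> would carry it back to \<open>x\<close>, and by \<open>epi_inj\<close> it
  determines \<theta>; hence its value is well defined.\<close>

lemma partial_map_attach:
  assumes A: "A \<subseteq> {e}" and W: "cubical_set A W" and Y: "cubical_set A Y" and R: "partial_map A W Y Q R"
    and x: "x \<in> cubes W m" "x \<notin> degenerate A W m" "(m, x) \<notin> pdomain R" and H: "H \<in> cubes Y m"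
    and faces: "\<And>n p \<eta>. m = Suc n \<Longrightarrow> p \<le> n \<Longrightarrow>
      (n, act W n m (face m (Suc p) \<eta>) x, act Y n m (face m (Suc p) \<eta>) H) \<in> R"
    and Q: "\<And>k \<theta>. epi A k m \<theta> \<Longrightarrow> Q k (act W k m \<theta> x) (act Y k m \<theta> H)"
  defines "R' \<equiv> R \<union> {(k, act W k m \<theta> x, act Y k m \<theta> H) | k \<theta>. \<theta> \<in> box_hom A k m}"
  shows "partial_map A W Y Q R'" and "(m, x, H) \<in> R'"
    and "(k, w) \<in> pdomain R' \<Longrightarrow> w \<notin> degenerate A W k \<Longrightarrow> (k, w) \<in> pdomain R \<or> (k, w) = (m, x)"
proof -
  have nonfull: "(k, act W k m \<theta> x, act Y k m \<theta> H) \<in> R" if \<theta>: "\<theta> \<in> box_hom A k m" "\<not> full k m \<theta>" for k \<theta>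
  proof -
    obtain n p \<eta> where p: "m = Suc n" "p \<le> n" "\<And>v. length v = k \<Longrightarrow> \<theta> v ! p = \<eta>"
      using not_full_obtain[OF \<theta>(2,1)] by metis
    let ?\<chi> = "compose (cube k) (degen (Suc n) (Suc p)) \<theta>"
    have \<chi>: "?\<chi> \<in> box_hom A k n" using compose_in_hom[OF \<theta>(1)[unfolded p(1)] degen_hom[OF p(2)]] .
    have \<theta>eq: "\<theta> = compose (cube k) (face (Suc n) (Suc p) \<eta>) ?\<chi>"
      using not_full_factor[OF \<theta>(1)[unfolded p(1)] p(2,3)] .
    have "act W k m \<theta> x = act W k n ?\<chi> (act W n m (face m (Suc p) \<eta>) x)"
      "act Y k m \<theta> H = act Y k n ?\<chi> (act Y n m (face m (Suc p) \<eta>) H)"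
      using \<theta>eq cubical_comp[OF W \<chi> face_hom[OF p(2)] x(1)[unfolded p(1)]]
        cubical_comp[OF Y \<chi> face_hom[OF p(2)] H[unfolded p(1)]] p(1) by metis+
    then show ?thesis using partial_mapD(4)[OF R faces[OF p(1,2)] \<chi>] by simp
  qed
  have new: "(k, act W k m \<theta> x) \<notin> pdomain R" if epi: "epi A k m \<theta>" for k \<theta>
  proof
    assume "(k, act W k m \<theta> x) \<in> pdomain R"
    moreover obtain s where s: "s \<in> box_hom A m k" "compose (cube m) \<theta> s = idm m"
      using epi_section[OF epi] by blast
    ultimately have "(m, act W m k s (act W k m \<theta> x)) \<in> pdomain R" using pdomain_act[OF R] by blast
    then show False
      using cubical_comp[OF W s(1) epi_hom[OF epi] x(1)] s(2) cubical_id[OF W x(1)] x(3) by simp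
  qed
  have cases: "(k, act W k m \<theta> x, act Y k m \<theta> H) \<in> R \<or> epi A k m \<theta>" if "\<theta> \<in> box_hom A k m" for k \<theta>
    using nonfull[OF that] full_epi[OF that A] by blast
  show pm: "partial_map A W Y Q R'"
    unfolding partial_map_def
  proof (intro conjI allI impI)
    fix n w y assume *: "(n, w, y) \<in> R'"
    then consider "(n, w, y) \<in> R" | \<theta> where "epi A n m \<theta>" "w = act W n m \<theta> x" "y = act Y n m \<theta> H"
      unfolding R'_def using cases by blast
    then have "w \<in> cubes W n \<and> y \<in> cubes Y n \<and> Q n w y"
    proof cases
      case 1 then show ?thesis using partial_mapD[OF R] by blast
    next
      case 2
      then show ?thesis using Q cubical_act[OF W epi_hom x(1)] cubical_act[OF Y epi_hom H] by blast
    qed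
    then show "w \<in> cubes W n" "y \<in> cubes Y n" "Q n w y" by auto
  next
    fix n w y k \<psi> assume *: "(n, w, y) \<in> R'" and \<psi>: "\<psi> \<in> box_hom A k n"
    from * consider "(n, w, y) \<in> R" | \<theta> where "\<theta> \<in> box_hom A n m" "w = act W n m \<theta> x"
      "y = act Y n m \<theta> H"
      unfolding R'_def by blast
    then show "(k, act W k n \<psi> w, act Y k n \<psi> y) \<in> R'"
    proof cases
      case 1 then show ?thesis unfolding R'_def using partial_mapD(4)[OF R _ \<psi>] by blast
    next
      case 2
      then have "act W k n \<psi> w = act W k m (compose (cube k) \<theta> \<psi>) x"
        "act Y k n \<psi> y = act Y k m (compose (cube k) \<theta> \<psi>) H"
        using cubical_comp[OF W \<psi> _ x(1)] cubical_comp[OF Y \<psi> _ H] by auto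
      then show ?thesis unfolding R'_def using compose_in_hom[OF \<psi> 2(1)] by blast
    qed
  next
    fix n w y y' assume *: "(n, w, y) \<in> R'" "(n, w, y') \<in> R'"
    have R_or: "(n, w, y) \<in> R \<or> (\<exists>\<theta>. epi A n m \<theta> \<and> w = act W n m \<theta> x \<and> y = act Y n m \<theta> H)"
      if "(n, w, y) \<in> R'" for y
      using that cases unfolding R'_def by blast
    show "y = y'"
    proof (cases "(n, w) \<in> pdomain R")
      case True
      then have "(n, w, y) \<in> R" "(n, w, y') \<in> R" using R_or * new by blast+
      then show ?thesis using partial_mapD(5)[OF R] by blast
    next
      case False
      then obtain \<theta> \<theta>' where "epi A n m \<theta>" "epi A n m \<theta>'" "w = act W n m \<theta> x" "w = act W n m \<theta>' x"
        "y = act Y n m \<theta> H" "y' = act Y n m \<theta>' H"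
        using R_or[OF *(1)] R_or[OF *(2)] unfolding pdomain_def by blast
      then show ?thesis using epi_inj[OF W A x(1,2), of n \<theta> \<theta>'] by auto
    qed
  qed
  have "(m, act W m m (idm m) x, act Y m m (idm m) H) \<in> R'"
    unfolding R'_def using idm_in_hom by blast
  then show "(m, x, H) \<in> R'" using cubical_id[OF W x(1)] cubical_id[OF Y H] by simp
  show "(k, w) \<in> pdomain R \<or> (k, w) = (m, x)" if dom: "(k, w) \<in> pdomain R'" "w \<notin> degenerate A W k"
  proof -
    obtain y where "(k, w, y) \<in> R'" using dom(1) by (auto simp: pdomain_def)
    then consider "(k, w, y) \<in> R" | \<theta> where "epi A k m \<theta>" "w = act W k m \<theta> x"
      unfolding R'_def using cases by blast
    then show ?thesis
    proof cases
      case 1 then show ?thesis by (auto simp: pdomain_def)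
    next
      case 2
      then show ?thesis using epi_degenerate[OF 2(1) W x(1)] dom(2) cubical_id[OF W x(1)] by auto
    qed
  qed
qed

text \<open>\<open>U\<close> is the matching: with a lower cell, its upper partner has to be in the domain as well.\<close>

definition saturated :: "((nat \<times> 'w) \<times> (nat \<times> 'w)) set \<Rightarrow> (nat \<times> 'w \<times> 'y) set \<Rightarrow> bool" where
  "saturated U R \<longleftrightarrow> (\<forall>(c, d)\<in>U. c \<in> pdomain R \<longrightarrow> d \<in> pdomain R)"

text \<open>A maximal saturated extension contains all nondegenerate cubes, since
  \<open>step\<close> would enlarge it otherwise, and then all cubes, by induction on the dimension.
  The step only has to enlarge the map; it may attach cells other than the one found
  missing.\<close>

lemma partial_map_total:
  assumes W: "cubical_set A W" and Y: "cubical_set A Y"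
    and R0: "partial_map A W Y Q R0" "saturated U R0"
    and step: "\<And>R n w. R0 \<subseteq> R \<Longrightarrow> partial_map A W Y Q R \<Longrightarrow> saturated U R \<Longrightarrow> w \<in> cubes W n \<Longrightarrow>
      w \<notin> degenerate A W n \<Longrightarrow> (n, w) \<notin> pdomain R \<Longrightarrow>
      \<exists>R'. R \<subset> R' \<and> partial_map A W Y Q R' \<and> saturated U R'"
  shows "\<exists>R. R0 \<subseteq> R \<and> partial_map A W Y Q R \<and> (\<forall>n. \<forall>w\<in>cubes W n. (n, w) \<in> pdomain R)"
proof -
  define \<A> where "\<A> = {R. R0 \<subseteq> R \<and> partial_map A W Y Q R \<and> saturated U R}"
  have "\<Union>\<C> \<in> \<A>" if C: "\<C> \<noteq> {}" "subset.chain \<A> \<C>" for \<C>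
  proof -
    have mem: "R0 \<subseteq> R" "partial_map A W Y Q R" "saturated U R" if "R \<in> \<C>" for R
      using C(2) that by (auto simp: \<A>_def subset.chain_def)
    have two: "\<exists>R\<in>\<C>. a \<in> R \<and> b \<in> R" if ab: "a \<in> \<Union>\<C>" "b \<in> \<Union>\<C>" for a b
    proof -
      obtain R1 R2 where R: "R1 \<in> \<C>" "R2 \<in> \<C>" "a \<in> R1" "b \<in> R2" using ab by blast
      then have "R1 \<subseteq> R2 \<or> R2 \<subseteq> R1" using C(2) unfolding subset_chain_def by blast
      then show ?thesis using R by blast
    qed
    have "partial_map A W Y Q (\<Union>\<C>)"
      unfolding partial_map_def
    proof (intro conjI allI impI)
      fix n w y assume "(n, w, y) \<in> \<Union>\<C>"
      then obtain R where "R \<in> \<C>" "(n, w, y) \<in> R" by blast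
      from partial_mapD[OF mem(2)[OF this(1)] this(2)] this(1)
      show "w \<in> cubes W n" "y \<in> cubes Y n" "Q n w y"
        "\<And>k \<psi>. \<psi> \<in> box_hom A k n \<Longrightarrow> (k, act W k n \<psi> w, act Y k n \<psi> y) \<in> \<Union>\<C>" by blast+
    next
      fix n w y y' assume "(n, w, y) \<in> \<Union>\<C>" "(n, w, y') \<in> \<Union>\<C>"
      from two[OF this] obtain R where "R \<in> \<C>" "(n, w, y) \<in> R" "(n, w, y') \<in> R" by blast
      then show "y = y'" using partial_mapD(5)[OF mem(2)] by metis
    qed
    moreover have "saturated U (\<Union>\<C>)"
      unfolding saturated_def
    proof (intro ballI, clarify)
      fix n w n' w' assume *: "((n, w), (n', w')) \<in> U" "(n, w) \<in> pdomain (\<Union>\<C>)"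
      then obtain R where R: "R \<in> \<C>" "(n, w) \<in> pdomain R" by (auto simp: pdomain_def)
      then have "(n', w') \<in> pdomain R" using mem(3)[OF R(1)] *(1) by (auto simp: saturated_def)
      then show "(n', w') \<in> pdomain (\<Union>\<C>)" using R(1) by (auto simp: pdomain_def)
    qed
    ultimately show ?thesis using C(1) mem(1) by (auto simp: \<A>_def)
  qed
  moreover have "\<A> \<noteq> {}" using R0 by (auto simp: \<A>_def)
  ultimately obtain M where M: "M \<in> \<A>" "\<And>X. X \<in> \<A> \<Longrightarrow> M \<subseteq> X \<Longrightarrow> X = M"
    using subset_Zorn_nonempty[of \<A>] by metis
  then have pm: "R0 \<subseteq> M" "partial_map A W Y Q M" "saturated U M" by (auto simp: \<A>_def)
  have nd: "(n, w) \<in> pdomain M" if "w \<in> cubes W n" "w \<notin> degenerate A W n" for n w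
  proof (rule ccontr)
    assume "(n, w) \<notin> pdomain M"
    from step[OF pm that this] obtain R' where "M \<subset> R'" "partial_map A W Y Q R'" "saturated U R'"
      by blast
    then show False using M(2)[of R'] pm(1) by (auto simp: \<A>_def)
  qed
  have "(n, w) \<in> pdomain M" if "w \<in> cubes W n" for n w
    using that
  proof (induction n arbitrary: w)
    case 0 then show ?case using nd[OF 0] by (simp add: degenerate_0)
  next
    case (Suc n)
    show ?case
    proof (cases "w \<in> degenerate A W (Suc n)")
      case True
      then show ?thesis
      proof (cases rule: degenerateE)
        case (1 n' p y)
        then have "(n, y) \<in> pdomain M" using Suc.IH by simp
        from pdomain_act[OF pm(2) this degen_hom[of p n]] show ?thesis using 1 by simp
      next
        case (2 n' p y e)
        then have "(n, y) \<in> pdomain M" using Suc.IH by simp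
        from pdomain_act[OF pm(2) this conn_hom[of e A p n]] show ?thesis using 2 by simp
      qed
    qed (use nd Suc.prems in blast)
  qed
  then show ?thesis using pm by blast
qed

section \<open>Words of faces and the cubes of the open box\<close>

lemma face_words_Cons:
  assumes "(c, b) # w \<in> face_words n"
  obtains n' p where "n = Suc n'" "c = Suc p" "p \<le> n'" "w \<in> face_words n'"
    "\<And>c' b'. (c', b') \<in> set w \<Longrightarrow> c' \<le> p"
    "\<And>v. length v = n - Suc (length w) \<Longrightarrow> face_comp n ((c, b) # w) v = insert_at p b (face_comp n' w v)"
    "\<And>v. length v = n - Suc (length w) \<Longrightarrow> length (face_comp n' w v) = n'"
proof -
  have *: "1 \<le> c" "c \<le> n" "\<forall>q\<in>set w. fst q < c" "sorted_wrt (>) (map fst w)" "fst ` set w \<subseteq> {1..n}"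
    using assms by (auto simp: face_words_def)
  then obtain n' p where np: "n = Suc n'" "c = Suc p" by (metis One_nat_def Suc_le_D le_trans)
  have w: "w \<in> face_words n'" using * np unfolding face_words_def by fastforce
  have len: "length (face_comp n' w v) = n'" if "length v = n - Suc (length w)" for v
    using box_hom_length[OF face_comp_in_hom[OF w]] that np by simp
  show thesis
  proof (rule that[OF np _ w])
    show "face_comp n ((c, b) # w) v = insert_at p b (face_comp n' w v)"
      if "length v = n - Suc (length w)" for v
      using len[OF that] that np by simp
  qed (use * np len in auto)
qed

lemma face_comp_fixed:
  "w \<in> face_words n \<Longrightarrow> (Suc c, b) \<in> set w \<Longrightarrow> length v = n - length w \<Longrightarrow> face_comp n w v ! c = b"
proof (induction w arbitrary: n)
  case (Cons a w)
  obtain c1 b1 where a: "a = (c1, b1)" by (cases a)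
  from Cons.prems(1)[unfolded a] show ?case
  proof (cases rule: face_words_Cons)
    case (1 n' p)
    show ?thesis
    proof (cases "(Suc c, b) = (c1, b1)")
      case True
      then show ?thesis using 1 a Cons.prems(3) by (simp add: nth_insert_at)
    next
      case False
      then have "(Suc c, b) \<in> set w" using Cons.prems(2) a by auto
      moreover from this have "c < p" using 1(5) by fastforce
      ultimately show ?thesis
        using Cons.IH[OF 1(4)] 1 a Cons.prems(3) by (simp add: nth_insert_at)
    qed
  qed
qed simp

text \<open>As the letters of a word decrease, the remaining letters fix coordinates below
  \<open>p\<close>; removing the outermost face only renumbers the coordinates above
  \<open>p\<close>.\<close>

lemma face_comp_free:
  "w \<in> face_words n \<Longrightarrow> c < n \<Longrightarrow> Suc c \<notin> fst ` set w \<Longrightarrow>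
   \<exists>q < n - length w. \<forall>v. length v = n - length w \<longrightarrow> face_comp n w v ! c = v ! q"
proof (induction w arbitrary: n c)
  case (Cons a w)
  obtain c1 b1 where a: "a = (c1, b1)" by (cases a)
  from Cons.prems(1)[unfolded a] show ?case
  proof (cases rule: face_words_Cons)
    case (1 n' p)
    have "c \<noteq> p" using Cons.prems(3) a 1(2) by auto
    define c' where "c' = (if c < p then c else c - 1)"
    have "c' < n'" using 1 Cons.prems(2) \<open>c \<noteq> p\<close> by (auto simp: c'_def)
    moreover have "Suc c' \<notin> fst ` set w"
    proof
      assume "Suc c' \<in> fst ` set w"
      then obtain b' where "(Suc c', b') \<in> set w" by auto
      then have "c' < p" "Suc c' \<in> fst ` set w" using 1(5)[of "Suc c'" b'] by force+
      then show False using Cons.prems(3) \<open>c \<noteq> p\<close> by (auto simp: c'_def split: if_splits)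
    qed
    ultimately obtain q where "q < n' - length w" "\<forall>v. length v = n' - length w \<longrightarrow>
      face_comp n' w v ! c' = v ! q"
      using Cons.IH[OF 1(4)] by blast
    then show ?thesis
      using 1 a Cons.prems(2) \<open>c \<noteq> p\<close> by (intro exI[of _ q]) (auto simp: nth_insert_at c'_def)
  qed
qed auto

lemma face_not_const:
  assumes "q \<le> n" "p \<le> n" and "\<And>v. length v = n \<Longrightarrow> insert_at p \<eta> v ! q = (b :: bool)"
  shows "(q, b) = (p, \<eta>)"
proof -
  have "q = p"
  proof (rule ccontr)
    assume "q \<noteq> p"
    then show False using assms(3)[of "replicate n (\<not> b)"] assms(1,2)
      by (auto simp: nth_insert_at split: if_splits)
  qed
  then show ?thesis using assms(3)[of "replicate n b"] assms(1,2) by (simp add: nth_insert_at)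
qed

text \<open>Membership in the open box becomes the presence of a constant coordinate other than the
  missing one. The indices of a word are distinct, so every word apart from \<open>[]\<close> and
  \<open>[(Suc p, \<eta>)]\<close> contains a letter different from
  \<open>(Suc p, \<eta>)\<close>.\<close>

lemma cubes_open_box:
  assumes p: "p \<le> n"
  shows "\<theta> \<in> cubes (open_box A (Suc n) (Suc p) \<eta>) k \<longleftrightarrow>
    \<theta> \<in> box_hom A k (Suc n) \<and> (\<exists>q\<le>n. \<exists>b. (q, b) \<noteq> (p, \<eta>) \<and> (\<forall>v. length v = k \<longrightarrow> \<theta> v ! q = b))"
    (is "?l \<longleftrightarrow> ?r")
proof
  assume ?l
  then obtain r \<delta> \<psi> where *: "\<theta> = compose (cube k) \<delta> \<psi>" "\<delta> \<in> faces (Suc n) r"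
    "(r, \<delta>) \<noteq> (Suc n, idm (Suc n))" "(r, \<delta>) \<noteq> (n, face (Suc n) (Suc p) \<eta>)" "\<psi> \<in> box_hom A k r"
    by (auto simp: open_box_def regular_subcomplex_def)
  then obtain w where w: "\<delta> = face_comp (Suc n) w" "w \<in> face_words (Suc n)" "length w + r = Suc n"
    by (auto simp: faces_def)
  have "\<exists>x\<in>set w. x \<noteq> (Suc p, \<eta>)"
  proof (rule ccontr)
    assume eq: "\<not> ?thesis"
    show False
    proof (cases w)
      case Nil
      then show False using * w by simp
    next
      case (Cons a w')
      moreover have "w' = []"
      proof (rule ccontr)
        assume "w' \<noteq> []"
        then obtain b w'' where "w = a # b # w''" using Cons by (cases w') auto
        then show False using w(2) eq by (auto simp: face_words_def)
      qed
      ultimately have wp: "w = [(Suc p, \<eta>)]" using eq by auto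
      then have "\<delta> = face (Suc n) (Suc p) \<eta>"
        using w(1) compose_idm_right[OF face_hom[OF p, of \<eta> A]] by simp
      then show False using * w(3) wp by simp
    qed
  qed
  then obtain c b where cb: "(c, b) \<in> set w" "(c, b) \<noteq> (Suc p, \<eta>)" by fastforce
  moreover have "c \<in> {1..Suc n}" using cb(1) w(2) by (auto simp: face_words_def)
  ultimately obtain q where q: "c = Suc q" "q \<le> n" by (cases c) auto
  have "\<theta> v ! q = b" if "length v = k" for v
    using face_comp_fixed[OF w(2), of q b "\<psi> v"] cb q w(1,3) box_hom_length[OF *(5) that] *(1) that
      by simp
  moreover have "\<theta> \<in> box_hom A k (Suc n)"
    using *(1) compose_in_hom[OF *(5) faces_in_hom[OF *(2)]] by simp
  ultimately show ?r using cb q by auto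
next
  assume ?r
  then obtain q b where *: "\<theta> \<in> box_hom A k (Suc n)" "q \<le> n" "(q, b) \<noteq> (p, \<eta>)"
    "\<And>v. length v = k \<Longrightarrow> \<theta> v ! q = b" by blast
  let ?\<delta> = "face (Suc n) (Suc q) b"
  have "[(Suc q, b)] \<in> face_words (Suc n)" using *(2) by (simp add: face_words_def)
  moreover have "face_comp (Suc n) [(Suc q, b)] = ?\<delta>"
    using compose_idm_right[OF face_hom[OF *(2), of b A]] by simp
  ultimately have "?\<delta> \<in> faces (Suc n) n" unfolding faces_def by force
  moreover have "?\<delta> \<noteq> face (Suc n) (Suc p) \<eta>"
  proof
    assume eq: "?\<delta> = face (Suc n) (Suc p) \<eta>"
    have "insert_at p \<eta> v ! q = b" if "length v = n" for v
    proof -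
      have "insert_at q b v = insert_at p \<eta> v" using fun_cong[OF eq, of v] that by simp
      moreover have "insert_at q b v ! q = b" using that *(2) by (simp add: nth_insert_at)
      ultimately show ?thesis by simp
    qed
    from face_not_const[OF *(2) p this] show False using *(3) by simp
  qed
  moreover have "compose (cube k) (degen (Suc n) (Suc q)) \<theta> \<in> box_hom A k n"
    using compose_in_hom[OF *(1) degen_hom[OF *(2)]] .
  ultimately show ?l
    unfolding open_box_def regular_subcomplex_def
    using not_full_factor[OF *(1,2,4)]
    by (simp, intro exI[of _ n] exI[of _ ?\<delta>] exI[of _ "compose (cube k) (degen (Suc n) (Suc q)) \<theta>"]) simp
qed

lemma open_boxE:
  assumes "p \<le> n" "\<theta> \<in> cubes (open_box A (Suc n) (Suc p) \<eta>) k"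
  obtains q b where "\<theta> \<in> box_hom A k (Suc n)" "q \<le> n" "(q, b) \<noteq> (p, \<eta>)"
    "\<And>v. length v = k \<Longrightarrow> \<theta> v ! q = b"
  using assms(2) unfolding cubes_open_box[OF assms(1)] by blast

lemma open_boxI:
  assumes "p \<le> n" "\<theta> \<in> box_hom A k (Suc n)" "q \<le> n" "(q, b) \<noteq> (p, \<eta>)"
    "\<And>v. length v = k \<Longrightarrow> \<theta> v ! q = b"
  shows "\<theta> \<in> cubes (open_box A (Suc n) (Suc p) \<eta>) k"
  unfolding cubes_open_box[OF assms(1)] using assms(2-) by blast

lemma comical_simps:
  "cubes (comical_cube A n i \<eta>) k = box_hom A k n"
  "act (comical_cube A n i \<eta>) k m \<psi> \<phi> = compose (cube k) \<phi> \<psi>"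
  "marked (comical_cube A n i \<eta>) k = degenerate A (representable A n) k \<union> critical_faces n i \<eta> k"
  "act (open_box A n i \<eta>) k m \<psi> \<phi> = compose (cube k) \<phi> \<psi>"
  "marked (open_box A n i \<eta>) k = marked (comical_cube A n i \<eta>) k \<inter> cubes (open_box A n i \<eta>) k"
  "cubes (comical_cube' A n i \<eta>) k = box_hom A k n"
  "act (comical_cube' A n i \<eta>) k m \<psi> \<phi> = compose (cube k) \<phi> \<psi>"
  "marked (comical_cube' A n i \<eta>) k = marked (comical_cube A n i \<eta>) k \<union>
     (if k = n - 1 then faces n (n - 1) - {face n i \<eta>} else {})"
  "marked (trunc r (comical_cube A n i \<eta>)) k = marked (comical_cube A n i \<eta>) k \<union>
     (if k > r then box_hom A k n else {})"
  by (auto simp: comical_cube_def comical_cube'_def open_box_def regular_subcomplex_def trunc_def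
      mark_also_def min_marked_def representable_def)

lemma degenerate_representable:
  assumes "cubical_set A W" "C \<in> cubes W n" "\<theta> \<in> degenerate A (representable A n) k"
  shows "act W k n \<theta> C \<in> degenerate A W k"
  using assms(3)
proof (cases rule: degenerateE)
  case (1 n' p y)
  then have y: "y \<in> box_hom A n' n" "\<theta> = compose (cube k) y (degen (Suc n') (Suc p))"
    by (auto simp: representable_def)
  then show ?thesis
    using cubical_comp[OF assms(1) degen_hom[OF 1(2)] y(1) assms(2)] 1(1)
      degenerateI(1)[OF cubical_act[OF assms(1) y(1) assms(2)] 1(2)] by simp
next
  case (2 n' p y e)
  then have y: "y \<in> box_hom A n' n" "\<theta> = compose (cube k) y (conn (Suc n') (Suc p) e)"
    by (auto simp: representable_def)
  then show ?thesis
    using cubical_comp[OF assms(1) conn_hom[OF 2(3,2)] y(1) assms(2)] 2(1)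
      degenerateI(2)[OF cubical_act[OF assms(1) y(1) assms(2)] 2(2,3)] by simp
qed

lemma face_of_faces:
  assumes "\<delta> \<in> faces (Suc n) n"
  obtains q b where "q \<le> n" "\<delta> = face (Suc n) (Suc q) b"
proof -
  obtain w where w: "\<delta> = face_comp (Suc n) w" "w \<in> face_words (Suc n)" "length w = 1"
    using assms by (auto simp: faces_def)
  then obtain c b where cb: "w = [(c, b)]"
    by (metis One_nat_def length_0_conv length_Suc_conv surj_pair)
  then obtain q where q: "c = Suc q" "q \<le> n" using w(2) by (cases c) (auto simp: face_words_def)
  then show thesis using that[of q b] w(1) cb compose_idm_right[OF face_hom[OF q(2), of b "{}"]] by simp
qed

text \<open>Attaches \<open>C\<close> together with its missing face \<open>c\<close>. The values of
  \<open>R\<close> on the open box extend to a comical cube in \<open>Y\<close>, whose missing face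
  \<open>H\<close> and interior \<open>K\<close> are attached one after the other. By
  \<open>crit\<close> the map on the open box preserves markings; \<open>lmarked\<close> is what the
  marking extension needs in order to mark \<open>H\<close>.\<close>

lemma box_step:
  fixes W :: "'w mcset" and Y :: "'y mcset"
  assumes A: "A \<subseteq> {e}" and Y: "comical_set A Y" and W: "marked_cubical_set A W"
    and R: "partial_map A W Y (\<lambda>n w y. w \<in> marked W n \<longrightarrow> y \<in> marked Y n) R"
    and p: "p \<le> n" and C: "C \<in> cubes W (Suc n)" "C \<notin> degenerate A W (Suc n)"
    and c: "c = act W n (Suc n) (face (Suc n) (Suc p) \<eta>) C" "c \<notin> degenerate A W n" "(n, c) \<notin> pdomain R"
    and others: "\<And>q b. q \<le> n \<Longrightarrow> (q, b) \<noteq> (p, \<eta>) \<Longrightarrow>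
      (n, act W n (Suc n) (face (Suc n) (Suc q) b) C) \<in> pdomain R"
    and crit: "\<And>k \<delta>. \<delta> \<in> critical_faces (Suc n) (Suc p) \<eta> k \<Longrightarrow> act W k (Suc n) \<delta> C \<in> marked W k"
    and lmarked: "c \<in> marked W n \<Longrightarrow> n \<ge> 1 \<and> (\<forall>q\<le>n. \<forall>b. (q, b) \<noteq> (p, \<eta>) \<longrightarrow>
      act W n (Suc n) (face (Suc n) (Suc q) b) C \<in> marked W n)"
  shows "\<exists>R'. R \<subset> R' \<and> partial_map A W Y (\<lambda>n w y. w \<in> marked W n \<longrightarrow> y \<in> marked Y n) R' \<and>
    (Suc n, C) \<in> pdomain R' \<and>
    (\<forall>k w. (k, w) \<in> pdomain R' \<longrightarrow> w \<notin> degenerate A W k \<longrightarrow> (k, w) \<in> pdomain R \<or> (k, w) = (n, c) \<or>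
      (k, w) = (Suc n, C))"
proof -
  let ?N = "Suc n" and ?i = "Suc p" and ?Q = "\<lambda>n w y. w \<in> marked W n \<longrightarrow> y \<in> marked Y n"
  have cW: "cubical_set A W" and dW: "\<And>n. degenerate A W n \<subseteq> marked W n"
    using W by (auto simp: marked_cubical_set_def)
  have cY: "cubical_set A Y" and dY: "\<And>n. degenerate A Y n \<subseteq> marked Y n"
    using Y by (auto simp: comical_set_def marked_cubical_set_def)
  have i: "?i \<in> {1..?N}" and N: "?N \<ge> 1" using p by auto
  then have rlp1: "has_rlp A (open_box A ?N ?i \<eta>) (comical_cube A ?N ?i \<eta>) (\<lambda>_ x. x) Y"
    using Y unfolding comical_set_def by blast
  have rlp2: "has_rlp A (comical_cube' A ?N ?i \<eta>) (trunc (?N - 2) (comical_cube A ?N ?i \<eta>)) (\<lambda>_ x. x) Y"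
    if "n \<ge> 1"
  proof -
    have "?N \<ge> 2" using that by simp
    then show ?thesis using Y i unfolding comical_set_def by blast
  qed
  let ?O = "\<lambda>k. cubes (open_box A ?N ?i \<eta>) k"
  \<comment> \<open>On the open box the values are forced: those of \<open>R\<close> at the
    corresponding faces of \<open>C\<close>.\<close>
  define u where "u k \<theta> = (THE y. (k, act W k ?N \<theta> C, y) \<in> R)" for k \<theta>
  have Ohom: "\<theta> \<in> box_hom A k ?N" if "\<theta> \<in> ?O k" for k \<theta>
    by (rule open_boxE[OF p that])
  have uI: "u k \<theta> = y" if "(k, act W k ?N \<theta> C, y) \<in> R" for k \<theta> y
    unfolding u_def by (rule the_equality) (rule that, rule partial_mapD(5)[OF R that])
  have uR: "(k, act W k ?N \<theta> C, u k \<theta>) \<in> R" if h: "\<theta> \<in> ?O k" for k \<theta>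
  proof -
    obtain q b where *: "\<theta> \<in> box_hom A k ?N" "q \<le> n" "(q, b) \<noteq> (p, \<eta>)" "\<And>v. length v = k \<Longrightarrow> \<theta> v ! q = b"
      by (rule open_boxE[OF p h], rule that)
    let ?\<chi> = "compose (cube k) (degen ?N (Suc q)) \<theta>"
    have \<chi>: "?\<chi> \<in> box_hom A k n" using compose_in_hom[OF *(1) degen_hom[OF *(2)]] .
    have "act W k ?N \<theta> C = act W k n ?\<chi> (act W n ?N (face ?N (Suc q) b) C)"
      using not_full_factor[OF *(1,2,4)] cubical_comp[OF cW \<chi> face_hom[OF *(2)] C(1)] by metis
    then have "(k, act W k ?N \<theta> C) \<in> pdomain R"
      using pdomain_act[OF R others[OF *(2,3)] \<chi>] by simp
    then show ?thesis using uI by (auto simp: pdomain_def)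
  qed
  have Oclosed: "compose (cube m) \<theta> \<phi> \<in> ?O m" if h: "\<theta> \<in> ?O k" "\<phi> \<in> box_hom A m k" for m k \<theta> \<phi>
  proof -
    obtain q b where *: "\<theta> \<in> box_hom A k ?N" "q \<le> n" "(q, b) \<noteq> (p, \<eta>)" "\<And>v. length v = k \<Longrightarrow> \<theta> v ! q = b"
      by (rule open_boxE[OF p h(1)], rule that)
    have "compose (cube m) \<theta> \<phi> \<in> box_hom A m ?N" using compose_in_hom[OF h(2) *(1)] .
    moreover have "compose (cube m) \<theta> \<phi> v ! q = b" if "length v = m" for v
      using *(4) box_hom_length[OF h(2) that] that by simp
    ultimately show ?thesis by (rule open_boxI[OF p _ *(2,3)])
  qed
  have "marked_map A (open_box A ?N ?i \<eta>) Y u"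
    unfolding marked_map_def
  proof (intro conjI allI ballI)
    show "u k \<in> ?O k \<rightarrow> cubes Y k" for k using partial_mapD(2)[OF R uR] by (intro funcsetI)
    show "u m (act (open_box A ?N ?i \<eta>) m k \<phi> \<theta>) = act Y m k \<phi> (u k \<theta>)"
      if "\<phi> \<in> box_hom A m k" "\<theta> \<in> ?O k" for m k \<phi> \<theta>
      unfolding comical_simps
    proof (rule uI)
      show "(m, act W m ?N (compose (cube m) \<theta> \<phi>) C, act Y m k \<phi> (u k \<theta>)) \<in> R"
        using partial_mapD(4)[OF R uR[OF that(2)] that(1)] cubical_comp[OF cW that(1) Ohom[OF that(2)] C(1)] by simp
    qed
    show "u k \<in> marked (open_box A ?N ?i \<eta>) k \<rightarrow> marked Y k" for k
    proof
      fix \<theta> assume "\<theta> \<in> marked (open_box A ?N ?i \<eta>) k"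
      then have *: "\<theta> \<in> ?O k" "\<theta> \<in> degenerate A (representable A ?N) k \<or> \<theta> \<in> critical_faces ?N ?i \<eta> k"
        by (auto simp: comical_simps)
      then have "act W k ?N \<theta> C \<in> marked W k"
        using degenerate_representable[OF cW C(1)] dW crit by blast
      then show "u k \<theta> \<in> marked Y k" using partial_mapD(3)[OF R uR[OF *(1)]] by blast
    qed
  qed
  then obtain v where v: "marked_map A (comical_cube A ?N ?i \<eta>) Y v"
    "\<And>k \<theta>. \<theta> \<in> ?O k \<Longrightarrow> v k \<theta> = u k \<theta>"
    using rlp1 unfolding has_rlp_def by blast
  have vc: "v k \<theta> \<in> cubes Y k" if "\<theta> \<in> box_hom A k ?N" for k \<theta>
    using v(1) that unfolding marked_map_def comical_simps by blast
  have vn: "v m (compose (cube m) \<theta> \<phi>) = act Y m k \<phi> (v k \<theta>)"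
    if "\<phi> \<in> box_hom A m k" "\<theta> \<in> box_hom A k ?N" for m k \<theta> \<phi>
    using v(1) that unfolding marked_map_def comical_simps by blast
  have vm: "v k \<theta> \<in> marked Y k" if "\<theta> \<in> marked (comical_cube A ?N ?i \<eta>) k" for k \<theta>
    using v(1) that unfolding marked_map_def by blast
  have vR: "(k, act W k ?N \<theta> C, v k \<theta>) \<in> R" if "\<theta> \<in> ?O k" for k \<theta>
    using uR[OF that] v(2)[OF that] by simp
  let ?f = "\<lambda>q b. face ?N (Suc q) b"
  have fO: "?f q b \<in> ?O n" if "q \<le> n" "(q, b) \<noteq> (p, \<eta>)" for q b
    by (rule open_boxI[OF p face_hom[OF that(1)] that]) (use that in \<open>simp add: nth_insert_at\<close>)
  note fh = face_hom[OF p, of \<eta> A]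
  define H where "H = v n (?f p \<eta>)"
  have H: "H \<in> cubes Y n" unfolding H_def by (rule vc[OF fh])
  \<comment> \<open>If \<open>c\<close> is marked, then all other faces of codimension one have
    marked images, so the filler is a map on \<open>comical_cube'\<close>; extending it to the
    truncation marks the value at the missing face.\<close>
  have Hm: "H \<in> marked Y n" if "c \<in> marked W n"
  proof -
    have n1: "n \<ge> 1" using lmarked[OF that] by simp
    have "marked_map A (comical_cube' A ?N ?i \<eta>) Y v"
      unfolding marked_map_def
    proof (intro conjI allI ballI)
      show "v k \<in> cubes (comical_cube' A ?N ?i \<eta>) k \<rightarrow> cubes Y k" for k
        using vc by (simp add: comical_simps)
      show "v m (act (comical_cube' A ?N ?i \<eta>) m k \<phi> x) = act Y m k \<phi> (v k x)"
        if "\<phi> \<in> box_hom A m k" "x \<in> cubes (comical_cube' A ?N ?i \<eta>) k" for m k \<phi> x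
        using vn that by (simp add: comical_simps)
      show "v k \<in> marked (comical_cube' A ?N ?i \<eta>) k \<rightarrow> marked Y k" for k
      proof
        fix \<theta> assume "\<theta> \<in> marked (comical_cube' A ?N ?i \<eta>) k"
        then consider "\<theta> \<in> marked (comical_cube A ?N ?i \<eta>) k" | "k = n" "\<theta> \<in> faces ?N n" "\<theta> \<noteq> ?f p \<eta>"
          unfolding comical_simps(8) by (auto split: if_splits)
        then show "v k \<theta> \<in> marked Y k"
        proof cases
          case 1 then show ?thesis by (rule vm)
        next
          case 2
          then obtain q b where qb: "q \<le> n" "\<theta> = ?f q b" using face_of_faces by metis
          then have ne: "(q, b) \<noteq> (p, \<eta>)" using 2(3) by auto
          show ?thesis
            using partial_mapD(3)[OF R vR[OF fO[OF qb(1) ne]]] lmarked[OF that] qb ne 2(1) by blast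
        qed
      qed
    qed
    then obtain v' where v': "marked_map A (trunc (?N - 2) (comical_cube A ?N ?i \<eta>)) Y v'"
      "\<And>k \<theta>. \<theta> \<in> box_hom A k ?N \<Longrightarrow> v' k \<theta> = v k \<theta>"
      using rlp2[OF n1] unfolding has_rlp_def comical_simps by blast
    have "?f p \<eta> \<in> marked (trunc (?N - 2) (comical_cube A ?N ?i \<eta>)) n"
      using fh n1 unfolding comical_simps by auto
    then have "v' n (?f p \<eta>) \<in> marked Y n" using v'(1) unfolding marked_map_def by blast
    then show ?thesis using v'(2)[OF fh] by (simp add: H_def)
  qed
  have epiQ: "?Q k (act W k m \<theta> x) (act Y k m \<theta> z)"
    if "epi A k m \<theta>" "x \<in> cubes W m" "z \<in> cubes Y m" "x \<in> marked W m \<Longrightarrow> z \<in> marked Y m" for k m \<theta> x z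
    using epi_degenerate[OF that(1) cY that(3)] dY that cubical_id[OF cW that(2)] cubical_id[OF cY that(3)] by auto
  have cc: "c \<in> cubes W n" unfolding c(1) by (rule cubical_act[OF cW fh C(1)])
  define R1 where "R1 = R \<union> {(k, act W k n \<theta> c, act Y k n \<theta> H) | k \<theta>. \<theta> \<in> box_hom A k n}"
  have faces1: "(n', act W n' n (face n (Suc q) b) c, act Y n' n (face n (Suc q) b) H) \<in> R"
    if "n = Suc n'" "q \<le> n'" for n' q b
  proof -
    have fq: "face n (Suc q) b \<in> box_hom A n' n" using face_hom[OF that(2)] that(1) by simp
    let ?\<theta> = "compose (cube n') (?f p \<eta>) (face n (Suc q) b)"
    have \<theta>: "?\<theta> \<in> box_hom A n' ?N" using compose_in_hom[OF fq fh] .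
    \<comment> \<open>Coordinate \<open>q\<close> of the missing face is coordinate
      \<open>q'\<close> of the whole cube. It differs from \<open>p\<close>, so the smaller face
      lies in the open box.\<close>
    define q' where "q' = (if q < p then q else Suc q)"
    have "?\<theta> v ! q' = b" if "length v = n'" for v
      using that \<open>n = Suc n'\<close> \<open>q \<le> n'\<close> p by (auto simp: q'_def nth_insert_at)
    moreover have q': "q' \<le> n" "(q', b) \<noteq> (p, \<eta>)" using that by (auto simp: q'_def)
    ultimately have "?\<theta> \<in> ?O n'" by (intro open_boxI[OF p \<theta> q']) simp
    from vR[OF this] show ?thesis
      using cubical_comp[OF cW fq fh C(1)] vn[OF fq fh] by (simp add: c(1) H_def)
  qed
  have R1: "partial_map A W Y ?Q R1" "(n, c, H) \<in> R1"
    "\<And>k w. (k, w) \<in> pdomain R1 \<Longrightarrow> w \<notin> degenerate A W k \<Longrightarrow> (k, w) \<in> pdomain R \<or> (k, w) = (n, c)"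
    unfolding R1_def
    using partial_map_attach[OF A cW cY R cc c(2,3) H faces1 epiQ[OF _ cc H Hm]] by blast+
  define K where "K = v ?N (idm ?N)"
  have K: "K \<in> cubes Y ?N" unfolding K_def by (rule vc[OF idm_in_hom])
  \<comment> \<open>The empty word is critical, so the identity of the comical cube is marked, and
    with it the value \<open>K\<close> of the filler.\<close>
  have Km: "K \<in> marked Y ?N"
  proof -
    have "face_comp ?N [] \<in> critical_faces ?N ?i \<eta> ?N"
      unfolding critical_faces_def
        by (rule CollectI, rule exI[of _ "[]"]) (simp add: face_words_def critical_word_def)
    then show ?thesis unfolding K_def by (intro vm) (simp add: comical_simps)
  qed
  have vK: "v n (?f q b) = act Y n ?N (?f q b) K" if "q \<le> n" for q b
    using vn[OF face_hom[OF that] idm_in_hom] compose_idm_left[OF face_hom[OF that]] unfolding K_def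
      by metis
  have faces2: "(n', act W n' ?N (face ?N (Suc q) b) C, act Y n' ?N (face ?N (Suc q) b) K) \<in> R1"
    if "?N = Suc n'" "q \<le> n'" for n' q b
  proof (cases "(q, b) = (p, \<eta>)")
    case True
    then show ?thesis using R1(2) vK[OF p, of \<eta>] that c(1) by (simp add: H_def)
  next
    case False
    then show ?thesis using vR[OF fO[of q b]] vK[of q b] that unfolding R1_def by simp
  qed
  have C_notin: "(?N, C) \<notin> pdomain R1"
  proof
    assume "(?N, C) \<in> pdomain R1"
    then have "(?N, C) \<in> pdomain R" using R1(3)[of ?N C] C(2) by auto
    then show False using pdomain_act[OF R _ fh] c(1,3) by auto
  qed
  define R2 where "R2 = R1 \<union> {(k, act W k ?N \<theta> C, act Y k ?N \<theta> K) | k \<theta>. \<theta> \<in> box_hom A k ?N}"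
  have R2: "partial_map A W Y ?Q R2" "(?N, C, K) \<in> R2"
    "\<And>k w. (k, w) \<in> pdomain R2 \<Longrightarrow> w \<notin> degenerate A W k \<Longrightarrow> (k, w) \<in> pdomain R1 \<or> (k, w) = (?N, C)"
    unfolding R2_def
    using partial_map_attach[OF A cW cY R1(1) C C_notin K faces2 epiQ[OF _ C(1) K Km]] by blast+
  have "R \<subset> R2" using R2(2) C_notin unfolding R2_def R1_def pdomain_def by blast
  moreover have "(?N, C) \<in> pdomain R2" using R2(2) by (auto simp: pdomain_def)
  ultimately show ?thesis using R2(1,3) R1(3) by blast
qed

section \<open>Labelled maps\<close>

type_synonym lmap = "(bool \<times> bool) list \<Rightarrow> bool list"

text \<open>The ordinary variables and the formal edges undergo the same substitution
  \<psi>.\<close>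

definition on_pairs :: "vmap \<Rightarrow> (bool \<times> bool) list \<Rightarrow> (bool \<times> bool) list" where
  "on_pairs \<psi> w = zip (\<psi> (map fst w)) (\<psi> (map snd w))"

definition join_pair :: "bool \<Rightarrow> bool \<times> bool \<Rightarrow> bool \<times> bool \<Rightarrow> bool \<times> bool" where
  "join_pair e a b = (join e (fst a) (fst b), join e (snd a) (snd b))"

lemma length_on_pairs: "\<psi> \<in> box_hom A k n \<Longrightarrow> length w = k \<Longrightarrow> length (on_pairs \<psi> w) = n"
  by (simp add: on_pairs_def box_hom_length)

lemma nth_on_pairs: "\<psi> \<in> box_hom A k n \<Longrightarrow> length w = k \<Longrightarrow> j < n \<Longrightarrow>
    on_pairs \<psi> w ! j = (\<psi> (map fst w) ! j, \<psi> (map snd w) ! j)"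
  by (simp add: on_pairs_def box_hom_length)

lemma on_pairs_face: "length w = n \<Longrightarrow> p \<le> n \<Longrightarrow> on_pairs (face (Suc n) (Suc p) \<eta>) w = insert_at p (\<eta>, \<eta>) w"
  by (rule nth_equalityI) (auto simp: on_pairs_def nth_insert_at)

lemma on_pairs_degen: "length w = Suc n \<Longrightarrow> p \<le> n \<Longrightarrow> on_pairs (degen (Suc n) (Suc p)) w = delete_at p w"
  by (rule nth_equalityI) (auto simp: on_pairs_def nth_delete_at)

lemma on_pairs_conn: "length w = Suc n \<Longrightarrow> p < n \<Longrightarrow>
  on_pairs (conn (Suc n) (Suc p) e) w = merge_at (join_pair e) p w"
  by (rule nth_equalityI) (auto simp: on_pairs_def nth_merge_at join_pair_def)

lemma on_pairs_compose: "\<psi> \<in> box_hom A k m \<Longrightarrow> \<phi> \<in> box_hom A m n \<Longrightarrow> length w = k \<Longrightarrow>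
    on_pairs (compose (cube k) \<phi> \<psi>) w = on_pairs \<phi> (on_pairs \<psi> w)"
  by (simp add: on_pairs_def box_hom_length)

lemma on_pairs_idm: "length w = n \<Longrightarrow> on_pairs (idm n) w = w"
  by (simp add: on_pairs_def zip_map_fst_snd)

lemma depends_on_pairs:
  assumes "\<psi> \<in> box_hom A k n" "j < n" "depends k (on_pairs \<psi>) j c" shows "depends k \<psi> j c"
proof -
  obtain w a where w: "c < k" "length w = k" "on_pairs \<psi> w ! j \<noteq> on_pairs \<psi> (w[c := a]) ! j"
    using assms(3) by (auto simp: depends_def)
  then have "\<psi> (map fst w) ! j \<noteq> \<psi> ((map fst w)[c := fst a]) ! j \<or>
      \<psi> (map snd w) ! j \<noteq> \<psi> ((map snd w)[c := snd a]) ! j"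
    using nth_on_pairs[OF assms(1) _ assms(2)] by (auto simp: map_update)
  then show ?thesis using w unfolding depends_def by (metis length_map)
qed

lemma ordered_on_pairs: "\<psi> \<in> box_hom A k n \<Longrightarrow> ordered k n (on_pairs \<psi>)"
  using ordered_box_hom[of \<psi> A k n] depends_on_pairs[of \<psi> A k n] unfolding ordered_def
    by (meson less_trans)

text \<open>Expresses two things at once: monotonicity, and independence of the second components.
  These are the coordinates without formal edges.\<close>

definition fst_mono :: "nat \<Rightarrow> ((bool \<times> bool) list \<Rightarrow> bool) \<Rightarrow> bool" where
  "fst_mono n c \<longleftrightarrow> (\<forall>w w'. length w = n \<and> length w' = n \<and> (\<forall>k<n. fst (w ! k) \<le> fst (w' ! k)) \<longrightarrow>
    c w \<le> c w')"

lemma fst_monoI: "(\<And>w w'. length w = n \<Longrightarrow> length w' = n \<Longrightarrow> (\<And>k. k < n \<Longrightarrow> fst (w ! k) \<le> fst (w' ! k)) \<Longrightarrow>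
  c w \<le> c w')
    \<Longrightarrow> fst_mono n c"
  by (auto simp: fst_mono_def)

lemma fst_monoD: "fst_mono n c \<Longrightarrow> length w = n \<Longrightarrow> length w' = n \<Longrightarrow> (\<And>k. k < n \<Longrightarrow>
  fst (w ! k) \<le> fst (w' ! k)) \<Longrightarrow> c w \<le> c w'"
  unfolding fst_mono_def by blast

lemma fst_mono_fst: "fst_mono n c \<Longrightarrow> length w = n \<Longrightarrow> length w' = n \<Longrightarrow> (\<And>k. k < n \<Longrightarrow>
  fst (w ! k) = fst (w' ! k)) \<Longrightarrow> c w = c w'"
  by (rule antisym; rule fst_monoD[of n c]) auto

lemma fst_mono_comp:
  assumes "fst_mono n c" "\<And>w. length w = k \<Longrightarrow> length (s w) = n"
    and "\<And>w w' j. length w = k \<Longrightarrow> length w' = k \<Longrightarrow> (\<And>q. q < k \<Longrightarrow> fst (w ! q) \<le> fst (w' ! q)) \<Longrightarrow> j < n \<Longrightarrow>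
      fst (s w ! j) \<le> fst (s w' ! j)"
  shows "fst_mono k (\<lambda>w. c (s w))"
  by (rule fst_monoI, rule fst_monoD[OF assms(1)]) (use assms(2,3) in blast)+

lemma fst_mono_insert_at: "fst_mono (Suc n) c \<Longrightarrow> p \<le> n \<Longrightarrow> fst_mono n (\<lambda>w. c (insert_at p (\<eta>, \<eta>) w))"
  by (rule fst_mono_comp[of "Suc n" c]) (auto simp: nth_insert_at)

lemma fst_mono_delete_at: "fst_mono n c \<Longrightarrow> p \<le> n \<Longrightarrow> fst_mono (Suc n) (\<lambda>w. c (delete_at p w))"
  by (rule fst_mono_comp[of n c]) (auto simp: nth_delete_at)

lemma fst_mono_merge_at: "fst_mono n c \<Longrightarrow> p < n \<Longrightarrow> fst_mono (Suc n) (\<lambda>w. c (merge_at (join_pair e) p w))"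
  by (rule fst_mono_comp[of n c]) (auto simp: nth_merge_at join_pair_def join_def)

lemma fst_mono_join: "fst_mono n c \<Longrightarrow> fst_mono n d \<Longrightarrow> fst_mono n (\<lambda>w. join e (c w) (d w))"
  unfolding fst_mono_def join_def by (cases e) (auto simp: le_bool_def)

lemma fst_mono_const: "fst_mono n (\<lambda>w. b)"
  by (simp add: fst_mono_def)

lemma fst_mono_nth: "x < n \<Longrightarrow> fst_mono n (\<lambda>w. fst (w ! x))"
  by (simp add: fst_mono_def)

lemma fst_mono_cong: "(\<And>w. length w = n \<Longrightarrow> c w = d w) \<Longrightarrow> fst_mono n c = fst_mono n d"
  by (simp add: fst_mono_def)

text \<open>Only ordinary variables count: for \<open>A = {}\<close>, a coordinate that is a formal
  edge is not a projection and has to be filled.\<close>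

definition is_proj :: "nat \<Rightarrow> ((bool \<times> bool) list \<Rightarrow> bool) \<Rightarrow> bool" where
  "is_proj n c \<longleftrightarrow> (\<exists>x<n. \<forall>w. length w = n \<longrightarrow> c w = fst (w ! x))"

abbreviation "pair_cube n \<equiv> {w :: (bool \<times> bool) list. length w = n}"

definition precomp :: "nat \<Rightarrow> vmap \<Rightarrow> lmap \<Rightarrow> lmap" where
  "precomp k \<psi> g = (\<lambda>w\<in>pair_cube k. g (on_pairs \<psi> w))"

definition postcomp :: "nat \<Rightarrow> vmap \<Rightarrow> lmap \<Rightarrow> lmap" where
  "postcomp n \<alpha> g = (\<lambda>w\<in>pair_cube n. \<alpha> (g w))"

definition via_fst :: "nat \<Rightarrow> vmap \<Rightarrow> lmap" where
  "via_fst n \<phi> = (\<lambda>w\<in>pair_cube n. \<phi> (map fst w))"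

lemma precomp_apply [simp]: "length w = k \<Longrightarrow> precomp k \<psi> g w = g (on_pairs \<psi> w)"
  and postcomp_apply [simp]: "length w = k \<Longrightarrow> postcomp k \<psi> g w = \<psi> (g w)"
  and via_fst_apply [simp]: "length w = k \<Longrightarrow> via_fst k \<psi> w = \<psi> (map fst w)"
  by (simp_all add: precomp_def postcomp_def via_fst_def)

lemma pair_cube_ext: "g \<in> extensional (pair_cube n) \<Longrightarrow> g' \<in> extensional (pair_cube n) \<Longrightarrow>
  (\<And>w. length w = n \<Longrightarrow> g w = g' w) \<Longrightarrow> g = g'"
  by (rule extensionalityI) auto

text \<open>A labelled map \<open>[1]\<^sup>n \<rightarrow> [1]\<^sup>m\<close> is a function of \<open>n\<close> pairs of booleans.  The first components are the
  ordinary variables; for \<open>A = {}\<close>, the second component of the \<open>t\<close>-th pair plays the role of the formal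
  edge \<open>E(t)\<close>, which has the same end points as the variable \<open>t\<close> because faces substitute pairs \<open>(b, b)\<close>.\<close>

locale labelled =
  fixes A :: "bool set" and e :: bool and sel :: "bool \<times> bool \<Rightarrow> bool"
  assumes A_sel: "(A = {e} \<and> sel = fst) \<or> (A = {} \<and> sel = snd)"
begin

lemma A_subset: "A \<subseteq> {e}"
  using A_sel by auto

lemma sel_diag [simp]: "sel (b, b) = b"
  using A_sel by auto

text \<open>A coordinate \<open>h\<close> join \<open>t\<close>, where \<open>sel (w ! t)\<close> is
  the variable itself for \<open>A = {e}\<close> and its formal edge for \<open>A = {}\<close>.
  Allowing \<open>h\<close> to be constantly \<open>e\<close> includes \<open>sel (w ! t)\<close>
  alone.\<close>

definition joins_last :: "nat \<Rightarrow> ((bool \<times> bool) list \<Rightarrow> bool) \<Rightarrow> nat \<Rightarrow> ((bool \<times> bool) list \<Rightarrow> bool) \<Rightarrow> bool" where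
  "joins_last n c t h \<longleftrightarrow> t < n \<and> fst_mono n h \<and>
     (\<forall>w w'. length w = n \<and> length w' = n \<and> (\<forall>k<t. w ! k = w' ! k) \<longrightarrow> h w = h w') \<and>
     (\<forall>w. length w = n \<longrightarrow> c w = join e (h w) (sel (w ! t)))"

lemma joins_lastI: "t < n \<Longrightarrow> fst_mono n h \<Longrightarrow>
    (\<And>w w'. length w = n \<Longrightarrow> length w' = n \<Longrightarrow> (\<And>k. k < t \<Longrightarrow> w ! k = w' ! k) \<Longrightarrow> h w = h w') \<Longrightarrow>
    (\<And>w. length w = n \<Longrightarrow> c w = join e (h w) (sel (w ! t))) \<Longrightarrow> joins_last n c t h"
  unfolding joins_last_def by (intro conjI allI impI) blast+

lemma joins_lastD:
  assumes "joins_last n c t h"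
  shows "t < n" "fst_mono n h" "length w = n \<Longrightarrow> c w = join e (h w) (sel (w ! t))"
    and "length w = n \<Longrightarrow> length w' = n \<Longrightarrow> (\<And>k. k < t \<Longrightarrow> w ! k = w' ! k) \<Longrightarrow> h w = h w'"
  using assms unfolding joins_last_def by blast+

text \<open>The first alternative contains the coordinates of all morphisms of Box_B; the second
  brings in the formal joins for \<open>A = {}\<close>, at most one edge in each coordinate.\<close>

definition admissible :: "nat \<Rightarrow> ((bool \<times> bool) list \<Rightarrow> bool) \<Rightarrow> bool" where
  "admissible n c \<longleftrightarrow> fst_mono n c \<or> (\<exists>t h. joins_last n c t h)"

lemma joins_last_cong: "(\<And>w. length w = n \<Longrightarrow> c w = d w) \<Longrightarrow> joins_last n c = joins_last n d"
  by (simp add: joins_last_def fun_eq_iff)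

lemma admissible_cong: "(\<And>w. length w = n \<Longrightarrow> c w = d w) \<Longrightarrow> admissible n c = admissible n d"
  using joins_last_cong[of n c d] fst_mono_cong[of n c d] by (simp add: admissible_def)

lemma admissible_fst:
  assumes "sel = fst" "admissible n c" shows "fst_mono n c"
proof (cases "fst_mono n c")
  case False
  then obtain t h where joins_last: "joins_last n c t h" using assms(2) by (auto simp: admissible_def)
  have "fst_mono n (\<lambda>w. join e (h w) (fst (w ! t)))"
    using joins_lastD(1,2)[OF joins_last] by (intro fst_mono_join fst_mono_nth)
  then show ?thesis
    using fst_mono_cong[of n c "\<lambda>w. join e (h w) (fst (w ! t))"] joins_lastD(3)[OF joins_last] assms(1) by simp
qed

lemma joins_last_insert_at:
  assumes "joins_last (Suc n) c t h" "p \<le> n" "p \<noteq> t"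
  shows "joins_last n (\<lambda>w. c (insert_at p (\<eta>, \<eta>) w)) (if t < p then t else t - 1) (\<lambda>w. h (insert_at p (\<eta>, \<eta>) w))"
proof (rule joins_lastI)
  note u = joins_lastD[OF assms(1)]
  show "(if t < p then t else t - 1) < n" using assms u(1) by auto
  show "fst_mono n (\<lambda>w. h (insert_at p (\<eta>, \<eta>) w))" using fst_mono_insert_at[OF u(2) assms(2)] .
  show "h (insert_at p (\<eta>, \<eta>) w) = h (insert_at p (\<eta>, \<eta>) w')"
    if "length w = n" "length w' = n" "\<And>k. k < (if t < p then t else t - 1) \<Longrightarrow> w ! k = w' ! k" for w w'
  proof (rule u(4))
    show "insert_at p (\<eta>, \<eta>) w ! k = insert_at p (\<eta>, \<eta>) w' ! k" if "k < t" for k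
      using that(1) \<open>length w = n\<close> \<open>length w' = n\<close> \<open>\<And>k. k < (if t < p then t else t - 1) \<Longrightarrow>
        w ! k = w' ! k\<close>[of k]
        \<open>\<And>k. k < (if t < p then t else t - 1) \<Longrightarrow> w ! k = w' ! k\<close>[of "k - 1"] assms(2,3) u(1)
      by (cases "t < p"; cases "k < p"; cases "k = p") (simp_all add: nth_insert_at)
  qed (use that in simp_all)
  show "c (insert_at p (\<eta>, \<eta>) w) = join e (h (insert_at p (\<eta>, \<eta>) w)) (sel (w ! (if t < p then t else t - 1)))"
    if "length w = n" for w
    using u(3)[of "insert_at p (\<eta>, \<eta>) w"] that assms u(1) by (auto simp: nth_insert_at)
qed

text \<open>Fixing the variable \<open>t\<close> turns its edge into a constant, after which the
  coordinate is an ordinary one. Fixing any other variable keeps the form \<open>h\<close> join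
  \<open>t\<close>.\<close>

lemma admissible_insert_at:
  assumes "admissible (Suc n) c" "p \<le> n"
  shows "admissible n (\<lambda>w. c (insert_at p (\<eta>, \<eta>) w))"
proof (cases "fst_mono (Suc n) c")
  case True
  then show ?thesis using fst_mono_insert_at[OF True assms(2)] by (simp add: admissible_def)
next
  case False
  then obtain t h where joins_last: "joins_last (Suc n) c t h" using assms(1)
    by (auto simp: admissible_def)
  show ?thesis
  proof (cases "p = t")
    case False
    then show ?thesis using joins_last_insert_at[OF joins_last assms(2) False]
      unfolding admissible_def by blast
  next
    case True
    have eq: "c (insert_at p (\<eta>, \<eta>) w) = join e (h (insert_at p (\<eta>, \<eta>) w)) \<eta>" if "length w = n" for w
      using joins_lastD(3)[OF joins_last, of "insert_at p (\<eta>, \<eta>) w"] that assms(2) True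
        by (simp add: nth_insert_at)
    have "fst_mono n (\<lambda>w. join e (h (insert_at p (\<eta>, \<eta>) w)) \<eta>)"
      using fst_mono_insert_at[OF joins_lastD(2)[OF joins_last] assms(2)]
        by (intro fst_mono_join fst_mono_const)
    then show ?thesis using fst_mono_cong[of n "\<lambda>w. c (insert_at p (\<eta>, \<eta>) w)"] eq
      by (simp add: admissible_def)
  qed
qed

lemma admissible_delete_at:
  assumes "admissible n c" "p \<le> n"
  shows "admissible (Suc n) (\<lambda>w. c (delete_at p w))"
proof (cases "fst_mono n c")
  case True
  then show ?thesis using fst_mono_delete_at[OF True assms(2)] by (simp add: admissible_def)
next
  case False
  then obtain t h where joins_last: "joins_last n c t h" using assms(1) by (auto simp: admissible_def)
  note u = joins_lastD[OF joins_last]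
  have "joins_last (Suc n) (\<lambda>w. c (delete_at p w)) (if t < p then t else Suc t) (\<lambda>w. h (delete_at p w))"
  proof (rule joins_lastI)
    show "(if t < p then t else Suc t) < Suc n" using u(1) by simp
    show "fst_mono (Suc n) (\<lambda>w. h (delete_at p w))" using fst_mono_delete_at[OF u(2) assms(2)] .
    show "h (delete_at p w) = h (delete_at p w')"
      if "length w = Suc n" "length w' = Suc n" "\<And>k. k < (if t < p then t else Suc t) \<Longrightarrow>
        w ! k = w' ! k" for w w'
      by (rule u(4)) (use that assms u(1) in \<open>auto simp: nth_delete_at split: if_splits\<close>)
    show "c (delete_at p w) = join e (h (delete_at p w)) (sel (w ! (if t < p then t else Suc t)))"
      if "length w = Suc n" for w
      using u(3)[of "delete_at p w"] that assms u(1) by (auto simp: nth_delete_at)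
  qed
  then show ?thesis unfolding admissible_def by blast
qed

lemma admissible_mono:
  assumes "admissible n c" "length w = n" "length w' = n"
    and "\<And>k. k < n \<Longrightarrow> fst (w ! k) \<le> fst (w' ! k)" "\<And>k. k < n \<Longrightarrow> snd (w ! k) \<le> snd (w' ! k)"
  shows "c w \<le> c w'"
proof (cases "fst_mono n c")
  case True
  then show ?thesis by (rule fst_monoD) (use assms in auto)
next
  case False
  then obtain t h where joins_last: "joins_last n c t h" using assms(1) by (auto simp: admissible_def)
  have "h w \<le> h w'" by (rule fst_monoD[OF joins_lastD(2)[OF joins_last]]) (use assms in auto)
  moreover have "sel (w ! t) \<le> sel (w' ! t)"
    using assms(4,5)[OF joins_lastD(1)[OF joins_last]] A_sel by auto
  ultimately show ?thesis
    using joins_lastD(3)[OF joins_last assms(2)] joins_lastD(3)[OF joins_last assms(3)]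
      by (cases e) (auto simp: join_def)
qed

definition lmaps :: "nat \<Rightarrow> nat \<Rightarrow> lmap set" where
  "lmaps n m = {g. g \<in> extensional (pair_cube n) \<and> (\<forall>w. length w = n \<longrightarrow> length (g w) = m) \<and>
    ordered n m g \<and>
     (\<forall>i<m. admissible n (\<lambda>w. g w ! i))}"

lemma lmapsI: "g \<in> extensional (pair_cube n) \<Longrightarrow> (\<And>w. length w = n \<Longrightarrow> length (g w) = m) \<Longrightarrow> ordered n m g \<Longrightarrow>
    (\<And>i. i < m \<Longrightarrow> admissible n (\<lambda>w. g w ! i)) \<Longrightarrow> g \<in> lmaps n m"
  by (simp add: lmaps_def)

lemma lmapsD:
  assumes "g \<in> lmaps n m"
  shows "g \<in> extensional (pair_cube n)" "length w = n \<Longrightarrow> length (g w) = m" "ordered n m g" "i < m \<Longrightarrow>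
    admissible n (\<lambda>w. g w ! i)"
  using assms by (auto simp: lmaps_def)

lemma lmaps_ext:
  assumes "g \<in> lmaps n m" "g' \<in> lmaps n m" "\<And>w i. length w = n \<Longrightarrow> i < m \<Longrightarrow> g w ! i = g' w ! i"
  shows "g = g'"
proof (rule pair_cube_ext[OF lmapsD(1)[OF assms(1)] lmapsD(1)[OF assms(2)]])
  show "g w = g' w" if "length w = n" for w
    by (rule nth_equalityI)
      (use lmapsD(2)[OF assms(1) that] lmapsD(2)[OF assms(2) that] assms(3)[OF that] in simp_all)
qed

lemma precomp_lmaps:
  assumes "\<psi> \<in> box_hom A k n" "g \<in> lmaps n m" shows "precomp k \<psi> g \<in> lmaps k m"
proof (rule lmapsI)
  show "precomp k \<psi> g \<in> extensional (pair_cube k)" by (simp add: precomp_def)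
  show "length (precomp k \<psi> g w) = m" if "length w = k" for w
    using that length_on_pairs[OF assms(1) that] lmapsD(2)[OF assms(2)] by simp
  show "ordered k m (precomp k \<psi> g)"
    using ordered_comp[OF lmapsD(3)[OF assms(2)] ordered_on_pairs[OF assms(1)] length_on_pairs[OF assms(1)]]
      ordered_cong[of k "precomp k \<psi> g" "\<lambda>w. g (on_pairs \<psi> w)"] by simp
  fix i assume i: "i < m"
  have "admissible k (\<lambda>w. c (on_pairs \<psi> w))" if "admissible n c" for c
    using assms(1) that
  proof (induction arbitrary: c rule: box_hom_induct)
    case (idm n)
    then show ?case using admissible_cong[of n "\<lambda>w. c (on_pairs (idm n) w)" c] on_pairs_idm by simp
  next
    case (face n p \<eta>)
    then show ?case
      using admissible_insert_at[of n c p \<eta>] admissible_cong[of n "\<lambda>w. c (on_pairs (face (Suc n) (Suc p) \<eta>) w)"] on_pairs_face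
      by simp
  next
    case (degen n p)
    then show ?case using admissible_delete_at[of n c p] admissible_cong[of "Suc n"
      "\<lambda>w. c (on_pairs (degen (Suc n) (Suc p)) w)"] on_pairs_degen
      by simp
  next
    \<comment> \<open>A connection in \<open>A\<close> forces \<open>sel = fst\<close>; so a formal
      edge never has to be merged with another variable.\<close>
    case (conn n p e')
    then have "sel = fst" "e' = e" using A_sel by auto
    then have "fst_mono (Suc n) (\<lambda>w. c (merge_at (join_pair e) p w))"
      using fst_mono_merge_at[OF admissible_fst[OF _ conn(3)] conn(2)] by simp
    then show ?case
      using fst_mono_cong[of "Suc n"
        "\<lambda>w. c (on_pairs (conn (Suc n) (Suc p) e') w)"] on_pairs_conn[OF _ conn(2)] \<open>e' = e\<close>
      by (simp add: admissible_def)
  next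
    case (comp k m n \<psi> \<phi>)
    have "admissible k (\<lambda>w. c (on_pairs \<phi> (on_pairs \<psi> w)))" by (rule comp(3)[OF comp(4)[OF comp(5)]])
    then show ?case
      using admissible_cong[of k "\<lambda>w. c (on_pairs (compose (cube k) \<phi> \<psi>) w)"] on_pairs_compose[OF comp(1,2)] by simp
  qed
  from this[OF lmapsD(4)[OF assms(2) i]] show "admissible k (\<lambda>w. precomp k \<psi> g w ! i)"
    using admissible_cong[of k "\<lambda>w. precomp k \<psi> g w ! i"] by simp
qed

lemma postcomp_lmaps:
  assumes "\<alpha> \<in> box_hom A m m'" "g \<in> lmaps n m" shows "postcomp n \<alpha> g \<in> lmaps n m'"
proof (rule lmapsI)
  show "postcomp n \<alpha> g \<in> extensional (pair_cube n)" by (simp add: postcomp_def)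
  show "length (postcomp n \<alpha> g w) = m'" if "length w = n" for w
    using that box_hom_length[OF assms(1)] lmapsD(2)[OF assms(2)] by simp
  show "ordered n m' (postcomp n \<alpha> g)"
    using ordered_comp[OF ordered_box_hom[OF assms(1)] lmapsD(3)[OF assms(2)] lmapsD(2)[OF assms(2)]]
      ordered_cong[of n "postcomp n \<alpha> g" "\<lambda>w. \<alpha> (g w)"] by simp
  fix i assume i: "i < m'"
  have "admissible n (\<lambda>w. \<alpha> (g w) ! i)"
    if "\<And>w. length w = n \<Longrightarrow> length (g w) = m" "\<And>i. i < m \<Longrightarrow> admissible n (\<lambda>w. g w ! i)" for g :: lmap
    using assms(1) that i
  proof (induction arbitrary: g i rule: box_hom_induct)
    case (idm m)
    then show ?case using admissible_cong[of n "\<lambda>w. idm m (g w) ! i"] by simp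
  next
    case (face m p \<eta>)
    have eq: "face (Suc m) (Suc p) \<eta> (g w) ! i = (if i < p then g w ! i else
      if i = p then \<eta> else g w ! (i - 1))"
      if "length w = n" for w using face that by (simp add: nth_insert_at)
    have "admissible n (\<lambda>w. if i < p then g w ! i else if i = p then \<eta> else g w ! (i - 1))"
      using face(3)[of i] face(3)[of "i - 1"] face(1,4) fst_mono_const[of n \<eta>]
      by (cases "i < p"; cases "i = p") (simp_all add: admissible_def)
    then show ?case using admissible_cong[of n, OF eq] by simp
  next
    case (degen m p)
    have eq: "degen (Suc m) (Suc p) (g w) ! i = (if i < p then g w ! i else g w ! Suc i)"
      if "length w = n" for w using degen that by (simp add: nth_delete_at)
    have "admissible n (\<lambda>w. if i < p then g w ! i else g w ! Suc i)"
      using degen(3)[of i] degen(3)[of "Suc i"] degen(1,4) by (cases "i < p") simp_all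
    then show ?case using admissible_cong[of n, OF eq] by simp
  next
    case (conn m p e')
    then have s: "sel = fst" using A_sel by auto
    have eq: "conn (Suc m) (Suc p) e' (g w) ! i =
        (if i < p then g w ! i else if i = p then join e' (g w ! p) (g w ! Suc p) else g w ! Suc i)"
      if "length w = n" for w using conn that by (simp add: nth_merge_at)
    have "admissible n (\<lambda>w. if i < p then g w ! i else
      if i = p then join e' (g w ! p) (g w ! Suc p) else g w ! Suc i)"
    proof -
      have "admissible n (\<lambda>w. join e' (g w ! p) (g w ! Suc p))"
        using conn fst_mono_join[OF admissible_fst[OF s] admissible_fst[OF s], of n "\<lambda>w. g w ! p"
          "\<lambda>w. g w ! Suc p" e']
        by (simp add: admissible_def)
      then show ?thesis
        using conn(4)[of i] conn(4)[of "Suc i"] conn(5) by (cases "i < p"; cases "i = p") simp_all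
    qed
    then show ?case using admissible_cong[of n, OF eq] by simp
  next
    case (comp k m m' \<psi> \<phi>)
    have len: "length (\<psi> (g w)) = m" if "length w = n" for w
      using box_hom_length[OF comp(1)] comp(5)[OF that] by simp
    have "admissible n (\<lambda>w. \<phi> (\<psi> (g w)) ! i)"
    proof (rule comp(4)[of "\<lambda>w. \<psi> (g w)", OF _ _ comp(7)])
      show "admissible n (\<lambda>w. \<psi> (g w) ! i)" if "i < m" for i
        using comp(3)[of g i] comp(5,6) that by blast
    qed (use len in blast)
    then show ?case using admissible_cong[of n "\<lambda>w. compose (cube k) \<phi> \<psi> (g w) ! i"] comp(5) by simp
  qed
  from this[OF lmapsD(2)[OF assms(2)] lmapsD(4)[OF assms(2)]] show "admissible n (\<lambda>w. postcomp n \<alpha> g w ! i)"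
    using admissible_cong[of n "\<lambda>w. postcomp n \<alpha> g w ! i"] by simp
qed

text \<open>Monotonicity and order hold for morphisms of the cube category whichever connections
  occur in them.\<close>

lemma via_fst_lmaps:
  assumes "\<phi> \<in> box_hom B n m" shows "via_fst n \<phi> \<in> lmaps n m"
proof (rule lmapsI)
  show "via_fst n \<phi> \<in> extensional (pair_cube n)" by (simp add: via_fst_def)
  show "length (via_fst n \<phi> w) = m" if "length w = n" for w using that box_hom_length[OF assms] by simp
  have "ordered n n (map fst :: (bool \<times> bool) list \<Rightarrow> bool list)"
  proof -
    have "depends n (map fst :: (bool \<times> bool) list \<Rightarrow> bool list) i k \<Longrightarrow> i < n \<Longrightarrow> i = k" for i k
      unfolding depends_def by (auto simp: map_update nth_list_update split: if_splits)
    then show ?thesis unfolding ordered_def by (metis less_trans)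
  qed
  from ordered_comp[OF ordered_box_hom[OF assms] this]
  show "ordered n m (via_fst n \<phi>)" using ordered_cong[of n "via_fst n \<phi>" "\<lambda>w. \<phi> (map fst w)"] by simp
  fix i assume i: "i < m"
  have "fst_mono n (\<lambda>w. \<phi> (map fst w) ! i)"
    by (rule fst_monoI, rule box_hom_mono_le[OF assms]) (use i in auto)
  then show "admissible n (\<lambda>w. via_fst n \<phi> w ! i)"
    using fst_mono_cong[of n "\<lambda>w. via_fst n \<phi> w ! i"] by (simp add: admissible_def)
qed

text \<open>For a map of \<open>Box_B\<close>, every coordinate of \<open>[1]\<^sup>n\<close> reappears unchanged in the target iff the map is a
  face; this is the case that must stay unmarked.\<close>

definition lmarked :: "nat \<Rightarrow> nat \<Rightarrow> lmap set" where
  "lmarked n m = {g \<in> lmaps n m. \<exists>q<n. \<forall>i<m. \<not> (\<forall>w. length w = n \<longrightarrow> g w ! i = fst (w ! q)) \<and>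
     \<not> (\<forall>w. length w = n \<longrightarrow> g w ! i = snd (w ! q))}"

definition lcset :: "nat \<Rightarrow> lmap mcset" where
  "lcset m = \<lparr>cubes = \<lambda>n. lmaps n m, act = \<lambda>k n \<psi> g. precomp k \<psi> g, marked = \<lambda>n. lmarked n m\<rparr>"

lemma lcset_simps [simp]: "cubes (lcset m) n = lmaps n m" "act (lcset m) k n \<psi> g = precomp k \<psi> g"
  "marked (lcset m) n = lmarked n m"
  by (simp_all add: lcset_def)

lemma cubical_lcset: "cubical_set A (lcset m)"
  unfolding cubical_set_def
proof (intro conjI allI ballI)
  show "act (lcset m) k n \<phi> \<in> cubes (lcset m) n \<rightarrow> cubes (lcset m) k" if "\<phi> \<in> box_hom A k n" for k n \<phi>
    using precomp_lmaps[OF that] by simp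
  show "act (lcset m) n n (idm n) x = x" if "x \<in> cubes (lcset m) n" for n x
    using that
      by (intro pair_cube_ext[of _ n]) (auto simp: lmapsD(1) on_pairs_idm, simp add: precomp_def)
  show "act (lcset m) k n (compose (cube k) \<phi> \<psi>) x = act (lcset m) k l \<psi> (act (lcset m) l n \<phi> x)"
    if "\<psi> \<in> box_hom A k l" "\<phi> \<in> box_hom A l n" "x \<in> cubes (lcset m) n" for k l n \<psi> \<phi> x
    using on_pairs_compose[OF that(1,2)] length_on_pairs[OF that(1)]
    by (intro pair_cube_ext[of _ k]) (auto, simp_all add: precomp_def)
qed

text \<open>A coordinate equal to the variable \<open>p\<close>, or to its edge, would change with
  \<open>p\<close>. The hypothesis is invariance, not a factorization, so that the lemma applies to
  degeneracies both in \<open>lcset m\<close> and in \<open>kan_ext\<close>.\<close>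

lemma lmarked_degen:
  assumes "p \<le> n" "g \<in> lmaps (Suc n) m" "\<And>w a. length w = Suc n \<Longrightarrow> g (w[p := a]) = g w"
  shows "g \<in> lmarked (Suc n) m"
proof -
  have "\<not> (\<forall>w. length w = Suc n \<longrightarrow> g w ! i = \<pi> (w ! p))" if "\<pi> = fst \<or> \<pi> = snd" for i \<pi>
  proof
    assume *: "\<forall>w. length w = Suc n \<longrightarrow> g w ! i = \<pi> (w ! p)"
    let ?w = "\<lambda>b. (replicate (Suc n) (False, False))[p := (b, b)]"
    have "g (?w b) ! i = b" for b using *[rule_format, of "?w b"] that assms(1)
      by (auto simp del: replicate_Suc)
    moreover have "g (?w True) = g (?w False)"
      using assms(3)[of "replicate (Suc n) (False, False)"] by (simp del: replicate_Suc)
    ultimately show False by metis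
  qed
  then show ?thesis unfolding lmarked_def using assms(1,2) by (auto intro!: exI[of _ p])
qed

text \<open>The two points with a single \<open>(\<not> b, \<not> b)\<close>, at \<open>p\<close>
  and at \<open>Suc p\<close>, have the same merge but differ at \<open>p\<close>; so no coordinate
  is the variable \<open>p\<close>. Here \<open>b\<close> is arbitrary, which covers the connections
  of Box_B.\<close>

lemma lmarked_conn:
  assumes "p < n" "g \<in> lmaps (Suc n) m"
    "\<And>w w'. length w = Suc n \<Longrightarrow> length w' = Suc n \<Longrightarrow>
      merge_at (join_pair b) p w = merge_at (join_pair b) p w' \<Longrightarrow> g w = g w'"
  shows "g \<in> lmarked (Suc n) m"
proof -
  have "\<not> (\<forall>w. length w = Suc n \<longrightarrow> g w ! i = \<pi> (w ! p))" if "\<pi> = fst \<or> \<pi> = snd" for i \<pi>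
  proof
    assume *: "\<forall>w. length w = Suc n \<longrightarrow> g w ! i = \<pi> (w ! p)"
    let ?w = "\<lambda>q. (replicate (Suc n) (b, b))[q := (\<not> b, \<not> b)]"
    have "merge_at (join_pair b) p (?w p) = merge_at (join_pair b) p (?w (Suc p))"
      by (rule nth_equalityI)
        (use assms(1) in \<open>auto simp: nth_merge_at nth_list_update join_pair_def simp del: replicate_Suc\<close>)
    then have "g (?w p) = g (?w (Suc p))" by (intro assms(3)) (simp_all del: replicate_Suc)
    moreover have "g (?w p) ! i = (\<not> b)" "g (?w (Suc p)) ! i = b"
      using *[rule_format, of "?w p"] *[rule_format, of "?w (Suc p)"] that assms(1)
      by (auto simp del: replicate_Suc)
    ultimately show False by simp
  qed
  then show ?thesis unfolding lmarked_def using assms(1,2) by (auto intro!: exI[of _ p])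
qed

lemma marked_lcset: "marked_cubical_set A (lcset m)"
proof -
  have "degenerate A (lcset m) n \<subseteq> lmarked n m" for n
  proof
    fix g assume "g \<in> degenerate A (lcset m) n"
    then show "g \<in> lmarked n m"
    proof (cases rule: degenerateE)
      case (1 n' p y)
      have "g \<in> lmarked (Suc n') m"
      proof (rule lmarked_degen[OF 1(2)])
        show "g \<in> lmaps (Suc n') m" using 1 precomp_lmaps[OF degen_hom] by simp
        fix w :: "(bool \<times> bool) list" and a assume w: "length w = Suc n'"
        have "delete_at p (w[p := a]) = delete_at p w" using w 1(2)
          by (intro nth_equalityI) (auto simp: nth_delete_at)
        then show "g (w[p := a]) = g w" using 1 w on_pairs_degen[OF _ 1(2)] by simp
      qed
      then show ?thesis using 1 by simp
    next
      case (2 n' p y b)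
      have "g \<in> lmarked (Suc n') m"
      proof (rule lmarked_conn[OF 2(2)])
        show "g \<in> lmaps (Suc n') m" using 2 precomp_lmaps[OF conn_hom] by simp
        show "g w = g w'" if "length w = Suc n'" "length w' = Suc n'"
          "merge_at (join_pair b) p w = merge_at (join_pair b) p w'" for w w'
          using that 2 on_pairs_conn[OF _ 2(2)] by simp
      qed
      then show ?thesis using 2 by simp
    qed
  qed
  moreover have "lmarked n m \<subseteq> lmaps n m" "lmarked 0 m = {}" for n by (auto simp: lmarked_def)
  ultimately show ?thesis using cubical_lcset unfolding marked_cubical_set_def by simp
qed

end

section \<open>Matching cells at the last nontrivial coordinate\<close>

declare on_pairs_face [simp] on_pairs_degen [simp] on_pairs_conn [simp]

text \<open>Renumbering along a face at \<open>p\<close>: \<open>skip p\<close> sends the variables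
  of the face to those of the cube, and \<open>unskip p\<close> is its inverse away from
  \<open>p\<close>.\<close>

definition skip :: "nat \<Rightarrow> nat \<Rightarrow> nat" where "skip p q = (if q < p then q else Suc q)"
definition unskip :: "nat \<Rightarrow> nat \<Rightarrow> nat" where "unskip p q = (if q < p then q else q - 1)"

lemma insert_at_update: "q < length w \<Longrightarrow> p \<le> length w \<Longrightarrow>
  insert_at p b (w[q := a]) = (insert_at p b w)[skip p q := a]"
  by (rule nth_equalityI) (auto simp: nth_insert_at nth_list_update skip_def)

lemma insert_at_update_same: "p \<le> length w \<Longrightarrow> (insert_at p b w)[p := a] = insert_at p a w"
  by (rule nth_equalityI) (auto simp: nth_insert_at nth_list_update)

lemma delete_at_update: "q < length w \<Longrightarrow> p < length w \<Longrightarrow> q \<noteq> p \<Longrightarrow>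
  delete_at p (w[q := a]) = (delete_at p w)[unskip p q := a]"
  by (rule nth_equalityI) (auto simp: nth_delete_at nth_list_update unskip_def length_delete_at)

lemma delete_at_update_same: "p < length w \<Longrightarrow> delete_at p (w[p := a]) = delete_at p w"
  by (rule nth_equalityI) (auto simp: nth_delete_at nth_list_update length_delete_at)

lemma nth_insert_at_skip: "q < length w \<Longrightarrow> p \<le> length w \<Longrightarrow> insert_at p b w ! skip p q = w ! q"
  by (simp add: nth_insert_at skip_def)

lemma insert_at_merge_at_eq: "length w = Suc n \<Longrightarrow> p < n \<Longrightarrow>
  insert_at (Suc p) a (merge_at f p w) = w[p := f (w ! p) (w ! Suc p), Suc p := a]"
proof (rule nth_equalityI)
  fix i assume *: "length w = Suc n" "p < n" "i < length (insert_at (Suc p) a (merge_at f p w))"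
  then show "insert_at (Suc p) a (merge_at f p w) ! i = w[p := f (w ! p) (w ! Suc p), Suc p := a] ! i"
    by (cases i) (auto simp: nth_insert_at nth_merge_at nth_list_update)
qed simp

lemma full_depends: "full n m g \<Longrightarrow> j < m \<Longrightarrow> \<exists>q. depends n g j q"
proof -
  assume "full n m g" "j < m"
  then obtain w where w: "length w = n" "g w ! j \<noteq> g (replicate n undefined) ! j" using fullD by metis
  then show ?thesis using depends_if_neq[of w n "replicate n undefined" g j] by auto
qed

lemma is_proj_depends:
  assumes "is_proj n (\<lambda>w. g w ! j)" "depends n g j q" "depends n g j q'" shows "q = q'"
proof -
  obtain x where x: "\<And>w. length w = n \<Longrightarrow> g w ! j = fst (w ! x)" using assms(1)
    by (auto simp: is_proj_def)
  have "d = x" if d: "depends n g j d" for d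
  proof (rule ccontr)
    assume "d \<noteq> x"
    moreover obtain w a where "length w = n" "g w ! j \<noteq> g (w[d := a]) ! j" using d
      by (auto simp: depends_def)
    ultimately show False using x[of w] x[of "w[d := a]"] by simp
  qed
  then show ?thesis using assms by blast
qed

lemma fst_update: "k < length w \<Longrightarrow> fst (w ! q) = fst a \<Longrightarrow> fst (w[q := a] ! k) = fst (w ! k)"
  by (cases "k = q") auto

lemma dependsI: "k < n \<Longrightarrow> length w = n \<Longrightarrow> g w ! i \<noteq> g (w[k := a]) ! i \<Longrightarrow> depends n g i k"
  unfolding depends_def by blast

lemma depends_less: "depends n g i q \<Longrightarrow> q < n" by (simp add: depends_def)

section \<open>Degenerate labelled maps; lower and upper cells\<close>

context labelled
begin

lemma sel_cases: "sel = fst \<or> sel = snd" using A_sel by auto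

lemma precomp_face [simp]: "length w = n \<Longrightarrow> p \<le> n \<Longrightarrow>
  precomp n (face (Suc n) (Suc p) b) G w = G (insert_at p (b, b) w)"
  by (simp add: on_pairs_face)

lemma precomp_face_lmaps: "g \<in> lmaps (Suc n) m \<Longrightarrow> p \<le> n \<Longrightarrow>
  precomp n (face (Suc n) (Suc p) b) g \<in> lmaps n m"
  by (rule precomp_lmaps[OF face_hom])

lemma depends_precomp_face:
  assumes "depends n (precomp n (face (Suc n) (Suc p) b) G) i q" "p \<le> n"
  shows "depends (Suc n) G i (skip p q)"
proof -
  obtain w a where w: "q < n" "length w = n"
    "precomp n (face (Suc n) (Suc p) b) G w ! i \<noteq> precomp n (face (Suc n) (Suc p) b) G (w[q := a]) ! i"
    using assms(1) unfolding depends_def by blast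
  then have "G (insert_at p (b, b) w) ! i \<noteq> G (insert_at p (b, b) (w[q := a])) ! i" using assms(2)
    by simp
  with w(1,2) show ?thesis using assms(2) insert_at_update[of q w p "(b, b)" a]
    by (intro dependsI[of _ _ "insert_at p (b, b) w" _ _ a]) (auto simp: skip_def)
qed

text \<open>For \<open>A = {e}\<close> this is the factorization through the connection at
  \<open>p\<close>, expressed by values: \<open>g\<close> is recovered from its restriction to the
  section on which the variable \<open>Suc p\<close> is \<open>e\<close>.\<close>

definition factors_at :: "nat \<Rightarrow> nat \<Rightarrow> lmap \<Rightarrow> nat \<Rightarrow> bool" where
  "factors_at n m g p \<longleftrightarrow> (\<forall>w. length w = n \<longrightarrow>
    (\<forall>i<m. g w ! i = g (w[p := join_pair e (w ! p) (w ! Suc p), Suc p := (e, e)]) ! i))"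

definition nondegenerate :: "nat \<Rightarrow> nat \<Rightarrow> lmap \<Rightarrow> bool" where
  "nondegenerate n m g \<longleftrightarrow> g \<in> lmaps n m \<and> g \<notin> degenerate A (lcset m) n"

lemma nondegenerate_relevant:
  assumes "nondegenerate n m g" "q < n" shows "\<exists>i<m. depends n g i q"
proof (rule ccontr)
  assume nd: "\<not> ?thesis"
  have g: "g \<in> lmaps n m" "g \<notin> degenerate A (lcset m) n" using assms(1)
    by (auto simp: nondegenerate_def)
  obtain n' where n: "n = Suc n'" "q \<le> n'" using assms(2) by (cases n) auto
  let ?y = "precomp n' (face (Suc n') (Suc q) False) g"
  have y: "?y \<in> lmaps n' m" using precomp_face_lmaps g n by simp
  have "g = precomp (Suc n') (degen (Suc n') (Suc q)) ?y"
  proof (rule lmaps_ext)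
    show "g \<in> lmaps (Suc n') m" using g n by simp
    show "precomp (Suc n') (degen (Suc n') (Suc q)) ?y \<in> lmaps (Suc n') m"
      by (rule precomp_lmaps[OF degen_hom[OF n(2)] y])
    fix w :: "(bool \<times> bool) list" and i assume w: "length w = Suc n'" "i < m"
    then have "g (insert_at q (w ! q) (delete_at q w)) ! i = g (insert_at q (False, False) (delete_at q w)) ! i"
      using not_depends_insert_at[of n g i q "delete_at q w"] nd assms(2) n by auto
    then show "g w ! i = precomp (Suc n') (degen (Suc n') (Suc q)) ?y w ! i"
      using w n insert_at_delete_at[of q w] by (simp add: on_pairs_degen)
  qed
  then show False using g(2) n degenerateI(1)[of ?y "lcset m" n' q A] y by simp
qed

lemma nondegenerate_not_factors:
  assumes "nondegenerate n m g" "A = {e}" "Suc p < n" shows "\<not> factors_at n m g p"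
proof
  assume f: "factors_at n m g p"
  have g: "g \<in> lmaps n m" "g \<notin> degenerate A (lcset m) n" using assms(1)
    by (auto simp: nondegenerate_def)
  obtain n' where n: "n = Suc n'" "p < n'" using assms(3) by (cases n) auto
  let ?y = "precomp n' (face (Suc n') (Suc (Suc p)) e) g"
  have y: "?y \<in> lmaps n' m" using precomp_face_lmaps g n by simp
  have "g = precomp (Suc n') (conn (Suc n') (Suc p) e) ?y"
  proof (rule lmaps_ext)
    show "g \<in> lmaps (Suc n') m" using g n by simp
    show "precomp (Suc n') (conn (Suc n') (Suc p) e) ?y \<in> lmaps (Suc n') m"
      by (rule precomp_lmaps[OF conn_hom y]) (use assms n in auto)
    fix w :: "(bool \<times> bool) list" and i assume w: "length w = Suc n'" "i < m"
    have "g w ! i = g (w[p := join_pair e (w ! p) (w ! Suc p), Suc p := (e, e)]) ! i"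
      using f w n unfolding factors_at_def by blast
    then show "g w ! i = precomp (Suc n') (conn (Suc n') (Suc p) e) ?y w ! i"
      using w n insert_at_merge_at_eq[OF w(1) n(2), of "(e, e)" "join_pair e"]
        by (simp add: on_pairs_conn)
  qed
  then show False using g(2) n degenerateI(2)[of ?y "lcset m" n' p e A] y assms(2) by simp
qed

lemma nondegenerateI:
  assumes g: "g \<in> lmaps n m" and rel: "\<And>q. q < n \<Longrightarrow> \<exists>i<m. depends n g i q"
    and nofac: "\<And>p. A = {e} \<Longrightarrow> Suc p < n \<Longrightarrow> \<not> factors_at n m g p"
  shows "nondegenerate n m g"
proof -
  have "g \<notin> degenerate A (lcset m) n"
  proof
    assume "g \<in> degenerate A (lcset m) n"
    then show False
    proof (cases rule: degenerateE)
      case (1 n' p y)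
      have "\<not> depends n g i p" for i
      proof
        assume "depends n g i p"
        then obtain w a where "length w = n" "g w ! i \<noteq> g (w[p := a]) ! i" by (auto simp: depends_def)
        then show False using 1 delete_at_update_same[of p w a] by (simp add: on_pairs_degen)
      qed
      then show False using rel[of p] 1 by auto
    next
      case (2 n' p y b)
      then have A: "A = {e}" "b = e" using A_sel by auto
      have "factors_at n m g p"
        unfolding factors_at_def
      proof (intro allI impI)
        fix w :: "(bool \<times> bool) list" and i assume w: "length w = n"
        have "merge_at (join_pair e) p (w[p := join_pair e (w ! p) (w ! Suc p), Suc p := (e, e)]) = merge_at (join_pair e) p w"
          using w 2 by (intro nth_equalityI) (auto simp: nth_merge_at nth_list_update join_pair_def)
        then show "g w ! i = g (w[p := join_pair e (w ! p) (w ! Suc p), Suc p := (e, e)]) ! i"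
          using w 2 A by (simp add: on_pairs_conn)
      qed
      then show False using nofac[OF A(1), of p] 2 by simp
    qed
  qed
  then show ?thesis using g by (simp add: nondegenerate_def)
qed

text \<open>The later coordinates are projections, and remain so on every full face. This helps to
  keep the distinguished coordinate fixed when passing to faces.\<close>

definition last_nontrivial :: "nat \<Rightarrow> nat \<Rightarrow> lmap \<Rightarrow> nat \<Rightarrow> bool" where
  "last_nontrivial n m g j \<longleftrightarrow> j < m \<and> \<not> is_proj n (\<lambda>w. g w ! j) \<and> (\<forall>i. j < i \<and> i < m \<longrightarrow>
    is_proj n (\<lambda>w. g w ! i))"

lemma last_nontrivial_unique: "last_nontrivial n m g j \<Longrightarrow> last_nontrivial n m g j' \<Longrightarrow> j = j'"
  unfolding last_nontrivial_def by (metis nat_neq_iff)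

text \<open>\<open>h \<noteq> e\<close> excludes the edges \<open>E(t)\<close>, which are lower cells.\<close>

definition upper :: "nat \<Rightarrow> lmap \<Rightarrow> nat \<Rightarrow> bool" where
  "upper n g j \<longleftrightarrow> (\<exists>t h. joins_last n (\<lambda>w. g w ! j) t h \<and> (\<exists>w. length w = n \<and> h w \<noteq> e))"

text \<open>Not the negation of \<open>upper\<close>: a formal edge alone is neither. It is the
  second kind of coordinate at which a cell can be lower.\<close>

definition plain :: "nat \<Rightarrow> lmap \<Rightarrow> nat \<Rightarrow> bool" where
  "plain n g j \<longleftrightarrow> \<not> (\<exists>t h. joins_last n (\<lambda>w. g w ! j) t h)"

text \<open>The new variable is inserted at position \<open>p\<close>. If \<open>s\<close> maps
  \<open>(e, e)\<close> to \<open>e\<close>, setting the new variable to \<open>e\<close> returns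
  \<open>g\<close>, as \<open>e\<close> is neutral.\<close>

definition fill_in :: "nat \<Rightarrow> nat \<Rightarrow> nat \<Rightarrow> (bool \<times> bool \<Rightarrow> bool) \<Rightarrow> lmap \<Rightarrow> lmap" where
  "fill_in n j p s g = (\<lambda>w\<in>pair_cube (Suc n). (g (delete_at p w))[j := join e (g (delete_at p w) ! j) (s (w ! p))])"

text \<open>In the second case the last nontrivial coordinate is an edge \<open>E(t)\<close>; the new variable \<open>x\<close> goes in front
  of \<open>t\<close>.\<close>

definition matched :: "nat \<Rightarrow> nat \<Rightarrow> lmap \<Rightarrow> lmap \<Rightarrow> nat \<Rightarrow> bool" where
  "matched n m g G p \<longleftrightarrow> nondegenerate n m g \<and> full n m g \<and> (\<exists>j. last_nontrivial n m g j \<and> \<not> upper n g j \<and>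
     (if plain n g j then p = Suc (Max {q. depends n g j q}) \<and> G = fill_in n j p sel g
      else p = Max {q. depends n g j q} \<and> G = fill_in n j p fst g))"

lemma fill_in_nth:
  "g \<in> lmaps n m \<Longrightarrow> p \<le> n \<Longrightarrow> length w = Suc n \<Longrightarrow> j < m \<Longrightarrow> i < m \<Longrightarrow>
   fill_in n j p s g w ! i = (if i = j then join e (g (delete_at p w) ! j) (s (w ! p)) else g (delete_at p w) ! i)"
  using lmapsD(2)[of g n m "delete_at p w"] by (simp add: fill_in_def nth_list_update)

text \<open>By \<open>L\<close> and \<open>R\<close> the new variable stands after the variables of
  earlier coordinates and before those of later ones, as the order demands. The dependences of
  \<open>G\<close> are those of \<open>g\<close>, renumbered by \<open>skip p\<close>, and that of
  coordinate \<open>j\<close> on the new variable.\<close>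

lemma fill_in_basic:
  assumes g: "g \<in> lmaps n m" and f: "full n m g" and j: "j < m" and p: "p \<le> n"
    and L: "\<forall>i q. i < j \<longrightarrow> depends n g i q \<longrightarrow> q < p"
    and R: "\<forall>i q. j < i \<longrightarrow> i < m \<longrightarrow> depends n g i q \<longrightarrow> p \<le> q"
    and s: "\<And>b. s (b, b) = b" and G: "G = fill_in n j p s g"
    and cj: "admissible (Suc n) (\<lambda>w. G w ! j)"
  shows "G \<in> lmaps (Suc n) m" "full (Suc n) m G" "depends (Suc n) G j p"
    and "depends n g i q \<Longrightarrow> depends (Suc n) G i (skip p q)"
    and "depends (Suc n) G i q \<Longrightarrow> i < m \<Longrightarrow> (i = j \<and> q = p) \<or> (q \<noteq> p \<and> depends n g i (unskip p q))"
    and "precomp n (face (Suc n) (Suc p) e) G = g"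
    and "length w = n \<Longrightarrow> G (insert_at p (\<not> e, \<not> e) w) ! j = (\<not> e)"
proof -
  note nth = fill_in_nth[OF g p _ j, of _ _ s, folded G]
  have len: "length (G w) = m" if "length w = Suc n" for w
    using that lmapsD(2)[OF g, of "delete_at p w"] p by (simp add: G fill_in_def)
  have Ge: "G (insert_at p (e, e) w) ! i = g w ! i" if "length w = n" "i < m" for w i
    using nth[of "insert_at p (e, e) w" i] that p s by (simp add: delete_at_insert_at nth_insert_at)
  show ne: "G (insert_at p (\<not> e, \<not> e) w) ! j = (\<not> e)" if "length w = n" for w
    using nth[of "insert_at p (\<not> e, \<not> e) w" j] that p s[of "\<not> e"] j
      by (simp add: delete_at_insert_at nth_insert_at)
  have inv: "(i = j \<and> q = p) \<or> (q \<noteq> p \<and> depends n g i (unskip p q))" if d: "depends (Suc n) G i q"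
    "i < m" for i q
  proof -
    obtain w a where w: "q < Suc n" "length w = Suc n" "G w ! i \<noteq> G (w[q := a]) ! i"
      using d by (auto simp: depends_def)
    show ?thesis
    proof (cases "q = p")
      case True
      have "i = j"
      proof (rule ccontr)
        assume "i \<noteq> j"
        then have "G w ! i = g (delete_at p w) ! i"
          "G (w[p := a]) ! i = g (delete_at p (w[p := a])) ! i"
          using nth[OF w(2) d(2)] nth[of "w[p := a]" i] w(2) d(2) by simp_all
        then show False using w True p delete_at_update_same[of p w a] by simp
      qed
      then show ?thesis using True by simp
    next
      case False
      have "G w ! i = (if i = j then join e (g (delete_at p w) ! j) (s (w ! p)) else g (delete_at p w) ! i)"
        "G (w[q := a]) ! i = (if i = j then join e (g (delete_at p (w[q := a])) ! j) (s (w ! p)) else g (delete_at p (w[q := a])) ! i)"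
        using nth[OF w(2) d(2)] nth[of "w[q := a]" i] w(2) d(2) False by simp_all
      then have "g (delete_at p w) ! i = g (delete_at p (w[q := a])) ! i \<Longrightarrow> G w ! i = G (w[q := a]) ! i"
        by (cases "i = j") simp_all
      then have "g (delete_at p w) ! i \<noteq> g (delete_at p (w[q := a])) ! i" using w(3) by blast
      then have "g (delete_at p w) ! i \<noteq> g ((delete_at p w)[unskip p q := a]) ! i"
        using w(1,2) False p delete_at_update[of q w p a] by simp
      moreover have "unskip p q < n" using False w(1) p by (auto simp: unskip_def)
      ultimately have "depends n g i (unskip p q)" using w(2) p
        by (intro dependsI[of _ _ "delete_at p w"]) simp_all
      then show ?thesis using False by simp
    qed
  qed
  then show "depends (Suc n) G i q \<Longrightarrow> i < m \<Longrightarrow> (i = j \<and> q = p) \<or> (q \<noteq> p \<and> depends n g i (unskip p q))" .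
  have fwd: "depends (Suc n) G i (skip p q)" if d: "depends n g i q" "i < m" for i q
  proof -
    obtain w a where w: "q < n" "length w = n" "g w ! i \<noteq> g (w[q := a]) ! i"
      using d by (auto simp: depends_def)
    then have "G (insert_at p (e, e) w) ! i \<noteq> G ((insert_at p (e, e) w)[skip p q := a]) ! i"
      using Ge[of w i] Ge[of "w[q := a]" i] insert_at_update[of q w p "(e, e)" a] p d(2) by simp
    then show ?thesis using w unfolding depends_def
      by (intro conjI exI[of _ "insert_at p (e, e) w"] exI[of _ a]) (auto simp: skip_def)
  qed
  have GM: "G \<in> lmaps (Suc n) m"
  proof (rule lmapsI[OF _ len])
    show "G \<in> extensional (pair_cube (Suc n))" by (simp add: G fill_in_def)
    show "ordered (Suc n) m G"
      unfolding ordered_def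
    proof (intro allI impI, elim conjE)
      fix i i' q q' assume *: "i < i'" "i' < m" "depends (Suc n) G i q" "depends (Suc n) G i' q'"
      have i: "(i = j \<and> q = p) \<or> (q \<noteq> p \<and> depends n g i (unskip p q))" using inv[OF *(3)] * by simp
      have i': "(i' = j \<and> q' = p) \<or> (q' \<noteq> p \<and> depends n g i' (unskip p q'))" using inv[OF *(4)] *
        by simp
      have o: "unskip p q < unskip p q'" if "depends n g i (unskip p q)" "depends n g i' (unskip p q')"
        using lmapsD(3)[OF g] that *(1,2) unfolding ordered_def by blast
      show "q < q'"
        using i i' o L[rule_format, of i "unskip p q"] R[rule_format, of i' "unskip p q'"] *(1,2)
        by (auto simp: unskip_def split: if_splits)
    qed
    fix i assume i: "i < m"
    show "admissible (Suc n) (\<lambda>w. G w ! i)"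
    proof (cases "i = j")
      case False
      then show ?thesis
        using admissible_delete_at[OF lmapsD(4)[OF g i] p] admissible_cong[of "Suc n" "\<lambda>w. G w ! i"
          "\<lambda>w. g (delete_at p w) ! i"] nth i
        by simp
    qed (use cj in simp)
  qed
  then show "G \<in> lmaps (Suc n) m" .
  show face: "precomp n (face (Suc n) (Suc p) e) G = g"
    by (rule lmaps_ext[OF precomp_face_lmaps[OF GM p] g]) (use Ge p in simp)
  show "full (Suc n) m G"
    unfolding full_def
  proof (intro allI impI)
    fix i b assume "i < m"
    then obtain w where w: "length w = n" "g w ! i \<noteq> b" using fullD[OF f \<open>i < m\<close>, of b] by blast
    then have "G (insert_at p (e, e) w) ! i \<noteq> b" using Ge[OF w(1) \<open>i < m\<close>] by simp
    moreover have "length (insert_at p (e, e) w) = Suc n" using w(1) by simp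
    ultimately show "\<exists>w. length w = Suc n \<and> G w ! i \<noteq> b" by blast
  qed
  \<comment> \<open>At a point where coordinate \<open>j\<close> of \<open>g\<close> is
    \<open>e\<close>, the new variable alone decides the value of \<open>G\<close>.\<close>
  obtain w where w: "length w = n" "g w ! j \<noteq> (\<not> e)" using fullD[OF f j, of "(\<not> e)"] by blast
  then have "G (insert_at p (e, e) w) ! j \<noteq> G ((insert_at p (e, e) w)[p := (\<not> e, \<not> e)]) ! j"
    using Ge[OF w(1) j] ne[OF w(1)] insert_at_update_same[of p w "(e, e)" "(\<not> e, \<not> e)"] p by simp
  then show "depends (Suc n) G j p" using w(1) p unfolding depends_def
    by (intro conjI exI[of _ "insert_at p (e, e) w"] exI[of _ "(\<not> e, \<not> e)"]) auto
  show "depends n g i q \<Longrightarrow> depends (Suc n) G i (skip p q)"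
  proof (cases "i < m")
    case False
    assume "depends n g i q"
    then obtain w a where w: "q < n" "length w = n" "g w ! i \<noteq> g (w[q := a]) ! i"
      by (auto simp: depends_def)
    have eq: "G (insert_at p (e, e) v) = g v" if "length v = n" for v
      using fun_cong[OF face, of v] that p by simp
    then have "G (insert_at p (e, e) w) ! i \<noteq> G ((insert_at p (e, e) w)[skip p q := a]) ! i"
      using w insert_at_update[of q w p "(e, e)" a] p eq[of "w[q := a]"] by simp
    then show ?thesis using w unfolding depends_def
      by (intro conjI exI[of _ "insert_at p (e, e) w"] exI[of _ a]) (auto simp: skip_def)
  qed (use fwd in simp)
qed

text \<open>The coordinate is a monotone and nonconstant function of the first component at
  \<open>d\<close>, hence equal to it.\<close>

lemma fst_mono_one_depends:
  assumes u: "fst_mono n (\<lambda>w. g w ! j)" and f: "full n m g" "j < m"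
    and d: "d < n" "\<And>q. depends n g j q \<Longrightarrow> q = d"
  shows "is_proj n (\<lambda>w. g w ! j)"
proof -
  define F where "F b = g (replicate n (b, b)) ! j" for b
  have eq: "g w ! j = F (fst (w ! d))" if w: "length w = n" for w
  proof -
    let ?w = "map (\<lambda>x. (fst x, fst x)) w"
    have "g w ! j = g ?w ! j" by (rule fst_mono_fst[OF u]) (use w in auto)
    also have "\<dots> = g (replicate n (fst (w ! d), fst (w ! d))) ! j"
    proof (rule ccontr)
      assume "g ?w ! j \<noteq> g (replicate n (fst (w ! d), fst (w ! d))) ! j"
      from depends_if_neq[of _ n _ g j, OF _ _ this] obtain q where
        "q < n" "depends n g j q" "?w ! q \<noteq> replicate n (fst (w ! d), fst (w ! d)) ! q" using w by auto
      then show False using d(2)[of q] w by simp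
    qed
    finally show ?thesis by (simp add: F_def)
  qed
  have "F False \<le> F True" unfolding F_def by (rule fst_monoD[OF u]) auto
  moreover obtain x y where "F x \<noteq> F y"
  proof -
    obtain w where w: "length w = n" "g w ! j \<noteq> F False" using fullD[OF f, of "F False"] by blast
    then have "F (fst (w ! d)) \<noteq> F False" using eq[OF w(1)] by simp
    then show thesis by (rule that)
  qed
  then have "F True \<noteq> F False" by (cases x; cases y) auto
  ultimately have "F b = b" for b by (cases b) auto
  then show ?thesis unfolding is_proj_def using eq d(1) by auto
qed

text \<open>The data attached to the two kinds of lower cells. In (I), coordinate \<open>j\<close>
  of \<open>g\<close> has at least two variables, as with one it would be a projection; in (II) it
  is a single formal edge, which exists only for \<open>A = {}\<close>.\<close>

lemma matched_cases:
  assumes "matched n m g G p"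
  obtains (I) j where "nondegenerate n m g" "full n m g" "last_nontrivial n m g j" "\<not> upper n g j"
    "p \<le> n"
    "\<forall>i q. i < j \<longrightarrow> depends n g i q \<longrightarrow> q < p" "\<forall>i q. j < i \<longrightarrow> i < m \<longrightarrow> depends n g i q \<longrightarrow> p \<le> q"
    "G = fill_in n j p sel g" "joins_last (Suc n) (\<lambda>w. G w ! j) p (\<lambda>w. g (delete_at p w) ! j)"
    "plain n g j" "fst_mono n (\<lambda>w. g w ! j)" "\<And>q. depends n g j q \<Longrightarrow> q < p" "depends n g j (p - 1)"
      "0 < p" "\<exists>d. d \<noteq> p - 1 \<and> depends n g j d"
  | (II) j where "nondegenerate n m g" "full n m g" "last_nontrivial n m g j" "\<not> upper n g j" "p \<le> n"
    "\<forall>i q. i < j \<longrightarrow> depends n g i q \<longrightarrow> q < p" "\<forall>i q. j < i \<longrightarrow> i < m \<longrightarrow> depends n g i q \<longrightarrow> p \<le> q"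
    "G = fill_in n j p fst g" "joins_last (Suc n) (\<lambda>w. G w ! j) (Suc p) (\<lambda>w. fst (w ! p))"
    "A = {}" "sel = snd" "p < n" "\<And>w. length w = n \<Longrightarrow> g w ! j = snd (w ! p)"
proof -
  obtain j where g: "nondegenerate n m g" and f: "full n m g" and j: "last_nontrivial n m g j"
    "\<not> upper n g j"
    and G: "if plain n g j then p = Suc (Max {q. depends n g j q}) \<and> G = fill_in n j p sel g
      else p = Max {q. depends n g j q} \<and> G = fill_in n j p fst g"
    using assms by (auto simp: matched_def)
  have gM: "g \<in> lmaps n m" using g by (simp add: nondegenerate_def)
  have jm: "j < m" using j by (simp add: last_nontrivial_def)
  let ?D = "{q. depends n g j q}"
  have fin: "finite ?D" by (rule finite_subset[of _ "{..<n}"]) (auto simp: depends_less)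
  obtain d0 where d0: "depends n g j d0" using full_depends[OF f jm] by blast
  have Mx: "depends n g j (Max ?D)" using Max_in[OF fin] d0 by blast
  have le: "q \<le> Max ?D" if "depends n g j q" for q using Max_ge[OF fin, of q] that by simp
  have ord: "ordered n m g" by (rule lmapsD(3)[OF gM])
  have L: "q < Max ?D" if "i < j" "depends n g i q" for i q
    using ord that Mx jm unfolding ordered_def by blast
  have R: "Max ?D < q" if "j < i" "i < m" "depends n g i q" for i q
    using ord that Mx unfolding ordered_def by blast
  have Mn: "Max ?D < n" using depends_less[OF Mx] .
  show thesis
  proof (cases "plain n g j")
    case True
    then have p: "p = Suc (Max ?D)" and G: "G = fill_in n j p sel g" using G by auto
    have u: "fst_mono n (\<lambda>w. g w ! j)" using lmapsD(4)[OF gM jm] True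
      by (auto simp: admissible_def plain_def)
    have pn: "p \<le> n" using p Mn by simp
    have joins_last: "joins_last (Suc n) (\<lambda>w. G w ! j) p (\<lambda>w. g (delete_at p w) ! j)"
    proof (rule joins_lastI)
      show "p < Suc n" using pn by simp
      show "fst_mono (Suc n) (\<lambda>w. g (delete_at p w) ! j)" by (rule fst_mono_delete_at[OF u pn])
      show "G w ! j = join e (g (delete_at p w) ! j) (sel (w ! p))" if "length w = Suc n" for w
        using fill_in_nth[OF gM pn that jm jm] G by simp
      fix w w' :: "(bool \<times> bool) list" assume w: "length w = Suc n" "length w' = Suc n" "\<And>k. k < p \<Longrightarrow>
        w ! k = w' ! k"
      show "g (delete_at p w) ! j = g (delete_at p w') ! j"
      proof (rule ccontr)
        assume "g (delete_at p w) ! j \<noteq> g (delete_at p w') ! j"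
        from depends_if_neq[of _ n _ g j, OF _ _ this] obtain q where q: "depends n g j q"
          "delete_at p w ! q \<noteq> delete_at p w' ! q"
          using w pn by auto
        have "q < p" using le[OF q(1)] p by simp
        then show False using q(2) w pn by (simp add: nth_delete_at)
      qed
    qed
    have "\<exists>d. d \<noteq> Max ?D \<and> depends n g j d"
      using fst_mono_one_depends[OF u f jm Mn] j(1) unfolding last_nontrivial_def by blast
    then have ex: "\<exists>d. d \<noteq> p - 1 \<and> depends n g j d" using p by simp
    show thesis
    proof (rule I[OF g f j pn _ _ G joins_last True u _ _ _ ex])
      show "\<forall>i q. i < j \<longrightarrow> depends n g i q \<longrightarrow> q < p" using L p less_SucI by blast
      show "\<forall>i q. j < i \<longrightarrow> i < m \<longrightarrow> depends n g i q \<longrightarrow> p \<le> q" using R p Suc_leI less_imp_le by blast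
      show "q < p" if "depends n g j q" for q using le[OF that] p by simp
    qed (use p Mx in auto)
  next
    case False
    then have p: "p = Max ?D" and G: "G = fill_in n j p fst g" using G by auto
    obtain t h where joins_last: "joins_last n (\<lambda>w. g w ! j) t h" using False by (auto simp: plain_def)
    have gj: "g w ! j = sel (w ! t)" if "length w = n" for w
    proof -
      have "h w = e" using j(2) joins_last that unfolding upper_def by blast
      then show ?thesis using joins_lastD(3)[OF joins_last that] by simp
    qed
    have tn: "t < n" using joins_lastD(1)[OF joins_last] .
    \<comment> \<open>For \<open>sel = fst\<close> the coordinate would be an ordinary variable,
      hence a projection.\<close>
    have "sel \<noteq> fst" using j(1) gj tn unfolding last_nontrivial_def is_proj_def by auto
    then have A: "A = {}" "sel = snd" using A_sel by auto
    have "d = t" if d: "depends n g j d" for d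
    proof (rule ccontr)
      assume "d \<noteq> t"
      moreover obtain w a where w: "length w = n" "g w ! j \<noteq> g (w[d := a]) ! j" using d
        by (auto simp: depends_def)
      ultimately show False using gj[of w] gj[of "w[d := a]"] by simp
    qed
    then have pt: "p = t" using Mx p by blast
    have gp: "g w ! j = snd (w ! p)" if "length w = n" for w using gj[OF that] A pt by simp
    have pn: "p < n" using tn pt by simp
    have uf': "joins_last (Suc n) (\<lambda>w. G w ! j) (Suc p) (\<lambda>w. fst (w ! p))"
    proof (rule joins_lastI)
      show "fst_mono (Suc n) (\<lambda>w. fst (w ! p))" by (rule fst_mono_nth) (use pn in simp)
      show "G w ! j = join e (fst (w ! p)) (sel (w ! Suc p))" if "length w = Suc n" for w
      proof -
        \<comment> \<open>The construction joins the new variable \<open>x\<close> to the edge; by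
          commutativity of \<open>join\<close> the result is also \<open>x\<close> join
          \<open>E(t)\<close>, with \<open>t\<close> now at position \<open>Suc p\<close>.\<close>
        have "G w ! j = join e (snd (w ! Suc p)) (fst (w ! p))"
          using fill_in_nth[OF gM less_imp_le[OF pn] that jm jm, of fst] G gp[of "delete_at p w"] that pn
          by (simp add: nth_delete_at)
        then show ?thesis using A by (auto simp: join_def)
      qed
    qed (use pn in auto)
    show thesis
    proof (rule II[OF g f j _ _ _ G uf' A pn gp])
      show "\<forall>i q. i < j \<longrightarrow> depends n g i q \<longrightarrow> q < p" using L p less_SucI by blast
      show "\<forall>i q. j < i \<longrightarrow> i < m \<longrightarrow> depends n g i q \<longrightarrow> p \<le> q" using R p Suc_leI less_imp_le by blast
    qed (use pn in auto)
  qed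
qed

text \<open>Fullness provides a point with \<open>h = e\<close>, the hypothesis one with
  \<open>h \<noteq> e\<close>. At the first the variable \<open>t\<close> matters; comparing the two
  yields an earlier variable that matters. A projection has only one variable.\<close>

lemma joins_last_not_is_proj:
  assumes joins_last: "joins_last n (\<lambda>w. g w ! j) t h" and h: "length w0 = n" "h w0 \<noteq> e"
    and f: "full n m g" "j < m"
  shows "depends n g j t" "\<exists>q<t. depends n g j q" "\<not> is_proj n (\<lambda>w. g w ! j)"
proof -
  note u = joins_lastD[OF joins_last]
  obtain w1 where w1: "length w1 = n" "g w1 ! j \<noteq> (\<not> e)" using fullD[OF f, of "(\<not> e)"] by blast
  then have h1: "h w1 = e" using u(3)[OF w1(1)] by (auto simp: join_def split: if_splits)
  have hi: "h (w[t := a]) = h w" if "length w = n" for w a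
    by (rule u(4)) (use that in auto)
  have c: "g (w[t := (b, b)]) ! j = join e (h w) b" if "length w = n" for w b
    using u(3)[of "w[t := (b, b)]"] hi[OF that, of "(b, b)"] that u(1) by simp
  show t: "depends n g j t"
  proof (rule dependsI[OF u(1), of "w1[t := (e, e)]" _ _ "(\<not> e, \<not> e)"])
    show "g (w1[t := (e, e)]) ! j \<noteq> g (w1[t := (e, e), t := (\<not> e, \<not> e)]) ! j"
      using c[OF w1(1), of e] c[OF w1(1), of "\<not> e"] h1 by simp
  qed (use w1 in simp)
  have "g (w1[t := (e, e)]) ! j \<noteq> g (w0[t := (e, e)]) ! j"
    using c[OF w1(1), of e] c[OF h(1), of e] h1 h(2) by simp
  from depends_if_neq[of _ n _ g j, OF _ _ this] obtain q where q: "q < n" "depends n g j q"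
    "w1[t := (e, e)] ! q \<noteq> w0[t := (e, e)] ! q" using w1 h by auto
  have "q < t"
  proof (rule ccontr)
    assume "\<not> q < t"
    moreover have "q \<noteq> t" using q(3) u(1) w1 h by auto
    ultimately have "t < q" by simp
    obtain w a where w: "length w = n" "g w ! j \<noteq> g (w[q := a]) ! j" using q(2)
      by (auto simp: depends_def)
    have "h w = h (w[q := a])" by (rule u(4)) (use w \<open>t < q\<close> in auto)
    then show False using u(3)[OF w(1)] u(3)[of "w[q := a]"] w \<open>t < q\<close> by simp
  qed
  then show "\<exists>q<t. depends n g j q" using q(2) by blast
  then show "\<not> is_proj n (\<lambda>w. g w ! j)" using is_proj_depends[of n g j t] t by blast
qed

lemma joins_last_depends_le: "joins_last n (\<lambda>w. g w ! j) t h \<Longrightarrow> depends n g j q \<Longrightarrow> q \<le> t"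
proof (rule ccontr)
  assume joins_last: "joins_last n (\<lambda>w. g w ! j) t h" and q: "depends n g j q" "\<not> q \<le> t"
  note u = joins_lastD[OF joins_last]
  obtain w a where w: "length w = n" "g w ! j \<noteq> g (w[q := a]) ! j" using q(1)
    by (auto simp: depends_def)
  have "h w = h (w[q := a])" by (rule u(4)) (use w q(2) in auto)
  then show False using u(3)[OF w(1)] u(3)[of "w[q := a]"] w q(2) by simp
qed

lemma is_proj_fill_in:
  assumes "g \<in> lmaps n m" "p \<le> n" "j < m" "i < m" "i \<noteq> j" "is_proj n (\<lambda>w. g w ! i)"
  shows "is_proj (Suc n) (\<lambda>w. fill_in n j p s g w ! i)"
proof -
  obtain x where x: "x < n" "\<And>w. length w = n \<Longrightarrow> g w ! i = fst (w ! x)" using assms(6)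
    by (auto simp: is_proj_def)
  have "fill_in n j p s g w ! i = fst (w ! skip p x)" if "length w = Suc n" for w
    using fill_in_nth[OF assms(1,2) that assms(3,4)] assms(2,5) x that
      by (simp add: nth_delete_at skip_def)
  moreover have "skip p x < Suc n" using x(1) by (simp add: skip_def)
  ultimately show ?thesis unfolding is_proj_def by blast
qed

text \<open>The delicate point is nondegeneracy: for \<open>A = {e}\<close> the partner must not
  factor through the connection at any two adjacent variables.\<close>

lemma matched_upper:
  assumes matched: "matched n m g G p"
  shows "nondegenerate (Suc n) m G" "full (Suc n) m G" "p \<le> n"
    "precomp n (face (Suc n) (Suc p) e) G = g"
    and "\<exists>j. last_nontrivial (Suc n) m G j \<and> upper (Suc n) G j"
proof -
  have main: "nondegenerate (Suc n) m G \<and> full (Suc n) m G \<and> p \<le> n \<and>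
    precomp n (face (Suc n) (Suc p) e) G = g \<and>
      last_nontrivial (Suc n) m G j \<and> upper (Suc n) G j"
    if g: "nondegenerate n m g" and f: "full n m g" and j: "last_nontrivial n m g j" and p: "p \<le> n"
      and L: "\<forall>i q. i < j \<longrightarrow> depends n g i q \<longrightarrow> q < p" and R: "\<forall>i q. j < i \<longrightarrow> i < m \<longrightarrow> depends n g i q \<longrightarrow>
        p \<le> q"
      and s: "\<And>b. s (b, b) = b" and G: "G = fill_in n j p s g"
        and joins_last: "joins_last (Suc n) (\<lambda>w. G w ! j) t h"
      and h: "length w0 = Suc n" "h w0 \<noteq> e"
      and nofac: "\<And>q. A = {e} \<Longrightarrow> Suc q < Suc n \<Longrightarrow> \<not> factors_at (Suc n) m G q"
    for j s t h w0
  proof -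
    have gM: "g \<in> lmaps n m" using g by (simp add: nondegenerate_def)
    have jm: "j < m" using j by (simp add: last_nontrivial_def)
    have cj: "admissible (Suc n) (\<lambda>w. G w ! j)" using joins_last by (auto simp: admissible_def)
    note b = fill_in_basic[OF gM f jm p L R s G cj]
    have rel: "\<exists>i<m. depends (Suc n) G i q" if "q < Suc n" for q
    proof (cases "q = p")
      case True
      then show ?thesis using b(3) jm by blast
    next
      case False
      then have q: "unskip p q < n" "skip p (unskip p q) = q" using that p
        by (auto simp: unskip_def skip_def)
      then obtain i where "i < m" "depends n g i (unskip p q)" using nondegenerate_relevant[OF g]
        by blast
      then show ?thesis using b(4)[of i "unskip p q"] q by auto
    qed
    have "nondegenerate (Suc n) m G" by (rule nondegenerateI[OF b(1) rel nofac])
    moreover have "last_nontrivial (Suc n) m G j"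
      unfolding last_nontrivial_def
        using joins_last_not_is_proj(3)[OF joins_last h b(2) jm] jm j is_proj_fill_in[OF gM p jm]
      unfolding last_nontrivial_def G by blast
    moreover have "upper (Suc n) G j" unfolding upper_def using joins_last h by blast
    ultimately show ?thesis using b(2,6) p by blast
  qed
  from matched have "\<exists>j. nondegenerate (Suc n) m G \<and> full (Suc n) m G \<and> p \<le> n \<and>
    precomp n (face (Suc n) (Suc p) e) G = g \<and>
      last_nontrivial (Suc n) m G j \<and> upper (Suc n) G j"
  proof (cases rule: matched_cases)
    case (I j)
    have gM: "g \<in> lmaps n m" using I(1) by (simp add: nondegenerate_def)
    have jm: "j < m" using I(3) by (simp add: last_nontrivial_def)
    note nth = fill_in_nth[OF gM I(5) _ jm, of _ _ sel, folded I(8)]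
    obtain w where w: "length w = n" "g w ! j \<noteq> e" using fullD[OF I(2) jm, of "e"] by blast
    have h: "g (delete_at p (insert_at p (e, e) w)) ! j \<noteq> e" using w I(5)
      by (simp add: delete_at_insert_at)
    have cj: "admissible (Suc n) (\<lambda>w. G w ! j)" using I(9) by (auto simp: admissible_def)
    note b = fill_in_basic[OF gM I(2) jm I(5,6,7) sel_diag I(8) cj]
    have Ge: "G (insert_at p (e, e) w) ! i = g w ! i" if "length w = n" "i < m" for w i
      using nth[of "insert_at p (e, e) w" i] that I(5) by (simp add: delete_at_insert_at nth_insert_at)
    have "\<not> factors_at (Suc n) m G q" if A: "A = {e}" and q: "Suc q < Suc n" for q
    proof
      assume factors_at: "factors_at (Suc n) m G q"
      have sel: "sel = fst" using A A_sel by auto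
      have facD: "G w ! i = G (w[q := join_pair e (w ! q) (w ! Suc q), Suc q := (e, e)]) ! i"
        if "length w = Suc n" "i < m" for w i using factors_at that unfolding factors_at_def by blast
      consider "Suc q = p" | "q = p" | "p < q \<or> Suc q < p" by linarith
      then show False
      proof cases
        \<comment> \<open>Merging the new variable with the one before it would give coordinate
          \<open>j\<close> of \<open>g\<close> the form \<open>h\<close> join its last variable,
          contrary to \<open>plain\<close>.\<close>
        case 1
        let ?h = "\<lambda>w. g (w[q := (e, e)]) ! j"
        have qn: "q < n" using 1 I(5) by simp
        have "joins_last n (\<lambda>w. g w ! j) q ?h"
        proof (rule joins_lastI[OF qn])
          show "fst_mono n ?h"
          proof (rule fst_mono_comp[OF I(11)])
            show "fst (w[q := (e, e)] ! k) \<le> fst (w'[q := (e, e)] ! k)"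
              if "length w = n" "length w' = n" "\<And>k. k < n \<Longrightarrow> fst (w ! k) \<le> fst (w' ! k)" "k < n"
              for w w' :: "(bool \<times> bool) list" and k
              using that(3)[OF that(4)] that(1,2,4) by (cases "k = q") simp_all
          qed simp
          show "?h w = ?h w'" if h: "length w = n" "length w' = n" "\<And>k. k < q \<Longrightarrow> w ! k = w' ! k" for w w'
          proof (rule ccontr)
            assume "?h w \<noteq> ?h w'"
            from depends_if_neq[of _ n _ g j, OF _ _ this] obtain d where d: "depends n g j d"
              "w[q := (e, e)] ! d \<noteq> w'[q := (e, e)] ! d" using h(1,2) by auto
            have "d < Suc q" using I(12)[OF d(1)] 1 by simp
            then show False using d(2) h qn by (cases "d = q") auto
          qed
          show "g w ! j = join e (?h w) (sel (w ! q))" if w: "length w = n" for w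
          proof (cases "fst (w ! q) = e")
            case True
            have "g w ! j = ?h w"
              by (rule fst_mono_fst[OF I(11)]) (use w True in \<open>simp_all add: fst_update\<close>)
            then show ?thesis using True sel by simp
          next
            case False
            let ?w = "insert_at p (\<not> e, \<not> e) w"
            have "(\<not> e) = G ?w ! j" using b(7)[OF w] by simp
            also have "\<dots> = G (?w[q := join_pair e (?w ! q) (?w ! Suc q), Suc q := (e, e)]) ! j"
              by (rule facD) (use w jm in auto)
            also have "?w[q := join_pair e (?w ! q) (?w ! Suc q), Suc q := (e, e)] = insert_at p (e, e) (w[q := (\<not> e, \<not> e)])"
              using w 1 qn
                by (intro nth_equalityI) (auto simp: nth_insert_at nth_list_update join_pair_def)
            also have "G (insert_at p (e, e) (w[q := (\<not> e, \<not> e)])) ! j = g (w[q := (\<not> e, \<not> e)]) ! j"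
              by (rule Ge) (use w jm in auto)
            also have "\<dots> = g w ! j"
              by (rule fst_mono_fst[OF I(11)]) (use w False qn in \<open>auto simp: fst_update\<close>)
            finally have "g w ! j = (\<not> e)" by simp
            moreover have "sel (w ! q) = (\<not> e)" using False sel by auto
            ultimately show ?thesis by simp
          qed
        qed
        then show False using I(10) unfolding plain_def by blast
      next
        \<comment> \<open>Merging it with the one after it moves the value \<open>\<not> e\<close>
          from a variable that coordinate \<open>j\<close> ignores to the new variable, and this
          changes the coordinate to \<open>\<not> e\<close>.\<close>
        case 2
        then have pn: "p < n" using q by simp
        obtain w where w: "length w = n" "g w ! j \<noteq> (\<not> e)" using fullD[OF I(2) jm, of "(\<not> e)"] by blast
        let ?v = "w[p := (\<not> e, \<not> e)]" and ?w = "insert_at p (e, e) (w[p := (\<not> e, \<not> e)])"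
        have "g w ! j = g ?v ! j"
        proof (rule ccontr)
          assume "g w ! j \<noteq> g ?v ! j"
          then have "depends n g j p" by (rule dependsI[OF pn w(1)])
          then show False using I(12) by blast
        qed
        then have "G ?w ! j \<noteq> (\<not> e)" using Ge[of ?v j] w jm by simp
        moreover have "G ?w ! j = G (?w[q := join_pair e (?w ! q) (?w ! Suc q), Suc q := (e, e)]) ! j"
          by (rule facD) (use w jm in auto)
        moreover have "?w[q := join_pair e (?w ! q) (?w ! Suc q), Suc q := (e, e)] = insert_at p (\<not> e, \<not> e) (w[p := (e, e)])"
          using w 2 pn by (intro nth_equalityI) (auto simp: nth_insert_at nth_list_update join_pair_def)
        ultimately show False using b(7)[of "w[p := (e, e)]"] w by simp
      next
        \<comment> \<open>Both merged variables are old, so the factorization restricts to the face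
          \<open>g\<close>.\<close>
        case 3
        define r where "r = unskip p q"
        have rq: "skip p r = q" "skip p (Suc r) = Suc q" "Suc r < n"
          using 3 q I(5) by (auto simp: r_def skip_def unskip_def)
        have "factors_at n m g r"
          unfolding factors_at_def
        proof (intro allI impI)
          fix w :: "(bool \<times> bool) list" and i assume w: "length w = n" "i < m"
          let ?w = "insert_at p (e, e) w"
          have nth': "?w ! q = w ! r" "?w ! Suc q = w ! Suc r"
            using nth_insert_at_skip[of r w p "(e, e)"] nth_insert_at_skip[of "Suc r" w p "(e, e)"] rq w I(5) by auto
          have "g w ! i = G ?w ! i" using Ge[OF w] by simp
          also have "\<dots> = G (?w[q := join_pair e (?w ! q) (?w ! Suc q), Suc q := (e, e)]) ! i"
            by (rule facD) (use w in auto)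
          also have "?w[q := join_pair e (?w ! q) (?w ! Suc q), Suc q := (e, e)]
              = insert_at p (e, e) (w[r := join_pair e (w ! r) (w ! Suc r), Suc r := (e, e)])"
            using rq w I(5) unfolding nth' by (simp add: insert_at_update)
          also have "G (insert_at p (e, e) (w[r := join_pair e (w ! r) (w ! Suc r), Suc r := (e, e)])) ! i
              = g (w[r := join_pair e (w ! r) (w ! Suc r), Suc r := (e, e)]) ! i"
            by (rule Ge) (use w in auto)
          finally show "g w ! i = g (w[r := join_pair e (w ! r) (w ! Suc r), Suc r := (e, e)]) ! i" .
        qed
        then show False using nondegenerate_not_factors[OF I(1) A rq(3)] by blast
      qed
    qed
    from main[OF I(1,2,3,5,6,7) sel_diag I(8,9) _ h this] w show ?thesis by auto
  next
    case (II j)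
    \<comment> \<open>Here \<open>h\<close> is the new variable \<open>x\<close>, so a point with
      \<open>x = (\<not> e)\<close> witnesses that \<open>h\<close> is not constantly
      \<open>e\<close>.\<close>
    from main[OF II(1,2,3,5,6,7) _ II(8,9), of "replicate (Suc n) (\<not> e, \<not> e)"] II(10,12)
    show ?thesis by (auto simp del: replicate_Suc)
  qed
  then show "nondegenerate (Suc n) m G" "full (Suc n) m G" "p \<le> n"
    "precomp n (face (Suc n) (Suc p) e) G = g"
    "\<exists>j. last_nontrivial (Suc n) m G j \<and> upper (Suc n) G j" by blast+
qed

end

lemma join_assoc: "join e (join e a b) c = join e a (join e b c)"
  by (auto simp: join_def)

lemma fst_neq_snd: "(fst :: bool \<times> bool \<Rightarrow> bool) \<noteq> snd"
  by (metis fst_conv snd_conv)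

lemma skip_neq [simp]: "skip p q \<noteq> p" and unskip_skip [simp]: "unskip p (skip p q) = q"
  and skip_unskip: "q \<noteq> p \<Longrightarrow> skip p (unskip p q) = q"
  by (auto simp: skip_def unskip_def)

lemma skip_less: "q < n \<Longrightarrow> skip p q < Suc n"
  by (simp add: skip_def)

section \<open>Upper cells as partners of lower cells\<close>

context labelled
begin

lemma A_fst: "sel = fst \<Longrightarrow> A = {e}" and A_snd: "sel = snd \<Longrightarrow> A = {}" and sel_A: "A = {e} \<Longrightarrow> sel = fst"
  using A_sel fst_neq_snd by auto

text \<open>A coordinate that does not use the variable \<open>p\<close> passes to the face at
  \<open>p\<close> with its variables merely renumbered.\<close>

lemma face_other:
  assumes F: "F \<in> lmaps (Suc n) m" and p: "p \<le> n" and nd: "\<not> depends (Suc n) F i p"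
  defines "g \<equiv> precomp n (face (Suc n) (Suc p) e) F"
  shows "length w = Suc n \<Longrightarrow> F w ! i = g (delete_at p w) ! i"
    and "depends (Suc n) F i r \<Longrightarrow> r \<noteq> p \<and> depends n g i (unskip p r)"
    and "length w = Suc n \<Longrightarrow> F w ! i \<noteq> \<eta> \<Longrightarrow> \<exists>w. length w = n \<and> g w ! i \<noteq> \<eta>"
    and "is_proj (Suc n) (\<lambda>w. F w ! i) \<Longrightarrow> is_proj n (\<lambda>w. g w ! i)"
proof -
  have 1: "F w ! i = g (delete_at p w) ! i" if "length w = Suc n" for w
    using not_depends_insert_at[OF nd, of "delete_at p w" "w ! p" "(e, e)"] that p
      by (simp add: g_def insert_at_delete_at)
  then show "length w = Suc n \<Longrightarrow> F w ! i = g (delete_at p w) ! i" .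
  show "r \<noteq> p \<and> depends n g i (unskip p r)" if d: "depends (Suc n) F i r"
  proof -
    have r: "r \<noteq> p" using d nd by auto
    obtain w a where w: "r < Suc n" "length w = Suc n" "F w ! i \<noteq> F (w[r := a]) ! i"
      using d by (auto simp: depends_def)
    then have "g (delete_at p w) ! i \<noteq> g ((delete_at p w)[unskip p r := a]) ! i"
      using 1[OF w(2)] 1[of "w[r := a]"] delete_at_update[of r w p a] r p by simp
    then show ?thesis using r w p
      by (auto intro!: dependsI[of _ _ "delete_at p w" _ _ a] simp: unskip_def)
  qed
  show "\<exists>w. length w = n \<and> g w ! i \<noteq> \<eta>" if h: "length w = Suc n" "F w ! i \<noteq> \<eta>"
    using 1[OF h(1)] h p by (intro exI[of _ "delete_at p w"]) simp
  show "is_proj n (\<lambda>w. g w ! i)" if tr: "is_proj (Suc n) (\<lambda>w. F w ! i)"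
  proof -
    obtain x where x: "x < Suc n" "\<And>w. length w = Suc n \<Longrightarrow> F w ! i = fst (w ! x)"
      using tr by (auto simp: is_proj_def)
    have "x \<noteq> p"
    proof
      assume xp: "x = p"
      have "depends (Suc n) F i p"
        by (rule dependsI[of _ _ "replicate (Suc n) (False, False)" _ _ "(True, True)"])
          (use x(1) xp x(2)[of "replicate (Suc n) (False, False)"]
            x(2)[of "(replicate (Suc n) (False, False))[p := (True, True)]"] in \<open>simp_all del: replicate_Suc\<close>)
      then show False using nd by blast
    qed
    then have un: "unskip p x < n" using x(1) p by (auto simp: unskip_def)
    have "g w ! i = fst (w ! unskip p x)" if "length w = n" for w
      using x(2)[of "insert_at p (e, e) w"] that p \<open>x \<noteq> p\<close> un nth_insert_at_skip[of "unskip p x" w p "(e, e)"]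
      by (simp add: g_def skip_unskip)
    then show ?thesis using un unfolding is_proj_def by blast
  qed
qed

lemma fill_in_eqI:
  assumes "F \<in> lmaps (Suc n) m" "g \<in> lmaps n m" "p \<le> n" "j < m"
    and "\<And>w i. length w = Suc n \<Longrightarrow> i < m \<Longrightarrow> i \<noteq> j \<Longrightarrow> F w ! i = g (delete_at p w) ! i"
    and "\<And>w. length w = Suc n \<Longrightarrow> F w ! j = join e (g (delete_at p w) ! j) (s (w ! p))"
  shows "F = fill_in n j p s g"
proof (rule pair_cube_ext[OF lmapsD(1)[OF assms(1)]])
  show "fill_in n j p s g \<in> extensional (pair_cube (Suc n))" by (simp add: fill_in_def)
  fix w :: "(bool \<times> bool) list" assume w: "length w = Suc n"
  show "F w = fill_in n j p s g w"
  proof (rule nth_equalityI)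
    show "length (F w) = length (fill_in n j p s g w)"
      using lmapsD(2)[OF assms(1) w] lmapsD(2)[OF assms(2), of "delete_at p w"] w assms(3)
        by (simp add: fill_in_def)
    fix i assume "i < length (F w)"
    then have i: "i < m" using lmapsD(2)[OF assms(1) w] by simp
    show "F w ! i = fill_in n j p s g w ! i"
      using fill_in_nth[OF assms(2,3) w assms(4) i, of s] assms(5)[OF w i] assms(6)[OF w]
        by (cases "i = j") simp_all
  qed
qed

lemma not_depends_updates:
  assumes "length w = n" "\<not> depends n g i a" "\<not> depends n g i b"
  shows "g w ! i = g (w[a := x, b := y]) ! i"
proof (rule ccontr)
  assume "g w ! i \<noteq> g (w[a := x, b := y]) ! i"
  from depends_if_neq[of w n "w[a := x, b := y]" g i, OF _ _ this] assms(1) obtain k where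
    "depends n g i k" "w ! k \<noteq> w[a := x, b := y] ! k" by auto
  then show False using assms by (metis nth_list_update_neq)
qed

text \<open>The lower cell is recovered as a face. If \<open>h\<close> is a single variable
  \<open>x\<close>, then \<open>A = {}\<close>, because for \<open>A = {e}\<close> the cell would be
  degenerate, and the face is \<open>x = e\<close> with coordinate \<open>E(t)\<close>. Otherwise
  the face is \<open>t = e\<close> with coordinate \<open>h\<close>.\<close>

lemma upper_matched:
  assumes F: "nondegenerate N m F" and f: "full N m F" and j: "last_nontrivial N m F j"
    and upper: "upper N F j"
  shows "\<exists>n g p. N = Suc n \<and> matched n m g F p"
proof -
  obtain t h w0 where joins_last: "joins_last N (\<lambda>w. F w ! j) t h" and w0: "length w0 = N" "h w0 \<noteq> e"
    using upper by (auto simp: upper_def)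
  note u = joins_lastD[OF joins_last]
  obtain n where N: "N = Suc n" using u(1) by (cases N) auto
  have FM: "F \<in> lmaps (Suc n) m" using F N by (simp add: nondegenerate_def)
  have jm: "j < m" using j by (simp add: last_nontrivial_def)
  note nt = joins_last_not_is_proj[OF joins_last w0 f jm]
  have ord: "ordered N m F" using lmapsD(3)[OF FM] N by simp
  have rel: "\<exists>i<m. depends N F i q" if "q < N" for q by (rule nondegenerate_relevant[OF F that])
  have other: "\<not> depends N F i d" if "i < m" "i \<noteq> j" "depends N F j d" for i d
    using ordered_depends_unique[OF ord] that jm by blast
  have jtriv: "is_proj N (\<lambda>w. F w ! i)" if "j < i" "i < m" for i using j that
    by (simp add: last_nontrivial_def)
  obtain q0 where q0: "q0 < t" "depends N F j q0" using nt(2) by blast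
  show ?thesis
  proof (cases "\<exists>x<N. \<forall>w. length w = N \<longrightarrow> h w = fst (w ! x)")
    case True
    then obtain x where x: "x < N" "\<And>w. length w = N \<Longrightarrow> h w = fst (w ! x)" by blast
    have Fj: "F w ! j = join e (fst (w ! x)) (sel (w ! t))" if "length w = N" for w
      using u(3)[OF that] x(2)[OF that] by simp
    have dj: "d = x \<or> d = t" if d: "depends N F j d" for d
    proof (rule ccontr)
      assume "\<not> ?thesis"
      moreover obtain w a where w: "length w = N" "F w ! j \<noteq> F (w[d := a]) ! j" using d
        by (auto simp: depends_def)
      ultimately show False using Fj[of w] Fj[of "w[d := a]"] by simp
    qed
    then have xt: "x < t" "depends N F j x" using q0 dj[OF q0(2)] by auto
    have t: "t = Suc x"
    proof (rule ccontr)
      assume "t \<noteq> Suc x"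
      then have "depends N F j (Suc x)"
        using contiguous[OF ord rel jm xt(2) nt(1), of "Suc x"] xt(1) by simp
      then show False using dj[of "Suc x"] \<open>t \<noteq> Suc x\<close> by simp
    qed
    have sel: "sel = snd"
    proof (rule ccontr)
      assume "sel \<noteq> snd"
      then have s: "sel = fst" "A = {e}" using A_sel by auto
      have "factors_at N m F x"
        unfolding factors_at_def
      proof (intro allI impI)
        fix w :: "(bool \<times> bool) list" and i assume w: "length w = N" "i < m"
        let ?w = "w[x := join_pair e (w ! x) (w ! Suc x), Suc x := (e, e)]"
        show "F w ! i = F ?w ! i"
        proof (cases "i = j")
          case True
          then show ?thesis using Fj[OF w(1)] Fj[of ?w] w x(1) u(1) s t
            by (simp add: nth_list_update join_pair_def)
        next
          case False
          then show ?thesis using not_depends_updates[OF w(1) other other] w(2) xt(2) nt(1) t by blast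
        qed
      qed
      then show False using nondegenerate_not_factors[OF F s(2)] u(1) t by blast
    qed
    then have A: "A = {}" by (rule A_snd)
    let ?g = "precomp n (face (Suc n) (Suc x) e) F"
    have xn: "x \<le> n" "x < n" using u(1) t N by auto
    have gM: "?g \<in> lmaps n m" by (rule precomp_face_lmaps[OF FM xn(1)])
    have gj: "?g w ! j = snd (w ! x)" if "length w = n" for w
      using Fj[of "insert_at x (e, e) w"] that N xn sel t by (simp add: nth_insert_at)
    have oth: "\<not> depends (Suc n) F i x" if "i < m" "i \<noteq> j" for i using other[OF that xt(2)] N by simp
    have gfull: "full n m ?g"
      unfolding full_def
    proof (intro allI impI)
      fix i b assume i: "i < m"
      show "\<exists>w. length w = n \<and> ?g w ! i \<noteq> b"
      proof (cases "i = j")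
        case True
        then show ?thesis using gj[of "replicate n (\<not> b, \<not> b)"] xn
          by (intro exI[of _ "replicate n (\<not> b, \<not> b)"]) simp
      next
        case False
        obtain w where "length w = Suc n" "F w ! i \<noteq> b" using fullD[OF f i, of b] N by blast
        then show ?thesis using face_other(3)[OF FM xn(1) oth[OF i False]] by blast
      qed
    qed
    have depx: "depends n ?g j x"
      by (rule dependsI[OF xn(2), of "replicate n (False, False)" _ _ "(True, True)"])
        (use gj[of "replicate n (False, False)"] gj[of "(replicate n (False, False))[x := (True, True)]"] xn
          in simp_all)
    have depx': "d = x" if d: "depends n ?g j d" for d
    proof (rule ccontr)
      assume "d \<noteq> x"
      moreover obtain w a where w: "length w = n" "?g w ! j \<noteq> ?g (w[d := a]) ! j"
        using d unfolding depends_def by blast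
      ultimately show False using gj[of w] gj[of "w[d := a]"] by simp
    qed
    have grel: "\<exists>i<m. depends n ?g i q" if q: "q < n" for q
    proof -
      obtain i where i: "i < m" "depends N F i (skip x q)"
        using rel[of "skip x q"] skip_less[OF q, of x] N by auto
      show ?thesis
      proof (cases "i = j")
        case True
        then have "skip x q = t" using dj[of "skip x q"] i(2) by simp
        then have "q = x" using t by (auto simp: skip_def split: if_splits)
        then show ?thesis using depx jm by blast
      next
        case False
        then show ?thesis using face_other(2)[OF FM xn(1) oth[OF i(1) False], of "skip x q"] i N by auto
      qed
    qed
    have gnd: "nondegenerate n m ?g" by (rule nondegenerateI[OF gM grel]) (use A in auto)
    have glast: "last_nontrivial n m ?g j"
      unfolding last_nontrivial_def
    proof (intro conjI allI impI jm)
      show "\<not> is_proj n (\<lambda>w. ?g w ! j)"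
      proof
        assume "is_proj n (\<lambda>w. ?g w ! j)"
        then obtain y where y: "y < n" "\<forall>w. length w = n \<longrightarrow> ?g w ! j = fst (w ! y)"
          unfolding is_proj_def by blast
        have "?g (replicate n (False, True)) ! j = False" using y by simp
        moreover have "?g (replicate n (False, True)) ! j = True"
          using gj[of "replicate n (False, True)"] xn by simp
        ultimately show False by simp
      qed
      fix i assume "j < i \<and> i < m"
      then show "is_proj n (\<lambda>w. ?g w ! i)" using face_other(4)[OF FM xn(1) oth] jtriv[of i] N by simp
    qed
    have ufg: "joins_last n (\<lambda>w. ?g w ! j) x (\<lambda>w. e)"
      by (rule joins_lastI[OF xn(2) fst_mono_const]) (use gj sel in simp_all)
    have nup: "\<not> upper n ?g j"
    proof
      assume "upper n ?g j"
      then obtain t' h' v where uf': "joins_last n (\<lambda>w. ?g w ! j) t' h'" and v: "length v = n"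
        "h' v \<noteq> e"
        unfolding upper_def by blast
      \<comment> \<open>Resetting all second components to \<open>e\<close> does not affect
        \<open>h'\<close>, but gives the edge the value \<open>e\<close>; so \<open>h'\<close> is
        \<open>e\<close> at \<open>v\<close> as well.\<close>
      let ?v = "map (\<lambda>y. (fst y, e)) v"
      have "h' v = h' ?v" by (rule fst_mono_fst[OF joins_lastD(2)[OF uf']]) (use v in auto)
      moreover have "?g ?v ! j = join e (h' ?v) (snd (?v ! t'))"
        using joins_lastD(3)[OF uf', of ?v] v sel by simp
      moreover have "?g ?v ! j = e" using gj[of ?v] v xn by simp
      ultimately show False using v joins_lastD(1)[OF uf'] by simp
    qed
    have "{q. depends n ?g j q} = {x}" using depx depx' by blast
    then have Mx: "x = Max {q. depends n ?g j q}" by simp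
    have "F = fill_in n j x fst ?g"
    proof (rule fill_in_eqI[OF FM gM xn(1) jm])
      show "F w ! i = ?g (delete_at x w) ! i" if "length w = Suc n" "i < m" "i \<noteq> j" for w i
        by (rule face_other(1)[OF FM xn(1) oth[OF that(2,3)] that(1)])
      show "F w ! j = join e (?g (delete_at x w) ! j) (fst (w ! x))" if "length w = Suc n" for w
        using Fj[of w] gj[of "delete_at x w"] that N xn sel t
          by (simp add: nth_delete_at) (simp add: join_def)
    qed
    moreover have "\<not> plain n ?g j" using ufg by (auto simp: plain_def)
    ultimately have "matched n m ?g F x"
      unfolding matched_def using gnd gfull glast nup Mx by auto
    then show ?thesis using N by blast
  next
    case False
    have tn: "t \<le> n" using u(1) N by simp
    let ?g = "precomp n (face (Suc n) (Suc t) e) F"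
    have gM: "?g \<in> lmaps n m" by (rule precomp_face_lmaps[OF FM tn])
    have oth: "\<not> depends (Suc n) F i t" if "i < m" "i \<noteq> j" for i using other[OF that nt(1)] N by simp
    have gh: "?g w ! j = h (insert_at t (e, e) w)" if "length w = n" for w
      using u(3)[of "insert_at t (e, e) w"] that N tn by (simp add: nth_insert_at)
    have hg: "h w = ?g (delete_at t w) ! j" if "length w = Suc n" for w
      unfolding gh[OF length_delete_at_Suc[OF that tn]]
      by (rule u(4)) (use that N tn in \<open>auto simp: nth_insert_at nth_delete_at\<close>)
    have Fj: "F w ! j = join e (?g (delete_at t w) ! j) (sel (w ! t))" if "length w = Suc n" for w
      using u(3)[of w] hg[OF that] that N by simp
    have Fi: "F w ! i = ?g (delete_at t w) ! i" if "length w = Suc n" "i < m" "i \<noteq> j" for w i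
      by (rule face_other(1)[OF FM tn oth[OF that(2,3)] that(1)])
    have gu: "fst_mono n (\<lambda>w. ?g w ! j)"
    proof -
      have "fst_mono n (\<lambda>w. h (insert_at t (e, e) w))" using fst_mono_insert_at[OF _ tn] u(2) N by simp
      then show ?thesis using fst_mono_cong[of n "\<lambda>w. ?g w ! j" "\<lambda>w. h (insert_at t (e, e) w)"] gh
        by blast
    qed
    have depj: "depends n ?g j (unskip t r)" if d: "depends N F j r" "r \<noteq> t" for r
    proof -
      obtain w a where w: "r < Suc n" "length w = Suc n" "F w ! j \<noteq> F (w[r := a]) ! j"
        using d N by (auto simp: depends_def)
      have "?g (delete_at t w) ! j \<noteq> ?g (delete_at t (w[r := a])) ! j"
      proof
        assume "?g (delete_at t w) ! j = ?g (delete_at t (w[r := a])) ! j"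
        then show False using w Fj[OF w(2)] Fj[of "w[r := a]"] d(2) by simp
      qed
      then have "?g (delete_at t w) ! j \<noteq> ?g ((delete_at t w)[unskip t r := a]) ! j"
        using delete_at_update[of r w t a] w d(2) tn by simp
      moreover have "unskip t r < n" using w d(2) tn by (auto simp: unskip_def)
      ultimately show ?thesis using w tn by (intro dependsI[of _ _ "delete_at t w" _ _ a]) simp_all
    qed
    have depj': "d < t \<and> depends N F j d" if d: "depends n ?g j d" for d
    proof -
      have "depends N F j (skip t d)" using depends_precomp_face[OF d tn] N by simp
      moreover from this have "skip t d \<le> t" by (rule joins_last_depends_le[OF joins_last])
      ultimately show ?thesis by (auto simp: skip_def split: if_splits)
    qed
    have gfull: "full n m ?g"
      unfolding full_def
    proof (intro allI impI)
      fix i b assume i: "i < m"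
      show "\<exists>w. length w = n \<and> ?g w ! i \<noteq> b"
      proof (cases "i = j")
        case True
        obtain w1 where w1: "length w1 = N" "F w1 ! j \<noteq> (\<not> e)" using fullD[OF f jm, of "\<not> e"] by blast
        then have h1: "h w1 = e" using u(3)[OF w1(1)] by (auto simp: join_def split: if_splits)
        show ?thesis
        proof (cases "b = e")
          case True
          then show ?thesis using hg[of w0] w0 N tn \<open>i = j\<close> by (intro exI[of _ "delete_at t w0"]) simp
        next
          case False
          then show ?thesis using hg[of w1] w1 h1 N tn \<open>i = j\<close>
            by (intro exI[of _ "delete_at t w1"]) simp
        qed
      next
        case False
        obtain w where "length w = Suc n" "F w ! i \<noteq> b" using fullD[OF f i, of b] N by blast
        then show ?thesis using face_other(3)[OF FM tn oth[OF i False]] by blast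
      qed
    qed
    have grel: "\<exists>i<m. depends n ?g i q" if q: "q < n" for q
    proof -
      obtain i where i: "i < m" "depends N F i (skip t q)"
        using rel[of "skip t q"] skip_less[OF q, of t] N by auto
      show ?thesis
      proof (cases "i = j")
        case True
        then show ?thesis using depj[of "skip t q"] i jm by auto
      next
        case False
        then show ?thesis using face_other(2)[OF FM tn oth[OF i(1) False], of "skip t q"] i N by auto
      qed
    qed
    have glast: "last_nontrivial n m ?g j"
      unfolding last_nontrivial_def
    proof (intro conjI allI impI jm)
      show "\<not> is_proj n (\<lambda>w. ?g w ! j)"
      proof
        assume "is_proj n (\<lambda>w. ?g w ! j)"
        then obtain y where y: "y < n" "\<And>w. length w = n \<Longrightarrow> ?g w ! j = fst (w ! y)"
          unfolding is_proj_def by blast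
        have "h w = fst (w ! skip t y)" if "length w = N" for w
          using hg[of w] y(2)[of "delete_at t w"] y(1) that N tn by (simp add: nth_delete_at skip_def)
        moreover have "skip t y < N" using y(1) N by (simp add: skip_def)
        ultimately show False using False by blast
      qed
      fix i assume "j < i \<and> i < m"
      then show "is_proj n (\<lambda>w. ?g w ! i)" using face_other(4)[OF FM tn oth] jtriv[of i] N by simp
    qed
    have tpos: "0 < t" "depends N F j (t - 1)"
    proof -
      show "0 < t" using q0(1) by simp
      show "depends N F j (t - 1)"
        using contiguous[OF ord rel jm q0(2) nt(1), of "t - 1"] q0 by (cases "q0 = t - 1") auto
    qed
    have gt1: "depends n ?g j (t - 1)" using depj[OF tpos(2)] tpos(1) by (simp add: unskip_def)
    \<comment> \<open>For \<open>sel = snd\<close>, a coordinate without edges cannot end in one: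
      give the edge at \<open>t'\<close> the value \<open>\<not> e\<close>. For
      \<open>sel = fst\<close>, a last joined variable \<open>t'\<close> of \<open>h\<close> would
      be adjacent to \<open>t\<close>, and by associativity of \<open>join\<close> the cell
      \<open>F\<close> would factor through the connection at \<open>t'\<close>.\<close>
    have plain: "plain n ?g j"
      unfolding plain_def
    proof
      assume "\<exists>t h. joins_last n (\<lambda>w. ?g w ! j) t h"
      then obtain t' h' where uf': "joins_last n (\<lambda>w. ?g w ! j) t' h'" by blast
      note u' = joins_lastD[OF uf']
      consider "sel = snd" | "sel = fst" using sel_cases by blast
      then show False
      proof cases
        case 1
        obtain w where w: "length w = n" "?g w ! j \<noteq> (\<not> e)" using fullD[OF gfull jm, of "\<not> e"] by blast
        let ?w = "w[t' := (fst (w ! t'), \<not> e)]"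
        have "?g w ! j = ?g ?w ! j"
          by (rule fst_mono_fst[OF gu]) (use w in \<open>simp_all add: fst_update\<close>)
        also have "\<dots> = (\<not> e)" using u'(3)[of ?w] w u'(1) 1 by simp
        finally show False using w by simp
      next
        case 2
        have A: "A = {e}" using A_fst[OF 2] .
        obtain v where v: "length v = n" "h' v \<noteq> e"
        proof (rule ccontr)
          assume "\<not> thesis"
          then have "h' v = e" if "length v = n" for v using that \<open>\<And>v. length v = n \<Longrightarrow> h' v \<noteq> e \<Longrightarrow>
            thesis\<close> by blast
          then have "is_proj n (\<lambda>w. ?g w ! j)" unfolding is_proj_def using u'(1,3) 2 by auto
          then show False using glast unfolding last_nontrivial_def by blast
        qed
        have dt': "depends n ?g j t'" by (rule joins_last_not_is_proj(1)[OF uf' v gfull jm])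
        then have t't: "t' < t" "depends N F j t'" using depj' by blast+
        have St: "Suc t' = t"
        proof (rule ccontr)
          assume ne: "Suc t' \<noteq> t"
          then have "depends N F j (Suc t')"
            using contiguous[OF ord rel jm t't(2) nt(1), of "Suc t'"] t't(1) by simp
          then have "depends n ?g j (Suc t')" using depj[of "Suc t'"] ne t't(1)
            by (simp add: unskip_def)
          then show False using joins_last_depends_le[OF uf'] by fastforce
        qed
        have "factors_at N m F t'"
          unfolding factors_at_def
        proof (intro allI impI)
          fix w :: "(bool \<times> bool) list" and i assume w: "length w = N" "i < m"
          let ?x = "join_pair e (w ! t') (w ! Suc t')"
          let ?w = "w[t' := ?x, Suc t' := (e, e)]"
          show "F w ! i = F ?w ! i"
          proof (cases "i = j")
            case True
            have wn: "length w = Suc n" using w N by simp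
            have dw: "delete_at t ?w = (delete_at t w)[t' := ?x]"
              using wn tn t't(1) St[symmetric]
                by (intro nth_equalityI) (auto simp: nth_delete_at nth_list_update)
            have "h' ((delete_at t w)[t' := ?x]) = h' (delete_at t w)"
              by (rule u'(4)) (use wn tn in auto)
            moreover have "delete_at t w ! t' = w ! t'" using wn tn t't(1) by (simp add: nth_delete_at)
            ultimately show ?thesis
              using Fj[OF wn] Fj[of ?w] dw u'(3)[of "delete_at t w"] u'(3)[of "(delete_at t w)[t' := ?x]"] wn tn 2 St u'(1) True
              by (simp add: join_assoc join_pair_def)
          next
            case False
            then show ?thesis using not_depends_updates[OF w(1) other other] w(2) t't(2) nt(1) St
              by blast
          qed
        qed
        then show False using nondegenerate_not_factors[OF F A] St u(1) by blast
      qed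
    qed
    \<comment> \<open>A factorization of the face lifts to \<open>F\<close> unless the merged
      variables lie on the two sides of the removed \<open>t\<close>. In that case coordinate
      \<open>j\<close> uses the left one but not the right one; moving \<open>\<not> e\<close> from
      right to left shows that it ignores the left one too, a contradiction.\<close>
    have gnofac: "\<not> factors_at n m ?g q" if A: "A = {e}" and q: "Suc q < n" for q
    proof
      assume factors_at: "factors_at n m ?g q"
      have facD: "?g w ! i = ?g (w[q := join_pair e (w ! q) (w ! Suc q), Suc q := (e, e)]) ! i"
        if "length w = n" "i < m" for w i using factors_at that unfolding factors_at_def by blast
      show False
      proof (cases "Suc q = t")
        case True
        have nd: "\<not> depends n ?g j t" using depj'[of t] by blast
        have upd: "?g w ! j = ?g (w[t := b]) ! j" if "length w = n" for w b
        proof (rule ccontr)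
          assume "?g w ! j \<noteq> ?g (w[t := b]) ! j"
          moreover have "t < n" using True q by simp
          ultimately show False using dependsI[of t n w ?g j b] that nd by blast
        qed
        have key: "?g w ! j = ?g (w[q := (\<not> e, \<not> e)]) ! j" if w: "length w = n" for w
        proof -
          let ?w = "w[t := (\<not> e, \<not> e)]"
          have "?g w ! j = ?g ?w ! j" by (rule upd[OF w])
          also have "\<dots> = ?g (?w[q := join_pair e (?w ! q) (?w ! Suc q), Suc q := (e, e)]) ! j"
            by (rule facD) (use w jm in simp_all)
          also have "?w[q := join_pair e (?w ! q) (?w ! Suc q), Suc q := (e, e)] = w[q := (\<not> e, \<not> e), t := (e, e)]"
            using w True[symmetric] q
              by (intro nth_equalityI) (auto simp: nth_list_update join_pair_def)
          also have "?g (w[q := (\<not> e, \<not> e), t := (e, e)]) ! j = ?g (w[q := (\<not> e, \<not> e)]) ! j"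
            by (rule upd[symmetric]) (use w in simp)
          finally show ?thesis .
        qed
        have "depends n ?g j q" using gt1 True by auto
        then obtain w a where w: "length w = n" "?g w ! j \<noteq> ?g (w[q := a]) ! j"
          unfolding depends_def by blast
        then show False using key[of w] key[of "w[q := a]"] by simp
      next
        case ne: False
        define r where "r = skip t q"
        have r: "skip t (Suc q) = Suc r" "r \<noteq> t" "Suc r \<noteq> t" "unskip t r = q"
          "unskip t (Suc r) = Suc q" "Suc r < Suc n"
          using ne q by (auto simp: r_def skip_def unskip_def)
        have "factors_at N m F r"
          unfolding factors_at_def
        proof (intro allI impI)
          fix w :: "(bool \<times> bool) list" and i assume w: "length w = N" "i < m"
          have wn: "length w = Suc n" using w N by simp
          let ?x = "join_pair e (w ! r) (w ! Suc r)"
          let ?w = "w[r := ?x, Suc r := (e, e)]" and ?v = "delete_at t w"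
          have vq: "?v ! q = w ! r" "?v ! Suc q = w ! Suc r"
            using wn tn q ne by (auto simp: nth_delete_at r_def skip_def)
          have dw: "delete_at t ?w = ?v[q := join_pair e (?v ! q) (?v ! Suc q), Suc q := (e, e)]"
            using delete_at_update[of r w t ?x] delete_at_update[of "Suc r"
              "w[r := ?x]" t "(e, e)"] wn tn r vq by simp
          have eq: "?g ?v ! i = ?g (delete_at t ?w) ! i" unfolding dw
            by (rule facD) (use wn tn w in simp_all)
          show "F w ! i = F ?w ! i"
          proof (cases "i = j")
            case True
            then show ?thesis using Fj[OF wn] Fj[of ?w] eq wn r by simp
          next
            case False
            then show ?thesis using Fi[OF wn w(2)] Fi[of ?w i] eq wn w(2) by simp
          qed
        qed
        then show False using nondegenerate_not_factors[OF F A] r(6) N by blast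
      qed
    qed
    have gnd: "nondegenerate n m ?g" by (rule nondegenerateI[OF gM grel gnofac])
    have nup: "\<not> upper n ?g j" using plain unfolding plain_def upper_def by blast
    have "Max {q. depends n ?g j q} = t - 1"
    proof (rule Max_eqI)
      show "finite {q. depends n ?g j q}"
        by (rule finite_subset[of _ "{..<n}"]) (auto dest: depends_less)
      show "q \<le> t - 1" if "q \<in> {q. depends n ?g j q}" for q
      proof -
        have "q < t" using depj'[of q] that by blast
        then show ?thesis by simp
      qed
    qed (use gt1 in simp)
    then have Mx: "t = Suc (Max {q. depends n ?g j q})" using tpos(1) by simp
    have "F = fill_in n j t sel ?g"
      by (rule fill_in_eqI[OF FM gM tn jm Fi Fj])
    then have "matched n m ?g F t"
      unfolding matched_def using gnd gfull glast nup Mx plain by auto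
    then show ?thesis using N by blast
  qed
qed

lemma matched_unique: "matched n m g G p \<Longrightarrow> matched n m g G' p' \<Longrightarrow> G = G' \<and> p = p'"
  unfolding matched_def using last_nontrivial_unique by (metis (full_types))

lemma lower_matched: "nondegenerate n m g \<Longrightarrow> full n m g \<Longrightarrow> last_nontrivial n m g j \<Longrightarrow> \<not> upper n g j \<Longrightarrow>
  \<exists>G p. matched n m g G p"
  unfolding matched_def by (cases "plain n g j") auto

text \<open>The last nontrivial coordinate of a partner is \<open>upper\<close>, which is excluded
  for lower cells.\<close>

lemma matched_not_lower: "matched n m g G p \<Longrightarrow> \<not> matched (Suc n) m G G' p'"
  using matched_upper(5)[of n m g G p] last_nontrivial_unique unfolding matched_def by blast

text \<open>The variables of successive coordinates increase strictly, and by nondegeneracy all of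
  them occur; \<open>strict_surj_id\<close> leaves only the identity.\<close>

lemma all_is_proj:
  assumes F: "nondegenerate n m F" and f: "full n m F" and tr: "\<And>i. i < m \<Longrightarrow> is_proj n (\<lambda>w. F w ! i)"
  shows "n = m \<and> F = via_fst n (idm n)"
proof -
  have FM: "F \<in> lmaps n m" using F by (simp add: nondegenerate_def)
  have "\<exists>x. \<forall>i<m. x i < n \<and> (\<forall>w. length w = n \<longrightarrow> F w ! i = fst (w ! x i))"
    using tr unfolding is_proj_def by (intro choice) blast
  then obtain x where x: "\<And>i. i < m \<Longrightarrow> x i < n" "\<And>i w. i < m \<Longrightarrow> length w = n \<Longrightarrow>
    F w ! i = fst (w ! x i)" by blast
  have depends: "q = x i" if iq: "i < m" "depends n F i q" for i q
  proof (rule ccontr)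
    assume "q \<noteq> x i"
    moreover obtain w a where w: "length w = n" "F w ! i \<noteq> F (w[q := a]) ! i" using iq(2)
      unfolding depends_def by blast
    ultimately show False using x(2)[OF iq(1), of w] x(2)[OF iq(1), of "w[q := a]"] by simp
  qed
  have depx: "depends n F i (x i)" if "i < m" for i using full_depends[OF f that] depends[OF that]
    by blast
  have mono: "x i < x i'" if "i < i'" "i' < m" for i i'
    using lmapsD(3)[OF FM] depx[of i] depx[of i'] that unfolding ordered_def by (meson less_trans)
  have surj: "\<exists>i<m. x i = q" if "q < n" for q using nondegenerate_relevant[OF F that] depends by blast
  have nm: "m = n" by (rule strict_surj_id(1)[of m x, OF x(1) mono surj])
  have xi: "x i = i" if "i < m" for i by (rule strict_surj_id(2)[of m x, OF x(1) mono surj that])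
  have "F = via_fst n (idm n)"
  proof (rule lmaps_ext[OF FM])
    show "via_fst n (idm n) \<in> lmaps n m" using via_fst_lmaps[OF idm_in_hom] nm by simp
    show "F w ! i = via_fst n (idm n) w ! i" if "length w = n" "i < m" for w i
      using x(2)[OF that(2,1)] xi[OF that(2)] that nm by simp
  qed
  then show ?thesis using nm by simp
qed

section \<open>Faces of an upper cell: order of attachment and markings\<close>

definition nontriv_count :: "nat \<Rightarrow> nat \<Rightarrow> lmap \<Rightarrow> nat" where
  "nontriv_count n m g = card {i. i < m \<and> \<not> is_proj n (\<lambda>w. g w ! i)}"

text \<open>A projection is lost only by fixing its own variable, and then the coordinate is
  constant, contrary to fullness.\<close>

lemma is_proj_face_full:
  assumes "is_proj (Suc n) (\<lambda>w. G w ! i)" "q \<le> n" "i < m"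
    and f: "full n m (precomp n (face (Suc n) (Suc q) b) G)"
  shows "is_proj n (\<lambda>w. precomp n (face (Suc n) (Suc q) b) G w ! i)"
proof -
  obtain x where x: "x < Suc n" "\<And>w. length w = Suc n \<Longrightarrow> G w ! i = fst (w ! x)"
    using assms(1) by (auto simp: is_proj_def)
  have Fi: "precomp n (face (Suc n) (Suc q) b) G w ! i = fst (insert_at q (b, b) w ! x)"
    if "length w = n" for w
    using x(2)[of "insert_at q (b, b) w"] that assms(2) by simp
  obtain w where w: "length w = n" "precomp n (face (Suc n) (Suc q) b) G w ! i \<noteq> b"
    using fullD[OF f assms(3), of b] by blast
  have "x \<noteq> q" using Fi[OF w(1)] w assms(2) by (auto simp: nth_insert_at)
  then have "unskip q x < n" using x(1) assms(2) by (auto simp: unskip_def)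
  moreover have "precomp n (face (Suc n) (Suc q) b) G w ! i = fst (w ! unskip q x)"
    if "length w = n" for w
    using Fi[OF that] nth_insert_at_skip[of "unskip q x" w q "(b, b)"] that assms(2) \<open>x \<noteq> q\<close> \<open>unskip q x < n\<close>
    by (simp add: skip_unskip)
  ultimately show ?thesis unfolding is_proj_def by blast
qed

text \<open>Fixing a variable other than \<open>t\<close> preserves the form \<open>h\<close> join
  \<open>t\<close>, and the cell remains upper as long as \<open>h\<close> is not constantly
  \<open>e\<close> on the face.\<close>

lemma upper_face:
  assumes j: "last_nontrivial (Suc n) m G j" and joins_last: "joins_last (Suc n) (\<lambda>w. G w ! j) t h"
    and q: "q \<le> n" "q \<noteq> t"
    and f: "full n m (precomp n (face (Suc n) (Suc q) b) G)" and h: "length w0 = n"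
      "h (insert_at q (b, b) w0) \<noteq> e"
  shows "last_nontrivial n m (precomp n (face (Suc n) (Suc q) b) G) j \<and>
    upper n (precomp n (face (Suc n) (Suc q) b) G) j"
proof -
  let ?F = "precomp n (face (Suc n) (Suc q) b) G"
  have jm: "j < m" using j by (simp add: last_nontrivial_def)
  have "joins_last n (\<lambda>w. G (insert_at q (b, b) w) ! j) (if t < q then t else t - 1) (\<lambda>w. h (insert_at q (b, b) w))"
    by (rule joins_last_insert_at[OF joins_last q])
  moreover have "joins_last n (\<lambda>w. ?F w ! j) = joins_last n (\<lambda>w. G (insert_at q (b, b) w) ! j)"
    by (rule joins_last_cong) (use q in simp)
  ultimately have uf': "joins_last n (\<lambda>w. ?F w ! j) (if t < q then t else t - 1) (\<lambda>w. h (insert_at q (b, b) w))" by simp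
  have "last_nontrivial n m ?F j"
    unfolding last_nontrivial_def
      using jm joins_last_not_is_proj(3)[OF uf' h f jm] is_proj_face_full[OF _ q(1) _ f] j
    unfolding last_nontrivial_def by blast
  moreover have "upper n ?F j" unfolding upper_def using uf' h by blast
  ultimately show ?thesis ..
qed

text \<open>Makes the other faces precede the missing one: an upper face belongs to a pair of lower
  dimension. The exception is the face \<open>t = e\<close> of \<open>x\<close> join
  \<open>E(t)\<close>, which is \<open>g\<close> with the edge replaced by the variable
  \<open>x\<close> and so has one nontrivial coordinate less.\<close>

lemma matched_faces:
  assumes matched: "matched n m g G p" and q: "q \<le> n" "(q, b) \<noteq> (p, e)"
    and F: "nondegenerate n m (precomp n (face (Suc n) (Suc q) b) G)"
      "full n m (precomp n (face (Suc n) (Suc q) b) G)"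
      (is "full n m ?F")
  shows "(\<exists>j. last_nontrivial n m ?F j \<and> upper n ?F j) \<or> nontriv_count n m ?F < nontriv_count n m g"
  using matched
proof (cases rule: matched_cases)
  case (I j)
  have gM: "g \<in> lmaps n m" using I(1) by (simp add: nondegenerate_def)
  have jm: "j < m" using I(3) by (simp add: last_nontrivial_def)
  have cj: "admissible (Suc n) (\<lambda>w. G w ! j)" using I(9) by (auto simp: admissible_def)
  note b = fill_in_basic[OF gM I(2) jm I(5,6,7) sel_diag I(8) cj]
  have GM: "G \<in> lmaps (Suc n) m" by (rule b(1))
  obtain j' where j': "last_nontrivial (Suc n) m G j'" "upper (Suc n) G j'"
    using matched_upper(5)[OF matched] by blast
  \<comment> \<open>The face of \<open>G\<close> opposite to the missing one has the constant
    coordinate \<open>\<not> e\<close>, so it is not full.\<close>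
  have qp: "q \<noteq> p"
  proof
    assume "q = p"
    then have b': "b = (\<not> e)" using q by auto
    obtain w where w: "length w = n" "?F w ! j \<noteq> (\<not> e)" using fullD[OF F(2) jm, of "\<not> e"] by blast
    then show False using b(7)[OF w(1)] \<open>q = p\<close> b' q(1) by simp
  qed
  \<comment> \<open>If \<open>h\<close> were constantly \<open>e\<close> on the face, coordinate
    \<open>j\<close> would reduce to the new variable. But \<open>g\<close> has two variables there,
    and the face fixes at most one; the other would occur nowhere, so the face would be
    degenerate.\<close>
  obtain w0 where w0: "length w0 = n" "g (delete_at p (insert_at q (b, b) w0)) ! j \<noteq> e"
  proof (rule ccontr)
    assume "\<not> thesis"
    then have he: "g (delete_at p (insert_at q (b, b) w)) ! j = e" if "length w = n" for w
      using that \<open>\<And>w0. length w0 = n \<Longrightarrow> g (delete_at p (insert_at q (b, b) w0)) ! j \<noteq> e \<Longrightarrow> thesis\<close>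
        by blast
    have Fj: "?F w ! j = sel (w ! unskip q p)" if "length w = n" for w
    proof -
      have "?F w ! j = join e (g (delete_at p (insert_at q (b, b) w)) ! j) (sel (insert_at q (b, b) w ! p))"
        using joins_lastD(3)[OF I(9), of "insert_at q (b, b) w"] that q(1) by simp
      also have "insert_at q (b, b) w ! p = w ! unskip q p"
        using that q(1) qp I(5) by (auto simp: nth_insert_at unskip_def)
      finally show ?thesis using he[OF that] by simp
    qed
    obtain d where d: "depends n g j d" "skip p d \<noteq> q"
    proof -
      obtain d1 where "d1 \<noteq> p - 1" "depends n g j d1" using I(15) by blast
      moreover have "skip p d1 \<noteq> skip p (p - 1)" using \<open>d1 \<noteq> p - 1\<close> by (metis unskip_skip)
      ultimately show thesis using that[of d1] that[of "p - 1"] I(13) by (cases "skip p d1 = q") auto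
    qed
    let ?r = "skip p d"
    have r: "depends (Suc n) G j ?r" "?r < Suc n"
      using b(4)[OF d(1)] skip_less depends_less[OF d(1)] by auto
    have "unskip q ?r < n" using r(2) d(2) q(1) by (auto simp: unskip_def)
    then obtain i where i: "i < m" "depends n ?F i (unskip q ?r)"
      using nondegenerate_relevant[OF F(1)] by blast
    have "depends (Suc n) G i ?r" using depends_precomp_face[OF i(2) q(1)] skip_unskip[OF d(2)] by simp
    then have "i = j" using ordered_depends_unique[OF lmapsD(3)[OF GM] i(1) jm _ r(1)] by blast
    then obtain w a where w: "length w = n" "?F w ! j \<noteq> ?F (w[unskip q ?r := a]) ! j"
      using i(2) unfolding depends_def by blast
    have "unskip q ?r \<noteq> unskip q p"
      using skip_neq[of p d] d(2) qp by (metis skip_unskip)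
    then show False using w Fj[OF w(1)] Fj[of "w[unskip q ?r := a]"] by simp
  qed
  have "last_nontrivial n m ?F j' \<and> upper n ?F j'"
  proof -
    have "last_nontrivial (Suc n) m G j"
      using is_proj_fill_in[OF gM I(5) jm, of _ sel] joins_last_not_is_proj(3)[OF I(9) _ w0(2) b(2) jm] w0(1) I(3) jm q(1)
      unfolding last_nontrivial_def I(8)[symmetric] by simp
    then show ?thesis
      using upper_face[OF _ I(9) q(1) qp F(2) w0] last_nontrivial_unique[OF j'(1)] by blast
  qed
  then show ?thesis by blast
next
  case (II j)
  have gM: "g \<in> lmaps n m" using II(1) by (simp add: nondegenerate_def)
  have jm: "j < m" using II(3) by (simp add: last_nontrivial_def)
  have cj: "admissible (Suc n) (\<lambda>w. G w ! j)" using II(9) by (auto simp: admissible_def)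
  have diag: "fst (b, b) = b" for b :: bool by simp
  note b = fill_in_basic[OF gM II(2) jm II(5,6,7) diag II(8) cj]
  have GM: "G \<in> lmaps (Suc n) m" by (rule b(1))
  have Gj: "G w ! j = join e (fst (w ! p)) (snd (w ! Suc p))" if "length w = Suc n" for w
    using joins_lastD(3)[OF II(9) that] II(11) by simp
  have qp: "q \<noteq> p"
  proof
    assume "q = p"
    then have b': "b = (\<not> e)" using q by auto
    obtain w where w: "length w = n" "?F w ! j \<noteq> (\<not> e)" using fullD[OF F(2) jm, of "\<not> e"] by blast
    then show False using b(7)[OF w(1)] \<open>q = p\<close> b' q(1) by simp
  qed
  show ?thesis
  proof (cases "q = Suc p")
    case False
    let ?w = "replicate n (\<not> e, \<not> e)"
    have w: "fst (insert_at q (b, b) ?w ! p) \<noteq> e"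
      using q(1) qp II(5,12) by (auto simp: nth_insert_at)
    have ltG: "last_nontrivial (Suc n) m G j"
      using is_proj_fill_in[OF gM II(5) jm, of _ fst] joins_last_not_is_proj(3)[OF II(9) _ w b(2) jm] II(3) jm q(1)
      unfolding last_nontrivial_def II(8)[symmetric] by simp
    show ?thesis using upper_face[OF ltG II(9) q(1) False F(2) _ w] by auto
  next
    case True
    have be: "b = e"
    proof (rule ccontr)
      assume "b \<noteq> e"
      then have b': "b = (\<not> e)" by auto
      obtain w where w: "length w = n" "?F w ! j \<noteq> (\<not> e)" using fullD[OF F(2) jm, of "\<not> e"] by blast
      then show False using Gj[of "insert_at q (b, b) w"] True b' q(1) by (simp add: nth_insert_at)
    qed
    have depp: "depends n g j p"
      by (rule dependsI[OF II(12), of "replicate n (False, False)" _ _ "(True, True)"])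
        (use II(13)[of "replicate n (False, False)"] II(13)[of "(replicate n (False, False))[p := (True, True)]"] II(12)
          in simp_all)
    have Fi: "?F w ! i = g w ! i" if w: "length w = n" "i < m" "i \<noteq> j" for w i
    proof -
      have "?F w ! i = g (delete_at p (insert_at (Suc p) (e, e) w)) ! i"
        using fill_in_nth[OF gM II(5) _ jm w(2), of "insert_at q (b, b) w" fst] w q(1) True be II(8)
          by simp
      also have "delete_at p (insert_at (Suc p) (e, e) w) = w[p := (e, e)]"
        using w II(12) by (intro nth_equalityI) (auto simp: nth_delete_at nth_insert_at nth_list_update)
      also have "g (w[p := (e, e)]) ! i = g w ! i"
      proof (rule ccontr)
        assume "g (w[p := (e, e)]) ! i \<noteq> g w ! i"
        then have "depends n g i p" using dependsI[OF II(12) w(1), of g i "(e, e)"] by metis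
        then show False using ordered_depends_unique[OF lmapsD(3)[OF gM] w(2) jm _ depp] w(3) by blast
      qed
      finally show ?thesis .
    qed
    have "?F w ! j = fst (w ! p)" if "length w = n" for w
      using Gj[of "insert_at q (b, b) w"] that True be q(1) II(12) by (simp add: nth_insert_at)
    then have trj: "is_proj n (\<lambda>w. ?F w ! j)" unfolding is_proj_def using II(12) by blast
    have tri: "is_proj n (\<lambda>w. ?F w ! i) = is_proj n (\<lambda>w. g w ! i)" if "i < m" "i \<noteq> j" for i
      unfolding is_proj_def using Fi[OF _ that] by metis
    have "{i. i < m \<and> \<not> is_proj n (\<lambda>w. ?F w ! i)} \<subset> {i. i < m \<and> \<not> is_proj n (\<lambda>w. g w ! i)}"
      using trj tri II(3) unfolding last_nontrivial_def by blast
    then have "nontriv_count n m ?F < nontriv_count n m g" unfolding nontriv_count_def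
      by (intro psubset_card_mono) auto
    then show ?thesis ..
  qed
qed

text \<open>By the order only coordinate \<open>j\<close> of the face can contain the variable
  \<open>q\<close>. If this coordinate is neither \<open>q\<close> nor its edge, then
  \<open>q\<close> reappears unchanged nowhere and witnesses the marking.\<close>

lemma lmarkedI:
  assumes G: "G \<in> lmaps N m" and \<delta>: "\<delta> \<in> box_hom A k N" and j: "j < m" "depends N G j c"
    and q: "q < k" "\<And>v. length v = k \<Longrightarrow> \<delta> v ! c = v ! q"
    and ne: "\<And>\<pi>. \<pi> = fst \<or> \<pi> = snd \<Longrightarrow> \<exists>w. length w = k \<and> G (on_pairs \<delta> w) ! j \<noteq> \<pi> (w ! q)"
  shows "precomp k \<delta> G \<in> lmarked k m"
proof -
  let ?F = "precomp k \<delta> G"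
  have cN: "c < N" using depends_less[OF j(2)] .
  have d\<delta>: "depends k \<delta> c q"
    by (rule dependsI[OF q(1), of "replicate k False" _ _ True])
      (use q(1) q(2)[of "replicate k False"] q(2)[of "(replicate k False)[q := True]"] in simp_all)
  have no: "\<not> (\<forall>w. length w = k \<longrightarrow> ?F w ! i = \<pi> (w ! q))" if i: "i < m" and \<pi>: "\<pi> = fst \<or> \<pi> = snd"
    for i \<pi>
  proof
    assume eq: "\<forall>w. length w = k \<longrightarrow> ?F w ! i = \<pi> (w ! q)"
    have "depends k ?F i q"
      by (rule dependsI[OF q(1), of "replicate k (False, False)" _ _ "(True, True)"])
        (use q(1) eq[rule_format, of "replicate k (False, False)"]
          eq[rule_format, of "(replicate k (False, False))[q := (True, True)]"] \<pi> in auto)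
    then have "depends k (\<lambda>w. G (on_pairs \<delta> w)) i q"
      using depends_cong[of k ?F "\<lambda>w. G (on_pairs \<delta> w)"] by simp
    then obtain c' where c': "depends N G i c'" "depends k (on_pairs \<delta>) c' q"
      using depends_comp[of k G "on_pairs \<delta>" i q N, OF _ length_on_pairs[OF \<delta>]] by blast
    have c'N: "c' < N" using depends_less[OF c'(1)] .
    have "c' = c"
      using ordered_depends_unique[OF ordered_box_hom[OF \<delta>] c'N cN depends_on_pairs[OF \<delta> c'N c'(2)] d\<delta>] .
    then have "i = j" using ordered_depends_unique[OF lmapsD(3)[OF G] i j(1) c'(1)] j(2) by blast
    then show False using eq ne[OF \<pi>] by auto
  qed
  have "?F \<in> lmaps k m" by (rule precomp_lmaps[OF \<delta> G])
  then show ?thesis unfolding lmarked_def using no q(1) by blast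
qed

lemma lmarkedI_const:
  assumes "G \<in> lmaps N m" "\<delta> \<in> box_hom A k N" "j < m" "depends N G j c"
    and q: "q < k" "\<And>v. length v = k \<Longrightarrow> \<delta> v ! c = v ! q"
    and const: "\<And>w. length w = k \<Longrightarrow> G (on_pairs \<delta> w) ! j = b"
  shows "precomp k \<delta> G \<in> lmarked k m"
proof (rule lmarkedI[OF assms(1-4) q])
  show "\<exists>w. length w = k \<and> G (on_pairs \<delta> w) ! j \<noteq> \<pi> (w ! q)" if "\<pi> = fst \<or> \<pi> = snd" for \<pi>
    using const[of "replicate k (\<not> b, \<not> b)"] q(1) that
    by (intro exI[of _ "replicate k (\<not> b, \<not> b)"]) auto
qed

text \<open>Coordinate \<open>j\<close> cannot be equal to two different variables, so one of
  \<open>q\<close> and \<open>q'\<close> serves as witness in \<open>lmarkedI\<close>.\<close>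

lemma lmarkedI2:
  assumes G: "G \<in> lmaps N m" and \<delta>: "\<delta> \<in> box_hom A k N" and j: "j < m" "depends N G j c"
    "depends N G j c'" "c \<noteq> c'"
    and q: "q < k" "\<And>v. length v = k \<Longrightarrow> \<delta> v ! c = v ! q"
    and q': "q' < k" "\<And>v. length v = k \<Longrightarrow> \<delta> v ! c' = v ! q'"
  shows "precomp k \<delta> G \<in> lmarked k m"
proof (cases "\<exists>\<pi>. (\<pi> = fst \<or> \<pi> = snd) \<and> (\<forall>w. length w = k \<longrightarrow> G (on_pairs \<delta> w) ! j = \<pi> (w ! q))")
  case False
  show ?thesis by (rule lmarkedI[OF G \<delta> j(1,2) q]) (use False in blast)+
next
  case True
  then obtain \<pi> where \<pi>: "\<pi> = fst \<or> \<pi> = snd" "\<And>w. length w = k \<Longrightarrow> G (on_pairs \<delta> w) ! j = \<pi> (w ! q)"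
    by blast
  have d: "depends k \<delta> x y" if "y < k" "\<And>v. length v = k \<Longrightarrow> \<delta> v ! x = v ! y" for x y
    by (rule dependsI[OF that(1), of "replicate k False" _ _ True])
      (use that(1) that(2)[of "replicate k False"] that(2)[of "(replicate k False)[y := True]"] in simp_all)
  have "q \<noteq> q'"
    using ordered_depends_unique[OF ordered_box_hom[OF \<delta>] depends_less[OF j(2)] depends_less[OF j(3)] d[OF q]] d[OF q'] j(4) by blast
  let ?w = "(replicate k (False, False))[q := (True, True)]"
  have "G (on_pairs \<delta> ?w) ! j = True" using \<pi>(2)[of ?w] \<pi>(1) q(1) by auto
  moreover have "\<pi>' (?w ! q') = False" if "\<pi>' = fst \<or> \<pi>' = snd" for \<pi>' :: "bool \<times> bool \<Rightarrow> bool"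
    using that \<open>q \<noteq> q'\<close> q'(1) by auto
  moreover have "length ?w = k" by simp
  ultimately have "\<exists>w. length w = k \<and> G (on_pairs \<delta> w) ! j \<noteq> \<pi>' (w ! q')" if "\<pi>' = fst \<or> \<pi>' = snd"
    for \<pi>' :: "bool \<times> bool \<Rightarrow> bool"
    using that by metis
  from lmarkedI[OF G \<delta> j(1,3) q' this] show ?thesis .
qed

lemma face_free:
  assumes "q \<le> n" "c \<noteq> q" "c < Suc n"
  shows "unskip q c < n" "length v = n \<Longrightarrow> face (Suc n) (Suc q) b v ! c = v ! unskip q c"
  using assms by (auto simp: unskip_def nth_insert_at)

text \<open>Provides the hypothesis of the marking extension. A face that leaves two variables in
  coordinate \<open>j\<close>, or makes it constant, is marked. What remains is the face
  \<open>t = e\<close> in (II), where \<open>x\<close> replaces \<open>E(t)\<close>: a variable that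
  reappears nowhere in \<open>g\<close> is different from \<open>t\<close>, and reappears nowhere in
  this face either.\<close>

lemma matched_marked_faces:
  assumes matched: "matched n m g G p" and gmk: "g \<in> lmarked n m"
  shows "n \<ge> 1 \<and> (\<forall>q\<le>n. \<forall>b. (q, b) \<noteq> (p, e) \<longrightarrow> precomp n (face (Suc n) (Suc q) b) G \<in> lmarked n m)"
proof (intro conjI allI impI)
  show "n \<ge> 1" using gmk by (auto simp: lmarked_def)
  fix q b assume q: "q \<le> n" "(q, b) \<noteq> (p, e)"
  let ?F = "precomp n (face (Suc n) (Suc q) b) G"
  have \<delta>: "face (Suc n) (Suc q) b \<in> box_hom A n (Suc n)" by (rule face_hom[OF q(1)])
  show "?F \<in> lmarked n m"
    using matched
  proof (cases rule: matched_cases)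
    case (I j)
    have gM: "g \<in> lmaps n m" using I(1) by (simp add: nondegenerate_def)
    have jm: "j < m" using I(3) by (simp add: last_nontrivial_def)
    have cj: "admissible (Suc n) (\<lambda>w. G w ! j)" using I(9) by (auto simp: admissible_def)
    note b = fill_in_basic[OF gM I(2) jm I(5,6,7) sel_diag I(8) cj]
    obtain d1 where d1: "d1 \<noteq> p - 1" "depends n g j d1" using I(15) by blast
    let ?d = "p - 1"
    have D: "depends (Suc n) G j (skip p ?d)" "depends (Suc n) G j (skip p d1)" "skip p d1 \<noteq> skip p ?d"
      using b(4) I(13) d1 by (auto, metis unskip_skip)
    note Dl = depends_less[OF D(1)] depends_less[OF D(2)] depends_less[OF b(3)]
    show ?thesis
    proof (cases "q = p")
      case True
      then have b': "b = (\<not> e)" using q by auto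
      have c: "skip p ?d \<noteq> q" using True by simp
      show ?thesis
        by (rule lmarkedI_const[OF b(1) \<delta> jm D(1) face_free[OF q(1) c Dl(1)], of "\<not> e"])
          (use b(7) True b' q(1) in simp_all)
    next
      case False
      have "\<exists>c c'. depends (Suc n) G j c \<and> depends (Suc n) G j c' \<and> c \<noteq> c' \<and> c \<noteq> q \<and> c' \<noteq> q"
      proof (cases "skip p ?d = q")
        case True
        then show ?thesis using b(3) D(2,3) False by (intro exI[of _ p] exI[of _ "skip p d1"]) auto
      next
        case f: False
        have "p \<noteq> skip p ?d" by (rule not_sym[OF skip_neq])
        then show ?thesis using b(3) D(1) False f by (intro exI[of _ p] exI[of _ "skip p ?d"]) auto
      qed
      then obtain c c' where c: "depends (Suc n) G j c" "depends (Suc n) G j c'" "c \<noteq> c'" "c \<noteq> q"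
        "c' \<noteq> q" by blast
      show ?thesis
        by (rule lmarkedI2[OF b(1) \<delta> jm c(1-3) face_free[OF q(1) c(4) depends_less[OF c(1)]]
              face_free[OF q(1) c(5) depends_less[OF c(2)]]])
    qed
  next
    case (II j)
    have gM: "g \<in> lmaps n m" using II(1) by (simp add: nondegenerate_def)
    have jm: "j < m" using II(3) by (simp add: last_nontrivial_def)
    have cj: "admissible (Suc n) (\<lambda>w. G w ! j)" using II(9) by (auto simp: admissible_def)
    have diag: "fst (b, b) = b" for b :: bool by simp
    note b = fill_in_basic[OF gM II(2) jm II(5,6,7) diag II(8) cj]
    have Gj: "G w ! j = join e (fst (w ! p)) (snd (w ! Suc p))" if "length w = Suc n" for w
      using joins_lastD(3)[OF II(9) that] II(11) by simp
    have depp: "depends n g j p"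
      by (rule dependsI[OF II(12), of "replicate n (False, False)" _ _ "(True, True)"])
        (use II(13)[of "replicate n (False, False)"] II(13)[of "(replicate n (False, False))[p := (True, True)]"] II(12)
          in simp_all)
    have D: "depends (Suc n) G j p" "depends (Suc n) G j (Suc p)" using b(3) b(4)[OF depp]
      by (auto simp: skip_def)
    note Dl = depends_less[OF D(1)] depends_less[OF D(2)]
    consider "q \<noteq> p" "q \<noteq> Suc p" | "q = p" "b = (\<not> e)" | "q = Suc p" "b = (\<not> e)" | "q = Suc p" "b = e"
      using q(2) by (cases "q = p"; cases "q = Suc p"; cases "b = e") auto
    then show ?thesis
    proof cases
      case 1
      have c: "p \<noteq> q" "Suc p \<noteq> q" "p \<noteq> Suc p" using 1 by auto
      show ?thesis
        by (rule lmarkedI2[OF b(1) \<delta> jm D c(3) face_free[OF q(1) c(1) Dl(1)] face_free[OF q(1) c(2) Dl(2)]])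
    next
      case 2
      have c: "Suc p \<noteq> q" using 2 by simp
      show ?thesis
        by (rule lmarkedI_const[OF b(1) \<delta> jm D(2) face_free[OF q(1) c Dl(2)], of "\<not> e"])
          (use Gj 2 q(1) in \<open>simp_all add: nth_insert_at\<close>)
    next
      case 3
      have c: "p \<noteq> q" using 3 by simp
      show ?thesis
        by (rule lmarkedI_const[OF b(1) \<delta> jm D(1) face_free[OF q(1) c Dl(1)], of "\<not> e"])
          (use Gj 3 q(1) in \<open>simp_all add: nth_insert_at\<close>)
    next
      case 4
      obtain k where k: "k < n" "\<And>i. i < m \<Longrightarrow> \<not> (\<forall>w. length w = n \<longrightarrow> g w ! i = fst (w ! k))"
        "\<And>i. i < m \<Longrightarrow> \<not> (\<forall>w. length w = n \<longrightarrow> g w ! i = snd (w ! k))"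
        using gmk unfolding lmarked_def by blast
      have Fi: "?F w ! i = g w ! i" if w: "length w = n" "i < m" "i \<noteq> j" for w i
      proof -
        have "?F w ! i = g (delete_at p (insert_at (Suc p) (e, e) w)) ! i"
          using fill_in_nth[OF gM II(5) _ jm w(2), of "insert_at q (b, b) w" fst] w q(1) 4 II(8) by simp
        also have "delete_at p (insert_at (Suc p) (e, e) w) = w[p := (e, e)]"
          using w II(12)
            by (intro nth_equalityI) (auto simp: nth_delete_at nth_insert_at nth_list_update)
        also have "g (w[p := (e, e)]) ! i = g w ! i"
        proof (rule ccontr)
          assume "g (w[p := (e, e)]) ! i \<noteq> g w ! i"
          then have "depends n g i p" using dependsI[OF II(12) w(1), of g i "(e, e)"] by metis
          then show False using ordered_depends_unique[OF lmapsD(3)[OF gM] w(2) jm _ depp] w(3) by blast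
        qed
        finally show ?thesis .
      qed
      have Fj: "?F w ! j = fst (w ! p)" if "length w = n" for w
        using Gj[of "insert_at q (b, b) w"] that 4 q(1) II(12) by (simp add: nth_insert_at)
      have kp: "k \<noteq> p" using k(3)[OF jm] II(13) by blast
      have no: "\<not> (\<forall>w. length w = n \<longrightarrow> ?F w ! i = \<pi> (w ! k))" if "i < m" "\<pi> = fst \<or> \<pi> = snd" for i \<pi>
      proof (cases "i = j")
        case True
        let ?w = "(replicate n (False, False))[k := (True, True)]"
        have "?F ?w ! j \<noteq> \<pi> (?w ! k)" using Fj[of ?w] kp that(2) k(1) II(12) by auto
        then show ?thesis using True by (metis length_list_update length_replicate)
      next
        case False
        then show ?thesis using k(2,3)[OF that(1)] Fi[OF _ that(1) False] that(2) by auto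
      qed
      have "?F \<in> lmaps n m" by (rule precomp_lmaps[OF \<delta> b(1)])
      then show ?thesis unfolding lmarked_def using no k(1) by blast
    qed
  qed
qed

text \<open>The new variable at \<open>p\<close> stays free, as the index \<open>Suc p\<close> does
  not occur in a critical word. Coordinate \<open>j\<close> then either retains a second variable or
  is constantly \<open>\<not> e\<close>, and both imply the marking.\<close>

lemma matched_critical:
  assumes matched: "matched n m g G p" and crit: "\<delta> \<in> critical_faces (Suc n) (Suc p) e k"
  shows "precomp k \<delta> G \<in> lmarked k m"
proof -
  obtain W where W: "\<delta> = face_comp (Suc n) W" "W \<in> face_words (Suc n)" "length W + k = Suc n"
    "critical_word (Suc p) e W"
    using crit by (auto simp: critical_faces_def)
  have k: "k = Suc n - length W" using W(3) by simp
  have \<delta>: "\<delta> \<in> box_hom A k (Suc n)" using face_comp_in_hom[OF W(2)] W(1) k by simp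
  have pfree: "Suc p \<notin> fst ` set W"
  proof
    assume "Suc p \<in> fst ` set W"
    then obtain b where "(Suc p, b) \<in> set W" by auto
    then show False using W(4) unfolding critical_word_def by (cases "b = e") auto
  qed
  have free: "\<exists>q<k. \<forall>v. length v = k \<longrightarrow> \<delta> v ! c = v ! q" if "c < Suc n" "Suc c \<notin> fst ` set W" for c
    using face_comp_free[OF W(2) that] W(1) k by simp
  have fixed: "on_pairs \<delta> w ! c = (b, b)" if "c < Suc n" "(Suc c, b) \<in> set W" "length w = k" for c b w
    using nth_on_pairs[OF \<delta> that(3,1)] face_comp_fixed[OF W(2) that(2)] W(1) k that(3) by simp
  have pn: "p \<le> n" by (rule matched_upper(3)[OF matched])
  obtain q0 where q0: "q0 < k" "\<And>v. length v = k \<Longrightarrow> \<delta> v ! p = v ! q0"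
    using free[of p] pfree pn by auto
  show ?thesis
    using matched
  proof (cases rule: matched_cases)
    case (I j)
    have gM: "g \<in> lmaps n m" using I(1) by (simp add: nondegenerate_def)
    have jm: "j < m" using I(3) by (simp add: last_nontrivial_def)
    have cj: "admissible (Suc n) (\<lambda>w. G w ! j)" using I(9) by (auto simp: admissible_def)
    note b = fill_in_basic[OF gM I(2) jm I(5,6,7) sel_diag I(8) cj]
    have dG: "depends (Suc n) G j d" if "depends n g j d" for d
      using b(4)[OF that] I(12)[OF that] by (simp add: skip_def)
    show ?thesis
    proof (cases "\<exists>d. depends n g j d \<and> Suc d \<notin> fst ` set W")
      case True
      then obtain d where d: "depends n g j d" "Suc d \<notin> fst ` set W" by blast
      obtain q where q: "q < k" "\<And>v. length v = k \<Longrightarrow> \<delta> v ! d = v ! q"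
        using free[OF _ d(2)] depends_less[OF dG[OF d(1)]] by blast
      have "p \<noteq> d" using I(12)[OF d(1)] by simp
      then show ?thesis by (rule lmarkedI2[OF b(1) \<delta> jm b(3) dG[OF d(1)] _ q0 q])
    next
      case allfixed: False
      show ?thesis
      proof (cases "\<exists>d. depends n g j d \<and> (Suc d, e) \<in> set W")
        case True
        let ?E = "{d. depends n g j d \<and> (Suc d, e) \<in> set W}"
        have fin: "finite ?E" by (rule finite_subset[of _ "{..<n}"]) (auto dest: depends_less)
        \<comment> \<open>The largest variable of \<open>j\<close> fixed at \<open>e\<close>. By
          contiguity everything between it and \<open>p\<close> belongs to \<open>j\<close>, and by
          maximality it is fixed at \<open>\<not> e\<close>: the pattern excluded by condition
          (3).\<close>
        define d where "d = Max ?E"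
        have "d \<in> ?E" unfolding d_def using Max_in[OF fin] True by blast
        then have d: "depends n g j d" "(Suc d, e) \<in> set W" by auto
        have "(k', \<not> e) \<in> set W" if k': "Suc d < k'" "k' < Suc p" for k'
        proof -
          obtain c where c: "k' = Suc c" "d < c" "c < p" using k' by (cases k') auto
          have rel: "\<exists>i<m. depends (Suc n) G i q" if "q < Suc n" for q
            by (rule nondegenerate_relevant[OF matched_upper(1)[OF matched] that])
          have "depends (Suc n) G j c"
            by (rule contiguous[OF lmapsD(3)[OF b(1)] rel jm dG[OF d(1)] b(3) c(2,3)])
          then have dc: "depends n g j c" using b(5)[of j c] jm c(3) by (auto simp: unskip_def)
          then obtain b' where b': "(Suc c, b') \<in> set W" using allfixed by force
          have "b' \<noteq> e"
          proof
            assume "b' = e"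
            then have "c \<in> ?E" using dc b' by simp
            then show False using Max_ge[OF fin, of c] c(2) by (simp add: d_def)
          qed
          then have "b' = (\<not> e)" by auto
          then show ?thesis using b' c(1) by simp
        qed
        moreover have "Suc d < Suc p" using I(12)[OF d(1)] by simp
        ultimately have False using W(4) d(2) unfolding critical_word_def by blast
        then show ?thesis ..
      next
        case noe: False
        have fx: "(Suc d, \<not> e) \<in> set W" if d: "depends n g j d" for d
        proof -
          obtain b' where b': "(Suc d, b') \<in> set W" using allfixed d by force
          then have "b' \<noteq> e" using noe d by blast
          then have "b' = (\<not> e)" by auto
          then show ?thesis using b' by simp
        qed
        \<comment> \<open>All variables of \<open>g\<close> in coordinate \<open>j\<close> are at
          \<open>\<not> e\<close>. By monotonicity a nonconstant coordinate takes the value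
          \<open>\<not> e\<close> at the vertex \<open>?W\<close>.\<close>
        have const: "G (on_pairs \<delta> w) ! j = (\<not> e)" if w: "length w = k" for w
        proof -
          let ?v = "delete_at p (on_pairs \<delta> w)" and ?W = "replicate n (\<not> e, \<not> e)"
          have ll: "length (on_pairs \<delta> w) = Suc n" by (rule length_on_pairs[OF \<delta> w])
          have "g ?v ! j = g ?W ! j"
          proof (rule ccontr)
            assume "g ?v ! j \<noteq> g ?W ! j"
            from depends_if_neq[of ?v n ?W g j, OF _ _ this] ll pn obtain d
              where d: "depends n g j d" "?v ! d \<noteq> ?W ! d" by auto
            have "?v ! d = on_pairs \<delta> w ! d" using ll pn I(12)[OF d(1)] by (simp add: nth_delete_at)
            also have "\<dots> = (\<not> e, \<not> e)" using fixed[OF _ fx[OF d(1)] w] depends_less[OF d(1)] by simp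
            finally show False using d(2) depends_less[OF d(1)] by simp
          qed
          also have "g ?W ! j = (\<not> e)"
          proof -
            obtain w0 where w0: "length w0 = n" "g w0 ! j \<noteq> e" using fullD[OF I(2) jm, of e] by blast
            show ?thesis
            proof (cases e)
              case True
              have "g ?W ! j \<le> g w0 ! j"
                by (rule admissible_mono[OF lmapsD(4)[OF gM jm]]) (use w0 True in auto)
              then show ?thesis using w0 True by simp
            next
              case False
              have "g w0 ! j \<le> g ?W ! j"
                by (rule admissible_mono[OF lmapsD(4)[OF gM jm]]) (use w0 False in auto)
              then show ?thesis using w0 False by simp
            qed
          qed
          finally show ?thesis using joins_lastD(3)[OF I(9) ll] by simp
        qed
        show ?thesis by (rule lmarkedI_const[OF b(1) \<delta> jm b(3) q0 const])
      qed
    qed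
  next
    case (II j)
    have gM: "g \<in> lmaps n m" using II(1) by (simp add: nondegenerate_def)
    have jm: "j < m" using II(3) by (simp add: last_nontrivial_def)
    have cj: "admissible (Suc n) (\<lambda>w. G w ! j)" using II(9) by (auto simp: admissible_def)
    have diag: "fst (b, b) = b" for b :: bool by simp
    note b = fill_in_basic[OF gM II(2) jm II(5,6,7) diag II(8) cj]
    have Gj: "G w ! j = join e (fst (w ! p)) (snd (w ! Suc p))" if "length w = Suc n" for w
      using joins_lastD(3)[OF II(9) that] II(11) by simp
    have depp: "depends n g j p"
      by (rule dependsI[OF II(12), of "replicate n (False, False)" _ _ "(True, True)"])
        (use II(13)[of "replicate n (False, False)"] II(13)[of "(replicate n (False, False))[p := (True, True)]"] II(12)
          in simp_all)
    have D: "depends (Suc n) G j (Suc p)" using b(4)[OF depp] by (auto simp: skip_def)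
    \<comment> \<open>Excluded by condition (2) with \<open>j = Suc (Suc p)\<close>: no index lies
      strictly between \<open>Suc p\<close> and \<open>j\<close>.\<close>
    have ne: "(Suc (Suc p), e) \<notin> set W"
    proof
      assume *: "(Suc (Suc p), e) \<in> set W"
      have "\<forall>k. Suc p < k \<and> k < Suc (Suc p) \<longrightarrow> (k, \<not> e) \<in> set W" by auto
      then show False using W(4) * unfolding critical_word_def by blast
    qed
    show ?thesis
    proof (cases "Suc (Suc p) \<in> fst ` set W")
      case True
      then obtain b' where b': "(Suc (Suc p), b') \<in> set W" by auto
      then have "b' = (\<not> e)" using ne by (cases "b' = e") auto
      then have const: "G (on_pairs \<delta> w) ! j = (\<not> e)" if "length w = k" for w
        using Gj[OF length_on_pairs[OF \<delta> that]] fixed[OF _ b' that] II(12) by simp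
      show ?thesis by (rule lmarkedI_const[OF b(1) \<delta> jm b(3) q0 const])
    next
      case False
      obtain q where q: "q < k" "\<And>v. length v = k \<Longrightarrow> \<delta> v ! Suc p = v ! q"
        using free[OF _ False] II(12) by auto
      show ?thesis by (rule lmarkedI2[OF b(1) \<delta> jm b(3) D _ q0 q]) simp
    qed
  qed
qed

text \<open>Among the pairs whose upper cell is missing, take one with least dimension and then
  least \<open>nontriv_count\<close>. Its open box lies in the domain: a face is given at the start,
  degenerate, or a member of an earlier pair. Saturation ensures that the lower cell is missing
  together with the upper one, so that both can be attached by \<open>box_step\<close>.\<close>

lemma extend_full:
  fixes Y :: "'y mcset"
  assumes Y: "comical_set A Y"
    and R0: "partial_map A (lcset m) Y (\<lambda>n w y. w \<in> marked (lcset m) n \<longrightarrow> y \<in> marked Y n) R0"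
    and nonfull: "\<And>n g. g \<in> lmaps n m \<Longrightarrow> \<not> full n m g \<Longrightarrow> (n, g) \<in> pdomain R0"
    and id: "(m, via_fst m (idm m)) \<in> pdomain R0"
    and only: "\<And>n g. (n, g) \<in> pdomain R0 \<Longrightarrow> nondegenerate n m g \<Longrightarrow> full n m g \<Longrightarrow>
      (n, g) = (m, via_fst m (idm m))"
  shows "\<exists>R. R0 \<subseteq> R \<and> partial_map A (lcset m) Y (\<lambda>n w y. w \<in> marked (lcset m) n \<longrightarrow> y \<in> marked Y n) R \<and>
    (\<forall>n. \<forall>g\<in>lmaps n m. (n, g) \<in> pdomain R)"
proof -
  let ?W = "lcset m" and ?Q = "\<lambda>n w y. w \<in> marked (lcset m) n \<longrightarrow> y \<in> marked Y n"
  define U where "U = {((n, g), (Suc n, G)) | n g G. \<exists>p. matched n m g G p}"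
  have mW: "marked_cubical_set A ?W" by (rule marked_lcset)
  have cW: "cubical_set A ?W" by (rule cubical_lcset)
  have cY: "cubical_set A Y" using Y by (simp add: comical_set_def marked_cubical_set_def)
  have nd: "nondegenerate n m g \<longleftrightarrow> g \<in> cubes ?W n \<and> g \<notin> degenerate A ?W n" for n g
    by (simp add: nondegenerate_def)
  \<comment> \<open>The only full nondegenerate cell given at the start is the identity; all its
    coordinates are projections, so it is not a lower cell.\<close>
  have sat0: "saturated U R0"
    unfolding saturated_def U_def
  proof (clarify)
    fix n g G p assume *: "matched n m g G p" "(n, g) \<in> pdomain R0"
    then have g: "nondegenerate n m g" "full n m g" "\<exists>j. last_nontrivial n m g j"
      by (auto simp: matched_def)
    from only[OF *(2) g(1,2)] have "n = m" "g = via_fst m (idm m)" by auto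
    then have "is_proj n (\<lambda>w. g w ! j)" if "j < m" for j using that unfolding is_proj_def
      by (intro exI[of _ j]) simp
    then have False using g(3) unfolding last_nontrivial_def by blast
    then show "(Suc n, G) \<in> pdomain R0" ..
  qed
  have step: "\<exists>R'. R \<subset> R' \<and> partial_map A ?W Y ?Q R' \<and> saturated U R'"
    if R: "R0 \<subseteq> R" "partial_map A ?W Y ?Q R" "saturated U R" and w: "w \<in> cubes ?W n'"
      "w \<notin> degenerate A ?W n'" "(n', w) \<notin> pdomain R"
    for R n' w
  proof -
    have R0R: "(k, F) \<in> pdomain R" if "(k, F) \<in> pdomain R0" for k F using pdomain_mono[OF R(1)] that
      by blast
    \<comment> \<open>A full nondegenerate cell with a nontrivial coordinate is upper or lower at
      the last one; without such a coordinate it is the identity.\<close>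
    have classify: "(k, F) \<in> pdomain R0 \<or> (\<exists>k' g p. k = Suc k' \<and> matched k' m g F p) \<or>
      (\<exists>G p. matched k m F G p)"
      if F: "nondegenerate k m F" for k F
    proof (cases "full k m F")
      case False
      then show ?thesis using nonfull F by (simp add: nondegenerate_def)
    next
      case True
      show ?thesis
      proof (cases "\<exists>j. last_nontrivial k m F j")
        case f: False
        have "is_proj k (\<lambda>w. F w ! i)" if "i < m" for i
        proof (rule ccontr)
          assume nt: "\<not> ?thesis"
          let ?S = "{i. i < m \<and> \<not> is_proj k (\<lambda>w. F w ! i)}"
          have "Max ?S \<in> ?S" using nt that by (intro Max_in) auto
          moreover have "i \<notin> ?S" if "Max ?S < i" for i
          proof
            assume "i \<in> ?S"
            then have "i \<le> Max ?S" by (intro Max_ge) auto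
            then show False using that by simp
          qed
          ultimately have "last_nontrivial k m F (Max ?S)" unfolding last_nontrivial_def by blast
          then show False using f by blast
        qed
        from all_is_proj[OF F True this] show ?thesis using id by auto
      next
        case t: True
        then obtain j where j: "last_nontrivial k m F j" by blast
        show ?thesis
          using upper_matched[OF F True j] lower_matched[OF F True j] by blast
      qed
    qed
    have face_dom: "(k, g) \<in> pdomain R" if "matched k m g G p" "(Suc k, G) \<in> pdomain R" for k g G p
      using pdomain_act[OF R(2) that(2) face_hom[OF matched_upper(3)[OF that(1)], of e]] matched_upper(4)[OF that(1)] by simp
    define P where "P = {(n, c). \<exists>g G p. matched n m g G p \<and> (Suc n, G) \<notin> pdomain R \<and>
      c = nontriv_count n m g}"
    have "P \<noteq> {}"
    proof -
      have "nondegenerate n' m w" using w nd by blast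
      from classify[OF this] w(3) R0R obtain k g G p where "matched k m g G p" "(Suc k, G) \<notin> pdomain R"
        using face_dom by blast
      then show ?thesis unfolding P_def by blast
    qed
    then obtain n c where nc: "(n, c) \<in> P" and min: "\<And>n' c'. (n', c') \<in> P \<Longrightarrow> \<not> (n' < n \<or> (n' = n \<and>
      c' < c))"
    proof -
      have wf: "wf (less_than <*lex*> less_than)" by (intro wf_lex_prod wf_less_than)
      obtain z where z: "z \<in> P" "\<And>y. (y, z) \<in> less_than <*lex*> less_than \<Longrightarrow> y \<notin> P"
        using wfE_min'[OF wf \<open>P \<noteq> {}\<close>] by blast
      obtain a b where ab: "z = (a, b)" by (cases z)
      show thesis
      proof (rule that)
        show "(a, b) \<in> P" using z(1) ab by simp
        show "\<not> (n' < a \<or> (n' = a \<and> c' < b))" if "(n', c') \<in> P" for n' c'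
          using z(2)[of "(n', c')"] that ab by auto
      qed
    qed
    then obtain g G p where matched: "matched n m g G p" and G: "(Suc n, G) \<notin> pdomain R"
      and c: "c = nontriv_count n m g"
      unfolding P_def by blast
    have minD: "(Suc k, G') \<in> pdomain R" if "matched k m g' G' p'" "k < n \<or> (k = n \<and>
      nontriv_count n m g' < nontriv_count n m g)" for k g' G' p'
    proof (rule ccontr)
      assume "(Suc k, G') \<notin> pdomain R"
      then have "(k, nontriv_count k m g') \<in> P" unfolding P_def using that(1) by blast
      then show False using min[of k "nontriv_count k m g'"] that(2) c by auto
    qed
    have small_nd: "(k, F) \<in> pdomain R" if F: "nondegenerate k m F" "k < n" for k F
      using classify[OF F(1)]
    proof (elim disjE exE conjE)
      show "(k, F) \<in> pdomain R" if "(k, F) \<in> pdomain R0" using R0R[OF that] .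
      show "(k, F) \<in> pdomain R" if "k = Suc k'" "matched k' m g' F p'" for k' g' p'
        using minD[OF that(2)] that(1) F(2) by simp
      show "(k, F) \<in> pdomain R" if "matched k m F G' p'" for G' p'
        using face_dom[OF that minD[OF that]] F(2) by blast
    qed
    have deg: "(k, F) \<in> pdomain R"
      if deg: "F \<in> degenerate A ?W k" and IH: "\<And>k' F'. k = Suc k' \<Longrightarrow> F' \<in> lmaps k' m \<Longrightarrow>
        (k', F') \<in> pdomain R" for k F
      using deg
    proof (cases rule: degenerateE)
      case (1 k' r y)
      have "(k', y) \<in> pdomain R" using IH[OF 1(1)] 1(3) by simp
      from pdomain_act[OF R(2) this degen_hom[OF 1(2)]] show ?thesis using 1 by simp
    next
      case (2 k' r y b)
      have "(k', y) \<in> pdomain R" using IH[OF 2(1)] 2(4) by simp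
      from pdomain_act[OF R(2) this conn_hom[OF 2(3,2)]] show ?thesis using 2 by simp
    qed
    have small: "(k, F) \<in> pdomain R" if "F \<in> lmaps k m" "k < n" for k F
      using that
    proof (induction k arbitrary: F)
      case 0
      then show ?case using small_nd[of 0 F] deg[of F 0] by (auto simp: nondegenerate_def)
    next
      case (Suc k)
      then show ?case using small_nd[of "Suc k" F] deg[of F "Suc k"] by (auto simp: nondegenerate_def)
    qed
    note prG = matched_upper[OF matched]
    have gnd: "nondegenerate n m g" using matched by (simp add: matched_def)
    have gdom: "(n, g) \<notin> pdomain R"
    proof
      assume "(n, g) \<in> pdomain R"
      moreover have "((n, g), (Suc n, G)) \<in> U" unfolding U_def using matched by blast
      ultimately have "(Suc n, G) \<in> pdomain R" using R(3) unfolding saturated_def by fast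
      then show False using G by blast
    qed
    have others: "(n, act ?W n (Suc n) (face (Suc n) (Suc q) b) G) \<in> pdomain R" if q: "q \<le> n"
      "(q, b) \<noteq> (p, e)" for q b
    proof -
      let ?F = "precomp n (face (Suc n) (Suc q) b) G"
      have FM: "?F \<in> lmaps n m" using prG(1) q(1)
        by (intro precomp_face_lmaps) (simp_all add: nondegenerate_def)
      have "(n, ?F) \<in> pdomain R"
      proof (cases "nondegenerate n m ?F")
        case False
        then have "?F \<in> degenerate A ?W n" using FM by (simp add: nondegenerate_def)
        then show ?thesis by (rule deg) (use small in auto)
      next
        case t: True
        show ?thesis
        proof (cases "full n m ?F")
          case False
          then show ?thesis using R0R nonfull FM by blast
        next
          case True
          have "(\<exists>j. last_nontrivial n m ?F j \<and> upper n ?F j) \<or>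
            nontriv_count n m ?F < nontriv_count n m g"
            by (rule matched_faces[OF matched q t True])
          then show ?thesis
          proof
            assume "\<exists>j. last_nontrivial n m ?F j \<and> upper n ?F j"
            then obtain k g' p' where k: "n = Suc k" "matched k m g' ?F p'"
              using upper_matched[OF t True] by blast
            then show ?thesis using minD[OF k(2)] k(1) by simp
          next
            assume less: "nontriv_count n m ?F < nontriv_count n m g"
            from classify[OF t] show ?thesis
            proof (elim disjE exE conjE)
              show ?thesis if "(n, ?F) \<in> pdomain R0" using R0R[OF that] .
              show ?thesis if "n = Suc k'" "matched k' m g' ?F p'" for k' g' p'
                using minD[OF that(2)] that(1) by simp
              show ?thesis if "matched n m ?F G' p'" for G' p'
                using face_dom[OF that minD[OF that]] less by blast
            qed
          qed
        qed
      qed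
      then show ?thesis by simp
    qed
    have G_nd: "G \<in> cubes ?W (Suc n)" "G \<notin> degenerate A ?W (Suc n)" using prG(1) nd by blast+
    have g_nd: "g \<notin> degenerate A ?W n" using gnd nd by blast
    have gf: "g = act ?W n (Suc n) (face (Suc n) (Suc p) e) G" using prG(4) by simp
    have crit: "act ?W k (Suc n) \<delta> G \<in> marked ?W k" if "\<delta> \<in> critical_faces (Suc n) (Suc p) e k" for k \<delta>
      using matched_critical[OF matched that] by simp
    have lmarked: "n \<ge> 1 \<and> (\<forall>q\<le>n. \<forall>b. (q, b) \<noteq> (p, e) \<longrightarrow>
      act ?W n (Suc n) (face (Suc n) (Suc q) b) G \<in> marked ?W n)"
      if "g \<in> marked ?W n" using matched_marked_faces[OF matched] that by simp
    obtain R' where R': "R \<subset> R'" "partial_map A ?W Y ?Q R'" "(Suc n, G) \<in> pdomain R'"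
      "\<And>k w. (k, w) \<in> pdomain R' \<Longrightarrow> w \<notin> degenerate A ?W k \<Longrightarrow> (k, w) \<in> pdomain R \<or> (k, w) = (n, g) \<or>
        (k, w) = (Suc n, G)"
      using box_step[OF A_subset Y mW R(2) prG(3) G_nd gf g_nd gdom others crit lmarked] by blast
    \<comment> \<open>The new nondegenerate cells are \<open>g\<close>, whose partner
      \<open>G\<close> has been added as well, and \<open>G\<close>, which is not lower.\<close>
    have "saturated U R'"
      unfolding saturated_def U_def
    proof (clarify)
      fix k g' G' p' assume *: "matched k m g' G' p'" "(k, g') \<in> pdomain R'"
      have nd': "g' \<notin> degenerate A ?W k" using *(1) nd unfolding matched_def by blast
      have "((k, g'), (Suc k, G')) \<in> U" unfolding U_def using *(1) by blast
      then have 1: "(Suc k, G') \<in> pdomain R" if "(k, g') \<in> pdomain R" using R(3) that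
        unfolding saturated_def by fast
      from R'(4)[OF *(2) nd'] show "(Suc k, G') \<in> pdomain R'"
      proof (elim disjE)
        assume "(k, g') \<in> pdomain R"
        then show ?thesis using 1 pdomain_mono[of R R'] R'(1) by blast
      next
        assume "(k, g') = (n, g)"
        then show ?thesis using matched_unique[OF matched, of G' p'] *(1) R'(3) by simp
      next
        assume "(k, g') = (Suc n, G)"
        then show ?thesis using matched_not_lower[OF matched] *(1) by simp
      qed
    qed
    then show ?thesis using R'(1,2) by blast
  qed
  from partial_map_total[OF cW cY R0 sat0 step] show ?thesis by simp
qed

section \<open>Gluing over the cells of the domain\<close>

lemma postcomp_precomp: "\<psi> \<in> box_hom A k n \<Longrightarrow>
  postcomp k \<alpha> (precomp k \<psi> g) = precomp k \<psi> (postcomp n \<alpha> g)"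
  by (rule pair_cube_ext[of _ k]) (auto simp: length_on_pairs, simp_all add: postcomp_def precomp_def)

lemma postcomp_compose: "g \<in> lmaps n k \<Longrightarrow>
  postcomp n (compose (cube k) \<phi> \<psi>) g = postcomp n \<phi> (postcomp n \<psi> g)"
  by (rule pair_cube_ext[of _ n]) (auto simp: lmapsD(2), simp_all add: postcomp_def)

lemma postcomp_idm: "g \<in> lmaps n m \<Longrightarrow> postcomp n (idm m) g = g"
  by (rule pair_cube_ext[of _ n]) (auto simp: lmapsD(1,2), simp add: postcomp_def)

lemma postcomp_via_fst: "\<phi> \<in> box_hom B n k \<Longrightarrow>
  postcomp n \<alpha> (via_fst n \<phi>) = via_fst n (compose (cube n) \<alpha> \<phi>)"
  by (rule pair_cube_ext[of _ n]) (auto, simp_all add: postcomp_def via_fst_def)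

lemma precomp_via_fst: "\<psi> \<in> box_hom A k n \<Longrightarrow>
  precomp k \<psi> (via_fst n \<phi>) = via_fst k (compose (cube k) \<phi> \<psi>)"
  by (rule pair_cube_ext[of _ k])
    (auto simp: length_on_pairs, simp_all add: precomp_def via_fst_def, simp add: on_pairs_def box_hom_length)

text \<open>The variable \<open>q\<close> that reappears in no coordinate of \<open>g\<close> also
  witnesses the marking of the composite. Only a connection could create it as a coordinate; since
  at most one of the two merged coordinates depends on \<open>q\<close>, the other would be constant
  and the first would have been \<open>q\<close> before.\<close>

lemma lmarked_postcomp:
  assumes "\<alpha> \<in> box_hom A m m'" "g \<in> lmarked n m" shows "postcomp n \<alpha> g \<in> lmarked n m'"
  using assms
proof (induction arbitrary: g rule: box_hom_induct)
  case (idm m)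
  then show ?case using postcomp_idm[of g n m] by (simp add: lmarked_def)
next
  case (face m p \<eta>)
  then obtain q where g: "g \<in> lmaps n m" and q: "q < n"
    "\<And>i \<pi>. i < m \<Longrightarrow> \<pi> = fst \<or> \<pi> = snd \<Longrightarrow> \<not> (\<forall>w. length w = n \<longrightarrow> g w ! i = \<pi> (w ! q))"
    unfolding lmarked_def by blast
  have "\<not> (\<forall>w. length w = n \<longrightarrow> postcomp n (face (Suc m) (Suc p) \<eta>) g w ! i = \<pi> (w ! q))"
    if i: "i < Suc m" and \<pi>: "\<pi> = fst \<or> \<pi> = snd" for i \<pi>
  proof
    assume *: "\<forall>w. length w = n \<longrightarrow> postcomp n (face (Suc m) (Suc p) \<eta>) g w ! i = \<pi> (w ! q)"
    have eq: "(if i < p then g w ! i else if i = p then \<eta> else g w ! (i - 1)) = \<pi> (w ! q)"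
      if "length w = n" for w
      using *[rule_format, OF that] lmapsD(2)[OF g that] that i face(1) by (simp add: nth_insert_at)
    consider "i < p" | "i = p" | "p < i" by linarith
    then show False
    proof cases
      case 1
      then show ?thesis using q(2)[OF _ \<pi>, of i] eq face(1) by auto
    next
      case 2
      then show ?thesis using eq[of "replicate n (\<not> \<eta>, \<not> \<eta>)"] q(1) \<pi> by auto
    next
      case 3
      then have "i - 1 < m" using i by simp
      then show ?thesis using q(2)[OF _ \<pi>, of "i - 1"] eq 3 by auto
    qed
  qed
  then show ?case unfolding lmarked_def using postcomp_lmaps[OF face_hom[OF face(1)] g] q(1) by blast
next
  case (degen m p)
  then obtain q where g: "g \<in> lmaps n (Suc m)" and q: "q < n"
    "\<And>i \<pi>. i < Suc m \<Longrightarrow> \<pi> = fst \<or> \<pi> = snd \<Longrightarrow> \<not> (\<forall>w. length w = n \<longrightarrow> g w ! i = \<pi> (w ! q))"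
    unfolding lmarked_def by blast
  have "\<not> (\<forall>w. length w = n \<longrightarrow> postcomp n (degen (Suc m) (Suc p)) g w ! i = \<pi> (w ! q))"
    if i: "i < m" and \<pi>: "\<pi> = fst \<or> \<pi> = snd" for i \<pi>
  proof
    assume *: "\<forall>w. length w = n \<longrightarrow> postcomp n (degen (Suc m) (Suc p)) g w ! i = \<pi> (w ! q)"
    have "g w ! (if i < p then i else Suc i) = \<pi> (w ! q)" if "length w = n" for w
      using *[rule_format, OF that] lmapsD(2)[OF g that] that i degen(1)
        by (auto simp: nth_delete_at split: if_splits)
    then show False
      using q(2)[OF _ \<pi>, of i] q(2)[OF _ \<pi>, of "Suc i"] i by (cases "i < p") auto
  qed
  then show ?case unfolding lmarked_def using postcomp_lmaps[OF degen_hom[OF degen(1)] g] q(1) by blast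
next
  case (conn m p b)
  then obtain q where g: "g \<in> lmaps n (Suc m)" and q: "q < n"
    "\<And>i \<pi>. i < Suc m \<Longrightarrow> \<pi> = fst \<or> \<pi> = snd \<Longrightarrow> \<not> (\<forall>w. length w = n \<longrightarrow> g w ! i = \<pi> (w ! q))"
    unfolding lmarked_def by blast
  have "\<not> (\<forall>w. length w = n \<longrightarrow> postcomp n (conn (Suc m) (Suc p) b) g w ! i = \<pi> (w ! q))"
    if i: "i < m" and \<pi>: "\<pi> = fst \<or> \<pi> = snd" for i \<pi>
  proof
    assume *: "\<forall>w. length w = n \<longrightarrow> postcomp n (conn (Suc m) (Suc p) b) g w ! i = \<pi> (w ! q)"
    have eq: "(if i < p then g w ! i else
      if i = p then join b (g w ! p) (g w ! Suc p) else g w ! Suc i) = \<pi> (w ! q)"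
      if "length w = n" for w
      using *[rule_format, OF that] lmapsD(2)[OF g that] that i conn(2) by (simp add: nth_merge_at)
    consider "i < p" | "i = p" | "p < i" by linarith
    then show False
    proof cases
      case 1
      then show ?thesis using q(2)[OF _ \<pi>, of i] eq i by auto
    next
      case 3
      then show ?thesis using q(2)[OF _ \<pi>, of "Suc i"] eq i by auto
    next
      case 2
      have J: "join b (g w ! p) (g w ! Suc p) = \<pi> (w ! q)" if "length w = n" for w
        using eq[OF that] 2 by simp
      \<comment> \<open>Giving the variable \<open>q\<close> the neutral value \<open>b\<close>
        makes the join equal to \<open>b\<close>, hence both merged coordinates; one that ignores
        \<open>q\<close> is therefore constantly \<open>b\<close>.\<close>
      have const: "g w ! r = b" if r: "r = p \<or> r = Suc p" and nd: "\<not> depends n g r q"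
        and w: "length w = n" for r w
      proof (rule ccontr)
        assume "g w ! r \<noteq> b"
        let ?w = "w[q := (b, b)]"
        have "g ?w ! r = g w ! r" using nd w q(1) unfolding depends_def by blast
        then have "join b (g ?w ! p) (g ?w ! Suc p) \<noteq> b" using r \<open>g w ! r \<noteq> b\<close> by (auto simp: join_def)
        moreover have "\<pi> (?w ! q) = b" using w q(1) \<pi> by auto
        ultimately show False using J[of ?w] w by simp
      qed
      have "\<not> depends n g p q \<or> \<not> depends n g (Suc p) q"
        using ordered_depends_unique[OF lmapsD(3)[OF g], of p "Suc p" q] conn(2) by auto
      then show ?thesis
      proof
        assume "\<not> depends n g p q"
        then have "g w ! Suc p = \<pi> (w ! q)" if "length w = n" for w
          using const[of p w] J[OF that] that by simp
        then show False using q(2)[OF _ \<pi>, of "Suc p"] conn(2) by simp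
      next
        assume "\<not> depends n g (Suc p) q"
        then have "g w ! p = \<pi> (w ! q)" if "length w = n" for w
          using const[of "Suc p" w] J[OF that] that by simp
        then show False using q(2)[OF _ \<pi>, of p] conn(2) by simp
      qed
    qed
  qed
  then show ?case unfolding lmarked_def using postcomp_lmaps[OF conn_hom[OF conn(1,2)] g] q(1) by blast
next
  case (comp k m m' \<psi> \<phi>)
  have "g \<in> lmaps n k" using comp(5) by (simp add: lmarked_def)
  then show ?case using comp(4)[OF comp(3)[OF comp(5)]] postcomp_compose by simp
qed

text \<open>An \<open>m\<close>-cube is a natural family of values at all labelled maps into \<open>[1]\<^sup>m\<close>; a weak connection structure
  on \<open>f\<close> is a lift of \<open>f\<close> along evaluation at the identity.\<close>

definition hom_cset :: "'y mcset \<Rightarrow> (nat \<Rightarrow> lmap \<Rightarrow> 'y) cset" where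
  "hom_cset Y = \<lparr>cubes = \<lambda>m. {H. (\<forall>n. \<forall>g\<in>lmaps n m. H n g \<in> cubes Y n) \<and>
      (\<forall>k n. \<forall>\<psi>\<in>box_hom A k n. \<forall>g\<in>lmaps n m. H k (precomp k \<psi> g) = act Y k n \<psi> (H n g)) \<and>
      (\<forall>n. \<forall>g\<in>lmarked n m. H n g \<in> marked Y n) \<and> (\<forall>n g. g \<notin> lmaps n m \<longrightarrow> H n g = undefined)},
    act = \<lambda>m' m \<alpha> H n g. if g \<in> lmaps n m' then H n (postcomp n \<alpha> g) else undefined\<rparr>"

lemma hom_csetD:
  assumes "H \<in> cubes (hom_cset Y) m"
  shows "g \<in> lmaps n m \<Longrightarrow> H n g \<in> cubes Y n"
    and "\<psi> \<in> box_hom A k n \<Longrightarrow> g \<in> lmaps n m \<Longrightarrow> H k (precomp k \<psi> g) = act Y k n \<psi> (H n g)"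
    and "g \<in> lmarked n m \<Longrightarrow> H n g \<in> marked Y n" "g \<notin> lmaps n m \<Longrightarrow> H n g = undefined"
  using assms by (auto simp: hom_cset_def)

lemma hom_csetI:
  assumes "\<And>n g. g \<in> lmaps n m \<Longrightarrow> H n g \<in> cubes Y n"
    and "\<And>k n \<psi> g. \<psi> \<in> box_hom A k n \<Longrightarrow> g \<in> lmaps n m \<Longrightarrow> H k (precomp k \<psi> g) = act Y k n \<psi> (H n g)"
    and "\<And>n g. g \<in> lmarked n m \<Longrightarrow> H n g \<in> marked Y n" "\<And>n g. g \<notin> lmaps n m \<Longrightarrow> H n g = undefined"
  shows "H \<in> cubes (hom_cset Y) m"
  using assms by (simp add: hom_cset_def)

lemma act_hom_cset: "g \<in> lmaps n m' \<Longrightarrow> act (hom_cset Y) m' m \<alpha> H n g = H n (postcomp n \<alpha> g)"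
  and act_hom_cset_undefined: "g \<notin> lmaps n m' \<Longrightarrow> act (hom_cset Y) m' m \<alpha> H n g = undefined"
  by (simp_all add: hom_cset_def)

lemma cubical_hom_cset: "cubical_set A (hom_cset Y)"
  unfolding cubical_set_def
proof (intro conjI allI ballI)
  show "act (hom_cset Y) m' m \<alpha> \<in> cubes (hom_cset Y) m \<rightarrow> cubes (hom_cset Y) m'"
    if \<alpha>: "\<alpha> \<in> box_hom A m' m" for m' m \<alpha>
  proof
    fix H assume H: "H \<in> cubes (hom_cset Y) m"
    show "act (hom_cset Y) m' m \<alpha> H \<in> cubes (hom_cset Y) m'"
    proof (rule hom_csetI)
      show "act (hom_cset Y) m' m \<alpha> H n g \<in> cubes Y n" if "g \<in> lmaps n m'" for n g
        using hom_csetD(1)[OF H postcomp_lmaps[OF \<alpha> that]] act_hom_cset[where Y=Y, OF that] by simp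
      show "act (hom_cset Y) m' m \<alpha> H k (precomp k \<psi> g) = act Y k n \<psi> (act (hom_cset Y) m' m \<alpha> H n g)"
        if "\<psi> \<in> box_hom A k n" "g \<in> lmaps n m'" for k n \<psi> g
        using hom_csetD(2)[OF H that(1) postcomp_lmaps[OF \<alpha> that(2)]] act_hom_cset[where Y=Y, OF that(2)] act_hom_cset[where Y=Y, OF precomp_lmaps[OF that]]
          postcomp_precomp[OF that(1)] by simp
      show "act (hom_cset Y) m' m \<alpha> H n g \<in> marked Y n" if "g \<in> lmarked n m'" for n g
        using hom_csetD(3)[OF H lmarked_postcomp[OF \<alpha> that]] act_hom_cset[of g n m' Y] that
          by (simp add: lmarked_def)
    qed (rule act_hom_cset_undefined)
  qed
  show "act (hom_cset Y) m m (idm m) H = H" if H: "H \<in> cubes (hom_cset Y) m" for m H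
  proof (intro ext)
    show "act (hom_cset Y) m m (idm m) H n g = H n g" for n g
      using act_hom_cset[of g n m Y] act_hom_cset_undefined[of g n m Y] postcomp_idm[of g n m] hom_csetD(4)[OF H] by (cases "g \<in> lmaps n m") simp_all
  qed
  show "act (hom_cset Y) k m (compose (cube k) \<phi> \<psi>) H = act (hom_cset Y) k l \<psi> (act (hom_cset Y) l m \<phi> H)"
    if "\<psi> \<in> box_hom A k l" "\<phi> \<in> box_hom A l m" "H \<in> cubes (hom_cset Y) m" for k l m \<psi> \<phi> H
  proof (intro ext)
    show "act (hom_cset Y) k m (compose (cube k) \<phi> \<psi>) H n g = act (hom_cset Y) k l \<psi> (act (hom_cset Y) l m \<phi> H) n g" for n g
      using act_hom_cset[of g n k Y] act_hom_cset_undefined[of g n k Y] act_hom_cset[of "postcomp n \<psi> g" n l Y] postcomp_lmaps[OF that(1)] postcomp_compose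
      by (cases "g \<in> lmaps n k") simp_all
  qed
qed

text \<open>The identity has to stay unmarked because its value will be \<open>f m x\<close>, which
  may be any cube of \<open>Y\<close>. It follows that the identity is nondegenerate.\<close>

lemma via_fst_id_not_lmarked: "via_fst m (idm m) \<notin> lmarked m m"
proof
  assume "via_fst m (idm m) \<in> lmarked m m"
  then obtain q where "q < m" "\<not> (\<forall>w. length w = m \<longrightarrow> via_fst m (idm m) w ! q = fst (w ! q))"
    unfolding lmarked_def by blast
  then show False by auto
qed

section \<open>Extension over one cell of the domain\<close>

lemma insert_at_insert_at: "p < p' \<Longrightarrow> p' \<le> Suc n \<Longrightarrow> length v = n \<Longrightarrow>
  insert_at p \<eta> (insert_at (p' - 1) \<eta>' v) = insert_at p' \<eta>' (insert_at p \<eta> v)"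
  for v :: "bool list"
  by (rule nth_equalityI) (auto simp: nth_insert_at)

lemma delete_at_delete_at: "p < p' \<Longrightarrow> p' \<le> Suc n \<Longrightarrow> length v = Suc (Suc n) \<Longrightarrow>
  delete_at (p' - 1) (delete_at p v) = delete_at p (delete_at p' v)"
  for v :: "bool list"
  by (rule nth_equalityI) (auto simp: nth_delete_at)

lemma postcomp_face_degen:
  assumes "g \<in> lmaps n (Suc m)" "p \<le> m" "\<And>w. length w = n \<Longrightarrow> g w ! p = \<eta>"
  shows "postcomp n (face (Suc m) (Suc p) \<eta>) (postcomp n (degen (Suc m) (Suc p)) g) = g"
proof (rule pair_cube_ext[OF _ lmapsD(1)[OF assms(1)]])
  show "postcomp n (face (Suc m) (Suc p) \<eta>) (postcomp n (degen (Suc m) (Suc p)) g) \<in> extensional (pair_cube n)"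
    by (simp add: postcomp_def)
  show "postcomp n (face (Suc m) (Suc p) \<eta>) (postcomp n (degen (Suc m) (Suc p)) g) w = g w"
    if "length w = n" for w
    using insert_at_delete_at[of p "g w"] assms(2,3) that lmapsD(2)[OF assms(1) that] by simp
qed

lemma postcomp_degen_face:
  assumes "g \<in> lmaps n m" "p \<le> m"
  shows "postcomp n (degen (Suc m) (Suc p)) (postcomp n (face (Suc m) (Suc p) \<eta>) g) = g"
proof (rule pair_cube_ext[OF _ lmapsD(1)[OF assms(1)]])
  show "postcomp n (degen (Suc m) (Suc p)) (postcomp n (face (Suc m) (Suc p) \<eta>) g) \<in> extensional (pair_cube n)"
    by (simp add: postcomp_def)
  show "postcomp n (degen (Suc m) (Suc p)) (postcomp n (face (Suc m) (Suc p) \<eta>) g) w = g w"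
    if "length w = n" for w
    using delete_at_insert_at[of p "g w" \<eta>] assms(2) that lmapsD(2)[OF assms(1) that] by simp
qed

text \<open>The faces of \<open>x\<close> force the values at maps with a constant coordinate and
  \<open>f\<close> forces the value at the identity; \<open>extend_full\<close> supplies the rest.
  The last clause says that the new cube of \<open>hom_cset Y\<close> has the boundary prescribed by
  \<open>R\<close>.\<close>

lemma boundary_extension:
  fixes X :: "'x mcset" and Y :: "'y mcset"
  assumes X: "marked_cubical_set A X" and Y: "comical_set A Y" and f: "marked_map A X Y f"
    and R: "partial_map A X (hom_cset Y) (\<lambda>k x H. H k (via_fst k (idm k)) = f k x) R"
    and x: "x \<in> cubes X m"
    and faces: "\<And>n p \<eta>. m = Suc n \<Longrightarrow> p \<le> n \<Longrightarrow> (n, act X n m (face m (Suc p) \<eta>) x) \<in> pdomain R"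
  shows "\<exists>H\<in>cubes (hom_cset Y) m. H m (via_fst m (idm m)) = f m x \<and>
    (\<forall>n p \<eta>. m = Suc n \<longrightarrow> p \<le> n \<longrightarrow>
      (n, act X n m (face m (Suc p) \<eta>) x, act (hom_cset Y) n m (face m (Suc p) \<eta>) H) \<in> R)"
proof -
  let ?Q = "\<lambda>n w y. w \<in> marked (lcset m) n \<longrightarrow> y \<in> marked Y n"
  have cX: "cubical_set A X" using X by (simp add: marked_cubical_set_def)
  have cY: "cubical_set A Y" and dY: "\<And>n. degenerate A Y n \<subseteq> marked Y n"
    using Y by (auto simp: comical_set_def marked_cubical_set_def)
  have fn: "f k (act X k n \<psi> y) = act Y k n \<psi> (f n y)" if "\<psi> \<in> box_hom A k n" "y \<in> cubes X n"
    for k n \<psi> y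
    using f that unfolding marked_map_def by blast
  have fc: "f n y \<in> cubes Y n" if "y \<in> cubes X n" for n y using f that unfolding marked_map_def by blast
  define bd where "bd p \<eta> = act X (m - 1) m (face m (Suc p) \<eta>) x" for p \<eta>
  define v where "v p \<eta> = (SOME H. (m - 1, bd p \<eta>, H) \<in> R)" for p \<eta>
  have vR: "(n, bd p \<eta>, v p \<eta>) \<in> R" if "m = Suc n" "p \<le> n" for n p \<eta>
    using faces[OF that, of \<eta>] that(1) someI_ex[of "\<lambda>H. (n, bd p \<eta>, H) \<in> R"]
    by (simp add: v_def bd_def pdomain_def)
  note v = partial_mapD[OF R vR]
  \<comment> \<open>At a map whose coordinate \<open>p\<close> is constantly \<eta>, the family of
    the face \<open>bd p \<eta>\<close> of \<open>x\<close> is evaluated after deleting that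
    coordinate.\<close>
  define R0 where "R0 = {(n, g, v p \<eta> n (postcomp n (degen m (Suc p)) g)) | n g p \<eta>.
     g \<in> lmaps n m \<and> p < m \<and> (\<forall>w. length w = n \<longrightarrow> g w ! p = \<eta>)}"
  have R0D: "\<exists>p \<eta> m'. m = Suc m' \<and> p \<le> m' \<and> y = v p \<eta> n (postcomp n (degen (Suc m') (Suc p)) g) \<and>
    g \<in> lmaps n (Suc m') \<and>
      (\<forall>w. length w = n \<longrightarrow> g w ! p = \<eta>)" if h: "(n, g, y) \<in> R0" for n g y
  proof -
    obtain p \<eta> where *: "g \<in> lmaps n m" "p < m" "\<forall>w. length w = n \<longrightarrow> g w ! p = \<eta>"
      "y = v p \<eta> n (postcomp n (degen m (Suc p)) g)"
      using h unfolding R0_def by blast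
    then show ?thesis by (intro exI[of _ p] exI[of _ \<eta>] exI[of _ "m - 1"]) auto
  qed
  have R0I: "(n, g, v p \<eta> n (postcomp n (degen (Suc m') (Suc p)) g)) \<in> R0"
    if "m = Suc m'" "p \<le> m'" "g \<in> lmaps n (Suc m')" "\<And>w. length w = n \<Longrightarrow> g w ! p = \<eta>" for n g p \<eta> m'
    unfolding R0_def using that by (intro CollectI exI conjI) auto
  \<comment> \<open>Two constant coordinates lead to the same value: both families restrict to the
    one over the common face of codimension two, by the cubical identities and functionality of
    \<open>R\<close>.\<close>
  have key: "v p \<eta> n (postcomp n (degen (Suc m') (Suc p)) g) = v p' \<eta>' n (postcomp n (degen (Suc m') (Suc p')) g)"
    if m: "m = Suc m'" and p: "p < p'" "p' \<le> m'" and g: "g \<in> lmaps n (Suc m')"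
      and c: "\<And>w. length w = n \<Longrightarrow> g w ! p = \<eta>" "\<And>w. length w = n \<Longrightarrow> g w ! p' = \<eta>'" for m' n g p p' \<eta> \<eta>'
  proof -
    obtain l where l: "m' = Suc l" using p by (cases m') auto
    have pl: "p \<le> l" "p \<le> Suc l" "p' - 1 \<le> l" "p' \<le> Suc l" "p' \<le> Suc l" using p l by auto
    let ?F = "\<lambda>p \<eta>. face (Suc m') (Suc p) \<eta>" and ?f = "\<lambda>p \<eta>. face (Suc l) (Suc p) \<eta>"
    let ?D = "\<lambda>p. degen (Suc m') (Suc p)" and ?d = "\<lambda>p. degen (Suc l) (Suc p)"
    have hF: "?F p \<eta> \<in> box_hom A (Suc l) m" "?F p' \<eta>' \<in> box_hom A (Suc l) m"
      using face_hom[of p m'] face_hom[of p' m'] pl l m by simp_all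
    have hf: "?f p \<eta> \<in> box_hom A l (Suc l)" "?f (p' - 1) \<eta>' \<in> box_hom A l (Suc l)"
      using face_hom pl by simp_all
    have hD: "postcomp n (?D p) g \<in> lmaps n (Suc l)" "postcomp n (?D p') g \<in> lmaps n (Suc l)"
      using postcomp_lmaps[OF degen_hom g] p l by simp_all
    have hd: "postcomp n (?d p) (postcomp n (?D p') g) \<in> lmaps n l"
      "postcomp n (?d (p' - 1)) (postcomp n (?D p) g) \<in> lmaps n l"
      using postcomp_lmaps[OF degen_hom hD(2)] postcomp_lmaps[OF degen_hom hD(1)] pl by simp_all
    \<comment> \<open>Deleting \<open>p\<close> shifts the later coordinate \<open>p'\<close> to
      \<open>p' - 1\<close>, whereas deleting \<open>p'\<close> leaves \<open>p\<close> in
      place.\<close>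
    have c1: "postcomp n (?D p) g w ! (p' - 1) = \<eta>'" "postcomp n (?D p') g w ! p = \<eta>"
      if w: "length w = n" for w
      using c[OF w] lmapsD(2)[OF g w] w p l by (auto simp: nth_delete_at)
    have 1: "v p \<eta> n (postcomp n (?D p) g) = act (hom_cset Y) l (Suc l) (?f (p' - 1) \<eta>') (v p \<eta>) n (postcomp n (?d (p' - 1)) (postcomp n (?D p) g))"
      using act_hom_cset[where Y=Y, OF hd(2)] postcomp_face_degen[OF hD(1) pl(3) c1(1)] by simp
    have 2: "v p' \<eta>' n (postcomp n (?D p') g) = act (hom_cset Y) l (Suc l) (?f p \<eta>) (v p' \<eta>') n (postcomp n (?d p) (postcomp n (?D p') g))"
      using act_hom_cset[where Y=Y, OF hd(1)] postcomp_face_degen[OF hD(2) pl(1) c1(2)] by simp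
    have 3: "postcomp n (?d (p' - 1)) (postcomp n (?D p) g) = postcomp n (?d p) (postcomp n (?D p') g)"
    proof (rule pair_cube_ext[of _ n])
      show "postcomp n (?d (p' - 1)) (postcomp n (?D p) g) w = postcomp n (?d p) (postcomp n (?D p') g) w" if "length w = n" for w
        using delete_at_delete_at[OF p(1), of l "g w"] lmapsD(2)[OF g that] that pl l by simp
    qed (simp_all add: postcomp_def)
    have 4: "act X l (Suc l) (?f (p' - 1) \<eta>') (bd p \<eta>) = act X l (Suc l) (?f p \<eta>) (bd p' \<eta>')"
    proof -
      have "compose (cube l) (?F p \<eta>) (?f (p' - 1) \<eta>') = compose (cube l) (?F p' \<eta>') (?f p \<eta>)"
        by (rule box_hom_ext[OF compose_in_hom[OF hf(2) hF(1)] compose_in_hom[OF hf(1) hF(2)]])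
          (use insert_at_insert_at[OF p(1), of l] pl l in simp)
      then show ?thesis
        using cubical_comp[OF cX hf(2) hF(1) x] cubical_comp[OF cX hf(1) hF(2) x] m l
          by (simp add: bd_def)
    qed
    have ml: "m = Suc (Suc l)" "p \<le> Suc l" using m l pl by auto
    have "(l, act X l (Suc l) (?f (p' - 1) \<eta>') (bd p \<eta>), act (hom_cset Y) l (Suc l) (?f (p' - 1) \<eta>') (v p \<eta>)) \<in> R"
      by (rule v(4)[OF ml hf(2)])
    moreover have "(l, act X l (Suc l) (?f p \<eta>) (bd p' \<eta>'), act (hom_cset Y) l (Suc l) (?f p \<eta>) (v p' \<eta>')) \<in> R"
      by (rule v(4)[OF ml(1) pl(4) hf(1)])
    ultimately have "act (hom_cset Y) l (Suc l) (?f p \<eta>) (v p' \<eta>') = act (hom_cset Y) l (Suc l) (?f (p' - 1) \<eta>') (v p \<eta>)"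
      unfolding 4 by (rule partial_mapD(5)[OF R])
    then show ?thesis using 1 2 3 by simp
  qed
  have pm0: "partial_map A (lcset m) Y ?Q R0"
    unfolding partial_map_def
  proof (intro conjI allI impI)
    fix n g y assume *: "(n, g, y) \<in> R0"
    obtain p \<eta> m' where h: "m = Suc m'" "p \<le> m'"
      "y = v p \<eta> n (postcomp n (degen (Suc m') (Suc p)) g)" "g \<in> lmaps n (Suc m')"
      "\<forall>w. length w = n \<longrightarrow> g w ! p = \<eta>" using R0D[OF *] by blast
    have V: "v p \<eta> \<in> cubes (hom_cset Y) m'" by (rule v(2)[OF h(1,2)])
    have D: "degen (Suc m') (Suc p) \<in> box_hom A (Suc m') m'" by (rule degen_hom[OF h(2)])
    show "g \<in> cubes (lcset m) n" using h by simp
    show "y \<in> cubes Y n" using hom_csetD(1)[OF V postcomp_lmaps[OF D h(4)]] h(3) by simp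
    show "y \<in> marked Y n" if "g \<in> marked (lcset m) n"
      using hom_csetD(3)[OF V lmarked_postcomp[OF D]] that h(1,3) by simp
  next
    fix n g y k \<psi> assume *: "(n, g, y) \<in> R0" and \<psi>: "\<psi> \<in> box_hom A k n"
    obtain p \<eta> m' where h: "m = Suc m'" "p \<le> m'"
      "y = v p \<eta> n (postcomp n (degen (Suc m') (Suc p)) g)" "g \<in> lmaps n (Suc m')"
      "\<forall>w. length w = n \<longrightarrow> g w ! p = \<eta>" using R0D[OF *] by blast
    have V: "v p \<eta> \<in> cubes (hom_cset Y) m'" by (rule v(2)[OF h(1,2)])
    have D: "degen (Suc m') (Suc p) \<in> box_hom A (Suc m') m'" by (rule degen_hom[OF h(2)])
    have "act Y k n \<psi> y = v p \<eta> k (postcomp k (degen (Suc m') (Suc p)) (precomp k \<psi> g))"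
      using hom_csetD(2)[OF V \<psi> postcomp_lmaps[OF D h(4)]] postcomp_precomp[OF \<psi>] h(3) by simp
    moreover have "(k, precomp k \<psi> g, v p \<eta> k (postcomp k (degen (Suc m') (Suc p)) (precomp k \<psi> g))) \<in> R0"
      by (rule R0I[OF h(1,2) precomp_lmaps[OF \<psi> h(4)]]) (use h(5) length_on_pairs[OF \<psi>] in simp)
    ultimately show "(k, act (lcset m) k n \<psi> g, act Y k n \<psi> y) \<in> R0" by simp
  next
    fix n g y y' assume *: "(n, g, y) \<in> R0" "(n, g, y') \<in> R0"
    obtain p \<eta> m' where h: "m = Suc m'" "p \<le> m'"
      "y = v p \<eta> n (postcomp n (degen (Suc m') (Suc p)) g)" "g \<in> lmaps n (Suc m')"
      "\<forall>w. length w = n \<longrightarrow> g w ! p = \<eta>" using R0D[OF *(1)] by blast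
    obtain p' \<eta>' m'' where h': "m = Suc m''" "p' \<le> m''"
      "y' = v p' \<eta>' n (postcomp n (degen (Suc m'') (Suc p')) g)" "g \<in> lmaps n (Suc m'')"
      "\<forall>w. length w = n \<longrightarrow> g w ! p' = \<eta>'" using R0D[OF *(2)] by blast
    have m'': "m'' = m'" using h(1) h'(1) by simp
    consider "p = p'" | "p < p'" | "p' < p" by linarith
    then show "y = y'"
    proof cases
      case 1
      then have "\<eta> = \<eta>'"
        using h(5)[rule_format, of "replicate n undefined"] h'(5)[rule_format, of "replicate n undefined"] by simp
      then show ?thesis using 1 h(3) h'(3) m'' by simp
    next
      case 2
      then show ?thesis using key[OF h(1) 2 _ h(4), of \<eta> \<eta>'] h h' m'' by simp
    next
      case 3
      then show ?thesis using key[OF h(1) 3 _ h(4), of \<eta>' \<eta>] h h' m'' by simp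
    qed
  qed
  let ?E = "via_fst m (idm m)"
  have E: "?E \<in> lmaps m m" using via_fst_lmaps[OF idm_in_hom] .
  have E_nd: "?E \<notin> degenerate A (lcset m) m"
    using marked_lcset[of m] via_fst_id_not_lmarked[of m] unfolding marked_cubical_set_def by auto
  have R0_nonfull: "\<not> full n m g" if "(n, g) \<in> pdomain R0" for n g
  proof -
    obtain y where "(n, g, y) \<in> R0" using \<open>(n, g) \<in> pdomain R0\<close> by (auto simp: pdomain_def)
    from R0D[OF this] obtain p \<eta> m' where p: "m = Suc m'" "p \<le> m'" "\<forall>w. length w = n \<longrightarrow> g w ! p = \<eta>"
      by blast
    then have "p < m" by simp
    show ?thesis
    proof
      assume "full n m g"
      from fullD[OF this \<open>p < m\<close>, of \<eta>] p(3) show False by auto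
    qed
  qed
  have E_full: "full m m ?E"
    unfolding full_def
  proof (intro allI impI)
    fix i \<eta> assume "i < m"
    then show "\<exists>w. length w = m \<and> ?E w ! i \<noteq> \<eta>" by (intro exI[of _ "replicate m (\<not> \<eta>, \<not> \<eta>)"]) simp
  qed
  have E_notin: "(m, ?E) \<notin> pdomain R0" using R0_nonfull E_full by blast
  \<comment> \<open>Deleting the constant coordinate from a face of the identity gives the smaller
    identity, where the family over the face of \<open>x\<close> takes the value of
    \<open>f\<close>, by the condition carried along with \<open>R\<close>.\<close>
  have Efaces: "(n, act (lcset m) n m (face m (Suc p) \<eta>) ?E, act Y n m (face m (Suc p) \<eta>) (f m x)) \<in> R0"
    if np: "m = Suc n" "p \<le> n" for n p \<eta>
  proof -
    have \<phi>: "face m (Suc p) \<eta> \<in> box_hom A n m" using face_hom[OF np(2)] np(1) by simp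
    let ?g = "precomp n (face (Suc n) (Suc p) \<eta>) ?E"
    have g: "?g \<in> lmaps n (Suc n)" using precomp_lmaps[OF \<phi> E] np(1) by simp
    have "(n, ?g, v p \<eta> n (postcomp n (degen (Suc n) (Suc p)) ?g)) \<in> R0"
      by (rule R0I[OF np g]) (use np in \<open>simp add: nth_insert_at\<close>)
    moreover have "postcomp n (degen (Suc n) (Suc p)) ?g = via_fst n (idm n)"
    proof (rule pair_cube_ext[of _ n])
      show "postcomp n (degen (Suc n) (Suc p)) ?g w = via_fst n (idm n) w" if "length w = n" for w
      proof -
        have "map fst (insert_at p (\<eta>, \<eta>) w) = insert_at p \<eta> (map fst w)"
          using that np(2) by (intro nth_equalityI) (auto simp: nth_insert_at)
        then show ?thesis using that np by (simp add: delete_at_insert_at)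
      qed
    qed (simp_all add: postcomp_def via_fst_def)
    moreover have "v p \<eta> n (via_fst n (idm n)) = act Y n m (face m (Suc p) \<eta>) (f m x)"
      using v(3)[OF np, of \<eta>] fn[OF \<phi> x] np(1) by (simp add: bd_def)
    ultimately show ?thesis using np(1) by simp
  qed
  have EQ: "?Q k (act (lcset m) k m \<theta> ?E) (act Y k m \<theta> (f m x))" if "epi A k m \<theta>" for k \<theta>
  proof -
    have "precomp m (idm m) ?E = ?E" using cubical_id[OF cubical_lcset[of m], of ?E m] E by simp
    then show ?thesis
      using epi_degenerate[OF that cY fc[OF x]] dY via_fst_id_not_lmarked[of m] by auto
  qed
  define R1
    where "R1 = R0 \<union> {(k, act (lcset m) k m \<theta> ?E, act Y k m \<theta> (f m x)) | k \<theta>. \<theta> \<in> box_hom A k m}"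
  have EW: "?E \<in> cubes (lcset m) m" using E by simp
  note at = partial_map_attach[where Q = ?Q, OF A_subset cubical_lcset cY pm0 EW E_nd E_notin fc[OF x] Efaces EQ, folded R1_def]
  have at1: "partial_map A (lcset m) Y ?Q R1" by (rule at(1); assumption)
  have at2: "(m, ?E, f m x) \<in> R1" by (rule at(2); assumption)
  have at3: "(k, w) \<in> pdomain R0 \<or> (k, w) = (m, ?E)"
    if "(k, w) \<in> pdomain R1" "w \<notin> degenerate A (lcset m) k" for k w
    by (rule at(3)[OF _ _ _ that]; assumption)
  have R0R1: "R0 \<subseteq> R1" by (auto simp: R1_def)
  have nonfull: "(n, g) \<in> pdomain R1" if g: "g \<in> lmaps n m" "\<not> full n m g" for n g
  proof -
    obtain p \<eta> where "p < m" "\<forall>w. length w = n \<longrightarrow> g w ! p = \<eta>" using g(2) unfolding full_def by blast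
    then have "(n, g, v p \<eta> n (postcomp n (degen m (Suc p)) g)) \<in> R0" unfolding R0_def using g(1)
      by blast
    then show ?thesis using R0R1 by (auto simp: pdomain_def)
  qed
  have idR1: "(m, ?E) \<in> pdomain R1" using at2 by (auto simp: pdomain_def)
  have only: "(n, g) = (m, ?E)" if "(n, g) \<in> pdomain R1" "nondegenerate n m g" "full n m g" for n g
    using at3[OF that(1)] that(2,3) R0_nonfull unfolding nondegenerate_def by blast
  obtain R2 where R2: "R1 \<subseteq> R2" "partial_map A (lcset m) Y ?Q R2" "\<And>n g. g \<in> lmaps n m \<Longrightarrow>
    (n, g) \<in> pdomain R2"
    using extend_full[OF Y at1 nonfull idR1 only] by blast
  \<comment> \<open>The fixed default outside \<open>lmaps n m\<close> makes families that agree on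
    labelled maps equal as cubes of \<open>hom_cset Y\<close>.\<close>
  define H where "H n g = (if g \<in> lmaps n m then SOME y. (n, g, y) \<in> R2 else undefined)" for n g
  have HR2: "(n, g, H n g) \<in> R2" if "g \<in> lmaps n m" for n g
    using R2(3)[OF that] someI_ex[of "\<lambda>y. (n, g, y) \<in> R2"] that by (simp add: H_def pdomain_def)
  have HI: "H n g = y" if "(n, g, y) \<in> R2" for n g y
  proof -
    have "g \<in> lmaps n m" using partial_mapD(1)[OF R2(2) that] by simp
    from partial_mapD(5)[OF R2(2) that HR2[OF this]] show ?thesis .
  qed
  have HY: "H \<in> cubes (hom_cset Y) m"
  proof (rule hom_csetI)
    show "H n g \<in> cubes Y n" if "g \<in> lmaps n m" for n g using partial_mapD(2)[OF R2(2) HR2[OF that]] .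
    show "H k (precomp k \<psi> g) = act Y k n \<psi> (H n g)" if "\<psi> \<in> box_hom A k n" "g \<in> lmaps n m" for k n \<psi> g
      using partial_mapD(4)[OF R2(2) HR2[OF that(2)] that(1)] HI by simp
    show "H n g \<in> marked Y n" if "g \<in> lmarked n m" for n g
      using partial_mapD(3)[OF R2(2) HR2[of g n]] that by (simp add: lmarked_def)
  qed (simp add: H_def)
  moreover have "H m ?E = f m x" using HI at2 R2(1) by blast
  moreover have "(n, act X n m (face m (Suc p) \<eta>) x, act (hom_cset Y) n m (face m (Suc p) \<eta>) H) \<in> R"
    if np: "m = Suc n" "p \<le> n" for n p \<eta>
  proof -
    have \<phi>: "face (Suc n) (Suc p) \<eta> \<in> box_hom A n (Suc n)" using face_hom[OF np(2)] .
    have "act (hom_cset Y) n m (face m (Suc p) \<eta>) H k g = v p \<eta> k g" for k g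
    proof (cases "g \<in> lmaps k n")
      case False
      then show ?thesis
        using act_hom_cset_undefined[where Y=Y, OF False] hom_csetD(4)[OF v(2)[OF np] False] by simp
    next
      case True
      let ?g = "postcomp k (face (Suc n) (Suc p) \<eta>) g"
      have "(k, ?g, v p \<eta> k (postcomp k (degen (Suc n) (Suc p)) ?g)) \<in> R0"
        by (rule R0I[OF np postcomp_lmaps[OF \<phi> True]]) (use lmapsD(2)[OF True] np(2) in \<open>simp add: nth_insert_at\<close>)
      then have "H k ?g = v p \<eta> k g" using HI R0R1 R2(1) postcomp_degen_face[OF True np(2)]
        by (metis subsetD)
      then show ?thesis using act_hom_cset[where Y=Y, OF True] np(1) by simp
    qed
    then have "act (hom_cset Y) n m (face m (Suc p) \<eta>) H = v p \<eta>" by (intro ext)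
    then show ?thesis using vR[OF np, of \<eta>] np(1) by (simp add: bd_def)
  qed
  ultimately show ?thesis by blast
qed

text \<open>Lifts \<open>f\<close> along evaluation at the identity over all of \<open>X\<close>. A
  missing nondegenerate cube of least dimension has its boundary in the domain, so
  \<open>boundary_extension\<close> applies to it. Cells are attached singly, and the matching is
  taken empty.\<close>

lemma weak_structure_family:
  fixes X :: "'x mcset" and Y :: "'y mcset"
  assumes X: "marked_cubical_set A X" and Y: "comical_set A Y" and f: "marked_map A X Y f"
  shows "\<exists>v. (\<forall>m. \<forall>x\<in>cubes X m. v m x \<in> cubes (hom_cset Y) m \<and> v m x m (via_fst m (idm m)) = f m x) \<and>
    (\<forall>k m \<alpha>. \<forall>x\<in>cubes X m. \<alpha> \<in> box_hom A k m \<longrightarrow> v k (act X k m \<alpha> x) = act (hom_cset Y) k m \<alpha> (v m x))"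
proof -
  let ?Q = "\<lambda>k x H. H k (via_fst k (idm k)) = f k x"
  have cX: "cubical_set A X" using X by (simp add: marked_cubical_set_def)
  have step: "\<exists>R'. R \<subset> R' \<and> partial_map A X (hom_cset Y) ?Q R' \<and> saturated {} R'"
    if "{} \<subseteq> R" and R: "partial_map A X (hom_cset Y) ?Q R" and "saturated {} R"
      and w: "w \<in> cubes X n" "w \<notin> degenerate A X n" "(n, w) \<notin> pdomain R" for R n w
  proof -
    define P where "P n \<longleftrightarrow> (\<exists>w. w \<in> cubes X n \<and> w \<notin> degenerate A X n \<and> (n, w) \<notin> pdomain R)" for n
    have "P n" using w by (auto simp: P_def)
    define m where "m = (LEAST n. P n)"
    have "P m" unfolding m_def by (rule LeastI[of P, OF \<open>P n\<close>])
    then obtain x where x: "x \<in> cubes X m" "x \<notin> degenerate A X m" "(m, x) \<notin> pdomain R"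
      by (auto simp: P_def)
    have nd: "(k, y) \<in> pdomain R" if "k < m" "y \<in> cubes X k" "y \<notin> degenerate A X k" for k y
      using not_less_Least[of k P] that unfolding m_def P_def by blast
    have small: "(k, y) \<in> pdomain R" if "k < m" "y \<in> cubes X k" for k y
      using that
    proof (induction k arbitrary: y)
      case 0
      then show ?case using nd[OF 0(1,2)] by (simp add: degenerate_0)
    next
      case (Suc k)
      show ?case
      proof (cases "y \<in> degenerate A X (Suc k)")
        case False
        then show ?thesis by (rule nd[OF Suc.prems])
      next
        case True
        then show ?thesis
        proof (cases rule: degenerateE)
          case (1 k' p z)
          then have "(k, z) \<in> pdomain R" using Suc.IH[of z] Suc.prems(1) by simp
          from pdomain_act[OF R this degen_hom[of p k]] show ?thesis using 1 by simp
        next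
          case (2 k' p z b)
          then have "(k, z) \<in> pdomain R" using Suc.IH[of z] Suc.prems(1) by simp
          from pdomain_act[OF R this conn_hom[of b A p k]] show ?thesis using 2 by simp
        qed
      qed
    qed
    have faces: "(n, act X n m (face m (Suc p) \<eta>) x) \<in> pdomain R" if "m = Suc n" "p \<le> n" for n p \<eta>
      using small[of n] cubical_act[OF cX face_hom[OF that(2)]] x(1) that(1) by simp
    obtain H where H: "H \<in> cubes (hom_cset Y) m" "H m (via_fst m (idm m)) = f m x"
      "\<And>n p \<eta>. m = Suc n \<Longrightarrow> p \<le> n \<Longrightarrow>
        (n, act X n m (face m (Suc p) \<eta>) x, act (hom_cset Y) n m (face m (Suc p) \<eta>) H) \<in> R"
      using boundary_extension[OF X Y f R x(1) faces] by blast
    \<comment> \<open>For degeneracies of \<open>x\<close> the lift condition follows from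
      naturality, as \<theta> is both a postcomposite and a precomposite of an identity.\<close>
    have Q: "?Q k (act X k m \<theta> x) (act (hom_cset Y) k m \<theta> H)" if "epi A k m \<theta>" for k \<theta>
    proof -
      note \<theta> = epi_hom[OF that]
      have E: "via_fst m (idm m) \<in> lmaps m m" "via_fst k (idm k) \<in> lmaps k k"
        using via_fst_lmaps[OF idm_in_hom] by auto
      have "act (hom_cset Y) k m \<theta> H k (via_fst k (idm k)) = H k (postcomp k \<theta> (via_fst k (idm k)))"
        by (rule act_hom_cset[where Y=Y, OF E(2)])
      also have "postcomp k \<theta> (via_fst k (idm k)) = via_fst k \<theta>"
        using postcomp_via_fst[OF idm_in_hom, of k \<theta>] compose_idm_right[OF \<theta>] by simp
      also have "via_fst k \<theta> = precomp k \<theta> (via_fst m (idm m))"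
        using precomp_via_fst[OF \<theta>, of "idm m"] compose_idm_left[OF \<theta>] by simp
      also have "H k (precomp k \<theta> (via_fst m (idm m))) = act Y k m \<theta> (f m x)"
        using hom_csetD(2)[OF H(1) \<theta> E(1)] H(2) by simp
      also have "\<dots> = f k (act X k m \<theta> x)" using f \<theta> x(1) unfolding marked_map_def by simp
      finally show ?thesis .
    qed
    note at = partial_map_attach[where Q = ?Q, OF A_subset cX cubical_hom_cset[of Y] R x H(1,3) Q]
    show ?thesis
    proof (intro exI conjI)
      show "partial_map A X (hom_cset Y) ?Q (R \<union> {(k, act X k m \<theta> x, act (hom_cset Y) k m \<theta> H) | k \<theta>. \<theta> \<in> box_hom A k m})"
        by (rule at(1); assumption)
      show "R \<subset> R \<union> {(k, act X k m \<theta> x, act (hom_cset Y) k m \<theta> H) | k \<theta>. \<theta> \<in> box_hom A k m}"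
        using at(2) x(3) by (auto simp: pdomain_def)
    qed (simp add: saturated_def)
  qed
  have "partial_map A X (hom_cset Y) ?Q {}" "saturated {} {}"
    by (simp_all add: partial_map_def saturated_def)
  then have "\<exists>R. {} \<subseteq> R \<and> partial_map A X (hom_cset Y) ?Q R \<and> (\<forall>n. \<forall>x\<in>cubes X n. (n, x) \<in> pdomain R)"
    by (rule partial_map_total[OF cX cubical_hom_cset[of Y]]) (rule step; assumption)
  then obtain R where R: "partial_map A X (hom_cset Y) ?Q R" "\<And>n x. x \<in> cubes X n \<Longrightarrow>
    (n, x) \<in> pdomain R" by blast
  define v where "v n x = (SOME H. (n, x, H) \<in> R)" for n x
  have vR: "(n, x, v n x) \<in> R" if "x \<in> cubes X n" for n x
    using R(2)[OF that] someI_ex[of "\<lambda>H. (n, x, H) \<in> R"] by (simp add: v_def pdomain_def)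
  show ?thesis
  proof (intro exI[of _ v] conjI allI ballI impI)
    show "v m x \<in> cubes (hom_cset Y) m" "v m x m (via_fst m (idm m)) = f m x" if "x \<in> cubes X m" for m x
      using partial_mapD(2,3)[OF R(1) vR[OF that]] by auto
    show "v k (act X k m \<alpha> x) = act (hom_cset Y) k m \<alpha> (v m x)" if "x \<in> cubes X m"
      "\<alpha> \<in> box_hom A k m" for k m \<alpha> x
      using partial_mapD(5)[OF R(1) partial_mapD(4)[OF R(1) vR[OF that(1)] that(2)] vR[OF cubical_act[OF cX that(2,1)]]] .
  qed
qed

text \<open>The cube represented by \<phi> and \<open>x\<close> is sent to the family of
  \<open>x\<close>, evaluated at \<phi>. Naturality in \<open>x\<close> makes this independent of
  the representative, naturality in the source of \<phi> gives a cubical map, and degenerate cubes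
  over Box_B go to marked ones because their labelled maps are marked.\<close>

lemma weak_connection_structure_exists:
  fixes X :: "'x mcset" and Y :: "'y mcset"
  assumes AB: "A \<subseteq> B" and X: "marked_cubical_set A X" and Y: "comical_set A Y"
    and f: "marked_map A X Y f"
  shows "\<exists>\<Gamma>. weak_connection_structure A B X Y f \<Gamma>"
proof -
  obtain v where v: "\<And>m x. x \<in> cubes X m \<Longrightarrow> v m x \<in> cubes (hom_cset Y) m"
    "\<And>m x. x \<in> cubes X m \<Longrightarrow> v m x m (via_fst m (idm m)) = f m x"
    "\<And>k m \<alpha> x. x \<in> cubes X m \<Longrightarrow> \<alpha> \<in> box_hom A k m \<Longrightarrow> v k (act X k m \<alpha> x) = act (hom_cset Y) k m \<alpha> (v m x)"
    using weak_structure_family[OF X Y f] by blast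
  define F where "F n = (\<lambda>(m, \<phi>, x). v m x n (via_fst n \<phi>))" for n
  define \<Gamma> where "\<Gamma> n c = F n (SOME t. t \<in> c)" for n c
  have inv: "F n s = F n t" if "kan_step A B X n s t" for n s t
    using that
  proof cases
    case (1 \<phi> m \<alpha> m' x)
    have "F n s = v m' x n (postcomp n \<alpha> (via_fst n \<phi>))" using 1 postcomp_via_fst[OF 1(3)]
      by (simp add: F_def)
    also have "\<dots> = act (hom_cset Y) m m' \<alpha> (v m' x) n (via_fst n \<phi>)"
      using act_hom_cset[where Y=Y, OF via_fst_lmaps[OF 1(3)]] by simp
    also have "\<dots> = F n t" using v(3)[OF 1(5,4)] 1(2) by (simp add: F_def)
    finally show ?thesis .
  qed
  have \<Gamma>: "\<Gamma> n (kan_class A B X n t) = F n t" for n t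
    unfolding \<Gamma>_def
    by (rule kan_step_invariant[OF someI[of "\<lambda>s. s \<in> kan_class A B X n t"] inv]) (rule kan_class_self)
  have \<Gamma>': "\<Gamma> n (kan_class A B X n (m, \<phi>, x)) = v m x n (via_fst n \<phi>)" for n m \<phi> x
    by (simp add: \<Gamma> F_def)
  have eta: "\<Gamma> n (eta A B X n x) = f n x" if "x \<in> cubes X n" for n x
    using v(2)[OF that] by (simp add: eta_def \<Gamma>')
  have sub: "\<psi> \<in> box_hom B k n" if "\<psi> \<in> box_hom A k n" for \<psi> k n using box_hom_mono[OF AB] that by blast
  have deg: "\<Gamma> n c \<in> marked Y n" if c: "c \<in> degenerate B (kan_ext A B X) n" for n c
    using c
  proof (cases rule: degenerateE)
    case (1 n' p b)
    obtain m \<phi> x where b: "\<phi> \<in> box_hom B n' m" "x \<in> cubes X m" "b = kan_class A B X n' (m, \<phi>, x)"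
      using 1(3) by (auto simp: cubes_kan_ext)
    let ?\<phi> = "compose (cube (Suc n')) \<phi> (degen (Suc n') (Suc p))"
    have \<phi>: "?\<phi> \<in> box_hom B (Suc n') m" by (rule compose_in_hom[OF degen_hom[OF 1(2)] b(1)])
    have "via_fst (Suc n') ?\<phi> \<in> lmarked (Suc n') m"
    proof (rule lmarked_degen[OF 1(2) via_fst_lmaps[OF \<phi>]])
      fix w :: "(bool \<times> bool) list" and a assume "length w = Suc n'"
      then show "via_fst (Suc n') ?\<phi> (w[p := a]) = via_fst (Suc n') ?\<phi> w"
        using 1(2) by (simp add: map_update delete_at_update_same)
    qed
    then have "v m x (Suc n') (via_fst (Suc n') ?\<phi>) \<in> marked Y (Suc n')"
      by (rule hom_csetD(3)[OF v(1)[OF b(2)]])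
    then show ?thesis using 1(1,4) b(3) by (simp add: act_kan_ext[OF degen_hom[OF 1(2)]] \<Gamma>')
  next
    case (2 n' p b e')
    obtain m \<phi> x where b: "\<phi> \<in> box_hom B n' m" "x \<in> cubes X m" "b = kan_class A B X n' (m, \<phi>, x)"
      using 2(4) by (auto simp: cubes_kan_ext)
    let ?\<phi> = "compose (cube (Suc n')) \<phi> (conn (Suc n') (Suc p) e')"
    have \<phi>: "?\<phi> \<in> box_hom B (Suc n') m" by (rule compose_in_hom[OF conn_hom[OF 2(3,2)] b(1)])
    have fst_cn: "map fst (merge_at (join_pair e') p w) = merge_at (join e') p (map fst w)"
      if "length w = Suc n'" for w
      using that 2(2) by (intro nth_equalityI) (auto simp: nth_merge_at join_pair_def)
    have "via_fst (Suc n') ?\<phi> \<in> lmarked (Suc n') m"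
    proof (rule lmarked_conn[OF 2(2) via_fst_lmaps[OF \<phi>]])
      fix w w' :: "(bool \<times> bool) list"
      assume "length w = Suc n'" "length w' = Suc n'"
        "merge_at (join_pair e') p w = merge_at (join_pair e') p w'"
      then show "via_fst (Suc n') ?\<phi> w = via_fst (Suc n') ?\<phi> w'"
        using 2(2) fst_cn[of w] fst_cn[of w'] by simp
    qed
    then have "v m x (Suc n') (via_fst (Suc n') ?\<phi>) \<in> marked Y (Suc n')"
      by (rule hom_csetD(3)[OF v(1)[OF b(2)]])
    then show ?thesis using 2(1,5) b(3) by (simp add: act_kan_ext[OF conn_hom[OF 2(3,2)]] \<Gamma>')
  qed
  have "marked_map A (i_star A (i_shriek A B X)) Y \<Gamma>"
    unfolding marked_map_def i_star_simps(1,2) i_shriek_simps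
  proof (intro conjI allI ballI)
    show "\<Gamma> n \<in> cubes (kan_ext A B X) n \<rightarrow> cubes Y n" for n
    proof
      fix c assume "c \<in> cubes (kan_ext A B X) n"
      then obtain m \<phi> x where "\<phi> \<in> box_hom B n m" "x \<in> cubes X m" "c = kan_class A B X n (m, \<phi>, x)"
        by (auto simp: cubes_kan_ext)
      then show "\<Gamma> n c \<in> cubes Y n" using hom_csetD(1)[OF v(1) via_fst_lmaps] \<Gamma>' by simp
    qed
    show "\<Gamma> k (act (i_star A (i_shriek A B X)) k n \<psi> c) = act Y k n \<psi> (\<Gamma> n c)"
      if \<psi>: "\<psi> \<in> box_hom A k n" and c: "c \<in> cubes (kan_ext A B X) n" for k n \<psi> c
    proof -
      obtain m \<phi> x where *: "\<phi> \<in> box_hom B n m" "x \<in> cubes X m" "c = kan_class A B X n (m, \<phi>, x)"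
        using c by (auto simp: cubes_kan_ext)
      have "\<Gamma> k (act (i_star A (i_shriek A B X)) k n \<psi> c) = v m x k (via_fst k (compose (cube k) \<phi> \<psi>))"
        using *(3) by (simp add: i_shriek_simps i_star_simps(3)[OF \<psi>] act_kan_ext[OF sub[OF \<psi>]] \<Gamma>')
      also have "\<dots> = v m x k (precomp k \<psi> (via_fst n \<phi>))" using precomp_via_fst[OF \<psi>, of \<phi>] by simp
      also have "\<dots> = act Y k n \<psi> (v m x n (via_fst n \<phi>))"
        by (rule hom_csetD(2)[OF v(1)[OF *(2)] \<psi> via_fst_lmaps[OF *(1)]])
      finally show ?thesis using *(3) \<Gamma>' by simp
    qed
    show "\<Gamma> n \<in> degenerate B (kan_ext A B X) n \<union> eta A B X n ` marked X n \<rightarrow> marked Y n" for n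
    proof
      fix c assume "c \<in> degenerate B (kan_ext A B X) n \<union> eta A B X n ` marked X n"
      then consider "c \<in> degenerate B (kan_ext A B X) n" | x where "x \<in> marked X n"
        "c = eta A B X n x" by blast
      then show "\<Gamma> n c \<in> marked Y n"
      proof cases
        case 1 then show ?thesis by (rule deg)
      next
        case 2
        then have "x \<in> cubes X n" using X unfolding marked_cubical_set_def by blast
        then show ?thesis using eta 2 f unfolding marked_map_def by fastforce
      qed
    qed
  qed
  then show ?thesis using eta unfolding weak_connection_structure_def by blast
qed

end

theorem corollary2p32:
  fixes A B :: "bool set"
    and X :: "'x mcset" and Y :: "'y mcset" and f :: "nat \<Rightarrow> 'x \<Rightarrow> 'y"
  assumes "A \<subseteq> B"
    and "marked_cubical_set A X"
    and "comical_set A Y"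
    and "marked_map A X Y f"
  shows "\<exists>\<Gamma>. weak_connection_structure A B X Y f \<Gamma>"
proof (cases "A = UNIV")
  case True
  then have BA: "B = A" using assms(1) by auto
  \<comment> \<open>With all connections already in \<open>A\<close>, the universal property of
    \<open>eta\<close> applies to \<open>f\<close> and \<open>Y\<close> themselves.\<close>
  have "marked_map A X (i_star A Y) f"
    using assms(4) unfolding marked_map_def i_star_simps(1,2) by (auto simp: i_star_simps(3))
  then obtain h where h: "marked_map A (i_shriek A A X) Y h"
    "\<forall>n. \<forall>x\<in>cubes X n. h n (eta A A X n x) = f n x"
    using eta_universal(1)[OF order_refl assms(2)] assms(3) unfolding comical_set_def by blast
  have "marked_map A (i_star A (i_shriek A A X)) Y h"
    using h(1) unfolding marked_map_def i_star_simps(1,2) by (auto simp: i_star_simps(3))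
  then show ?thesis using h(2) BA unfolding weak_connection_structure_def by blast
next
  case False
  \<comment> \<open>At most the connection opposite to \<open>e\<close> is left. If
    \<open>A = {}\<close>, the neutral element may be either one and the labels are the formal
    edges; if \<open>A = {\<not> e}\<close>, the neutral element is \<open>\<not> e\<close> and the
    labels are the variables.\<close>
  then obtain e where "e \<notin> A" by auto
  then have "x = (\<not> e)" if "x \<in> A" for x using that by (cases x; cases e) auto
  then have "A = {} \<or> A = {\<not> e}" by blast
  then show ?thesis
  proof
    assume "A = {}"
    then interpret labelled A e snd by unfold_locales simp
    show ?thesis by (rule weak_connection_structure_exists[OF assms])
  next
    assume "A = {\<not> e}"
    then interpret labelled A "\<not> e" fst by unfold_locales simp
    show ?thesis by (rule weak_connection_structure_exists[OF assms])
  qed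
qed

end
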